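(* There is a constant $C>0$ such that for all $z\in\mathbb{C}$ the dynamical determinant $d$ of $T$ satisfies $$|d(z)|\le F\big(C|z|\,G(C|z|)\big),$$ where $F$ and $G$ are the entire functions $$F(z)=(1+z)\prod_{m=1}^{+\infty}\big(1+f(m)z\big),\qquad G(z)=\sum_{n=0}^{+\infty}\Big(\prod_{k=0}^{n-1}g(k)\Big)z^n,$$ with $$f(x)=x^\alpha w\Big(\frac{R'}{x}\Big)\ (x>0),\quad \alpha=\frac{\log\lambda}{\log\theta},\qquad g(N)=\sup_{m\ge N}\frac{w(R/\theta^m)}{w(R/\theta^{m-1})}\ (N\in\mathbb{N}).$$
   Context: $\mathbb{S}^1=\mathbb{R}/\mathbb{Z}$, $\mathbb{N}=\{0,1,2,\dots\}$. $M=(M_k)_{k\in\mathbb{N}}$ is a fixed non-decreasing, logarithmically convex ($M_k^2\le M_{k-1}M_{k+1}$ for $k\ge1$) sequence of positive reals with $M_0=1$. A $\mathcal{C}^\infty$ function $h:\mathbb{S}^1\to\mathbb{C}$ belongs to $\mathcal{C}^M$ if there are $C,R>0$ with $|h^{(k)}(x)|\le CR^kk!M_k$ for all $k\in\mathbb{N}$, $x\in\mathbb{S}^1$. $w(x)=\inf_{k\in\mathbb{N}}x^kk!M_k$ for $x>0$. $\lambda>1$ and $T:\mathbb{S}^1\to\mathbb{S}^1$ satisfies $|T'(x)|>\lambda$ for all $x$, with $T'\in\mathcal{C}^M$. The transfer operator is $\mathcal{L}\varphi(x)=\sum_{y:\,Ty=x}\frac{1}{|T'(y)|}\varphi(y)$.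 Put $\mathrm{tr}^\flat(\mathcal{L}^n)=\sum_{x:\,T^nx=x}\frac{1}{|1-(T^n)'(x)|}$; the dynamical determinant $d$ is the entire continuation of $z\mapsto\exp(-\sum_{n\ge1}\frac1n\mathrm{tr}^\flat(\mathcal{L}^n)z^n)$, which is defined for $|z|$ small. Fix $\theta\in\,]1,\lambda[$. Let $e_k(x)=e^{2i\pi kx}$, and let $\pi_n$ be the orthogonal projectors on $L^2(\mathbb{S}^1)$ given by $\pi_0u=\langle u,e_0\rangle e_0$ and $\pi_nu=\sum_{\theta^{n-1}\le|k|<\theta^n}\langle u,e_k\rangle e_k$ for $n\ge1$. Fix $R>0$ such that, for some $C_0>0$, $\|\pi_m\mathcal{L}\pi_nu\|_{L^2}\le C_0\,w(R/\theta^m)\,\theta^{(m+n)/2}\|\pi_nu\|_{L^2}$ for all $m\ge n\ge0$ and $u\in L^2(\mathbb{S}^1)$ (such $R$ exists). $\mathcal{H}$ is the Hilbert space of $u\in L^2(\mathbb{S}^1)$ with $\|u\|_{\mathcal{H}}^2=\sum_{m\in\mathbb{N}}\lambda^{-2m}w(R/\theta^{m-1})^{-2}\|\pi_mu\|_{L^2}^2<\infty$. The operator $\mathcal{L}_c$ is the limit, in operator norm from $L^2(\mathbb{S}^1)$ to $\mathcal{H}$, of $A_N=\sum_{0\le n\le m\le N}\pi_m\mathcal{L}\pi_n$. Finally $R'>0$ is a fixed constant such that, for some $C_1>0$, the singular values $(s_\ell)_{\ell\in\mathbb{N}}$ (non-increasing, indexed from $0$) of $\mathcal{L}_c$ acting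 on $\mathcal{H}$ satisfy $s_\ell\le C_1\,\ell^\alpha w(R'/\ell)$ for all $\ell\ge1$ (such $R'$ exists). *)

theory Defs
  imports "HOL-Analysis.Analysis"
begin

text \<open>
  The circle is \<open>\<real>/\<int>\<close>: a function on it is a 1-periodic function on \<open>\<real>\<close>, its points are
  represented by \<open>{0..<1}\<close>, and a circle map is given by a continuous lift \<open>\<real> \<rightarrow> \<real>\<close>.
\<close>

definition periodic1 :: "(real \<Rightarrow> 'a) \<Rightarrow> bool" where
  "periodic1 h \<longleftrightarrow> (\<forall>x. h (x + 1) = h x)"

definition circle_lift :: "(real \<Rightarrow> real) \<Rightarrow> bool" where
  "circle_lift T \<longleftrightarrow> continuous_on UNIV T \<and> (\<forall>x. T (x + 1) - T x \<in> \<int>)"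

definition weight_sequence :: "(nat \<Rightarrow> real) \<Rightarrow> bool" where
  "weight_sequence M \<longleftrightarrow>
     (\<forall>k. M k > 0) \<and> M 0 = 1 \<and> mono M \<and> (\<forall>k\<ge>1. (M k)\<^sup>2 \<le> M (k - 1) * M (k + 1))"

definition nth_deriv :: "nat \<Rightarrow> (real \<Rightarrow> complex) \<Rightarrow> real \<Rightarrow> complex" where
  "nth_deriv k h = ((\<lambda>g x. vector_derivative g (at x)) ^^ k) h"

definition class_CM :: "(nat \<Rightarrow> real) \<Rightarrow> (real \<Rightarrow> complex) set" where
  "class_CM M = {h. periodic1 h \<and> (\<forall>k x. nth_deriv k h differentiable (at x)) \<and>
     (\<exists>C>0. \<exists>R>0. \<forall>k x. cmod (nth_deriv k h x) \<le> C * R ^ k * fact k * M k)}"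

definition wfun :: "(nat \<Rightarrow> real) \<Rightarrow> real \<Rightarrow> real" where
  "wfun M x = (INF k. x ^ k * fact k * M k)"

definition transfer :: "(real \<Rightarrow> real) \<Rightarrow> (real \<Rightarrow> complex) \<Rightarrow> real \<Rightarrow> complex" where
  "transfer T \<phi> x = (\<Sum>y\<in>{y\<in>{0..<1}. T y - x \<in> \<int>}. of_real (1 / \<bar>deriv T y\<bar>) * \<phi> y)"

definition flat_trace :: "(real \<Rightarrow> real) \<Rightarrow> nat \<Rightarrow> real" where
  "flat_trace T n = (\<Sum>x\<in>{x\<in>{0..<1}. (T ^^ n) x - x \<in> \<int>}. 1 / \<bar>1 - deriv (T ^^ n) x\<bar>)"

definition is_dynamical_determinant :: "(real \<Rightarrow> real) \<Rightarrow> (complex \<Rightarrow> complex) \<Rightarrow> bool" where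
  "is_dynamical_determinant T d \<longleftrightarrow> d holomorphic_on UNIV \<and>
     (\<forall>\<^sub>F z in nhds 0.
        d z = exp (- (\<Sum>n. 1 / of_nat (Suc n) * of_real (flat_trace T (Suc n)) * z ^ Suc n)))"

text \<open>Elements are functions; equality of classes is equality almost everywhere.\<close>

definition L2 :: "(real \<Rightarrow> complex) set" where
  "L2 = {u. periodic1 u \<and> u \<in> borel_measurable borel \<and>
            set_integrable lborel {0..<1} (\<lambda>x. (cmod (u x))\<^sup>2)}"

definition L2_inner :: "(real \<Rightarrow> complex) \<Rightarrow> (real \<Rightarrow> complex) \<Rightarrow> complex" where
  "L2_inner u v = (LINT x:{0..<1}|lborel. u x * cnj (v x))"

definition L2_norm :: "(real \<Rightarrow> complex) \<Rightarrow> real" where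
  "L2_norm u = sqrt (LINT x:{0..<1}|lborel. (cmod (u x))\<^sup>2)"

definition fourier_e :: "int \<Rightarrow> real \<Rightarrow> complex" where
  "fourier_e k x = exp (2 * \<i> * of_real pi * of_int k * of_real x)"

definition freq_block :: "real \<Rightarrow> nat \<Rightarrow> int set" where
  "freq_block \<theta> n =
     (if n = 0 then {0} else {k. \<theta> ^ (n - 1) \<le> \<bar>real_of_int k\<bar> \<and> \<bar>real_of_int k\<bar> < \<theta> ^ n})"

definition proj :: "real \<Rightarrow> nat \<Rightarrow> (real \<Rightarrow> complex) \<Rightarrow> real \<Rightarrow> complex" where
  "proj \<theta> n u x = (\<Sum>k\<in>freq_block \<theta> n. L2_inner u (fourier_e k) * fourier_e k x)"

definition H_weight :: "(nat \<Rightarrow> real) \<Rightarrow> real \<Rightarrow> real \<Rightarrow> real \<Rightarrow> nat \<Rightarrow> real" where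
  "H_weight M lam \<theta> R m =
     lam powi (- 2 * int m) * wfun M (R / \<theta> powi (int m - 1)) powi (- 2)"

definition H_space :: "(nat \<Rightarrow> real) \<Rightarrow> real \<Rightarrow> real \<Rightarrow> real \<Rightarrow> (real \<Rightarrow> complex) set" where
  "H_space M lam \<theta> R =
     {u \<in> L2. summable (\<lambda>m. H_weight M lam \<theta> R m * (L2_norm (proj \<theta> m u))\<^sup>2)}"

definition H_norm :: "(nat \<Rightarrow> real) \<Rightarrow> real \<Rightarrow> real \<Rightarrow> real \<Rightarrow> (real \<Rightarrow> complex) \<Rightarrow> real" where
  "H_norm M lam \<theta> R u = sqrt (\<Sum>m. H_weight M lam \<theta> R m * (L2_norm (proj \<theta> m u))\<^sup>2)"

definition H_inner ::
  "(nat \<Rightarrow> real) \<Rightarrow> real \<Rightarrow> real \<Rightarrow> real \<Rightarrow> (real \<Rightarrow> complex) \<Rightarrow> (real \<Rightarrow> complex) \<Rightarrow> complex" where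
  "H_inner M lam \<theta> R u v =
     (\<Sum>m. of_real (H_weight M lam \<theta> R m) * L2_inner (proj \<theta> m u) (proj \<theta> m v))"

definition A_trunc ::
  "(real \<Rightarrow> real) \<Rightarrow> real \<Rightarrow> nat \<Rightarrow> (real \<Rightarrow> complex) \<Rightarrow> real \<Rightarrow> complex" where
  "A_trunc T \<theta> N u x = (\<Sum>m\<le>N. \<Sum>n\<le>m. proj \<theta> m (transfer T (proj \<theta> n u)) x)"

text \<open>
  Convergence in operator norm from \<open>L2\<close> to the weighted space. Linearity of the limit (almost
  everywhere) follows, as the approximating operators are linear.
\<close>

definition is_Lc ::
  "(nat \<Rightarrow> real) \<Rightarrow> real \<Rightarrow> (real \<Rightarrow> real) \<Rightarrow> real \<Rightarrow> real
     \<Rightarrow> ((real \<Rightarrow> complex) \<Rightarrow> real \<Rightarrow> complex) \<Rightarrow> bool" where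
  "is_Lc M lam T \<theta> R A \<longleftrightarrow> (\<forall>u\<in>L2. A u \<in> H_space M lam \<theta> R) \<and>
     (\<forall>\<epsilon>>0. \<forall>\<^sub>F N in sequentially. \<forall>u\<in>L2.
        (\<lambda>x. A u x - A_trunc T \<theta> N u x) \<in> H_space M lam \<theta> R \<and>
        H_norm M lam \<theta> R (\<lambda>x. A u x - A_trunc T \<theta> N u x) \<le> \<epsilon> * L2_norm u)"

definition adjoint_on ::
  "(real \<Rightarrow> complex) set \<Rightarrow> ((real \<Rightarrow> complex) \<Rightarrow> (real \<Rightarrow> complex) \<Rightarrow> complex)
     \<Rightarrow> ((real \<Rightarrow> complex) \<Rightarrow> real \<Rightarrow> complex) \<Rightarrow> ((real \<Rightarrow> complex) \<Rightarrow> real \<Rightarrow> complex) \<Rightarrow> bool" where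
  "adjoint_on V ip A A' \<longleftrightarrow>
     (\<forall>v\<in>V. A' v \<in> V) \<and> (\<forall>u\<in>V. \<forall>v\<in>V. ip (A u) v = ip u (A' v))"

text \<open>
  For a compact operator \<open>A\<close> on an infinite-dimensional Hilbert space \<open>V\<close>: \<open>s\<close> lists, in
  non-increasing order, the square roots of the non-zero eigenvalues of \<open>A\<^sup>* A\<close> with
  multiplicity, followed by zeros if there are finitely many of them. The multiplicities are
  recorded by the orthonormal system \<open>e\<close> of eigenvectors, outside the span of which \<open>A\<^sup>* A\<close>
  vanishes; \<open>e\<close> need not span the kernel.
\<close>

definition singular_values_on ::
  "(real \<Rightarrow> complex) set \<Rightarrow> ((real \<Rightarrow> complex) \<Rightarrow> (real \<Rightarrow> complex) \<Rightarrow> complex)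
     \<Rightarrow> ((real \<Rightarrow> complex) \<Rightarrow> real \<Rightarrow> complex) \<Rightarrow> (nat \<Rightarrow> real) \<Rightarrow> bool" where
  "singular_values_on V ip A s \<longleftrightarrow> decseq s \<and> (\<forall>l. 0 \<le> s l) \<and>
     (\<exists>A' e. adjoint_on V ip A A' \<and>
        (\<forall>l. e l \<in> V) \<and> (\<forall>k l. ip (e k) (e l) = (if k = l then 1 else 0)) \<and>
        (\<forall>l. AE x in lborel. A' (A (e l)) x = of_real ((s l)\<^sup>2) * e l x) \<and>
        (\<forall>u\<in>V. (\<forall>l. ip u (e l) = 0) \<longrightarrow> (AE x in lborel. A' (A u) x = 0)))"

definition alpha :: "real \<Rightarrow> real \<Rightarrow> real" where
  "alpha lam \<theta> = ln lam / ln \<theta>"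

definition f_fun :: "(nat \<Rightarrow> real) \<Rightarrow> real \<Rightarrow> real \<Rightarrow> real \<Rightarrow> real \<Rightarrow> real" where
  "f_fun M lam \<theta> R' x = x powr alpha lam \<theta> * wfun M (R' / x)"

definition g_fun :: "(nat \<Rightarrow> real) \<Rightarrow> real \<Rightarrow> real \<Rightarrow> nat \<Rightarrow> real" where
  "g_fun M \<theta> R N = (SUP m\<in>{N..}. wfun M (R / \<theta> ^ m) / wfun M (R / \<theta> powi (int m - 1)))"

text \<open>
  Polymorphic, so that the same definition gives the entire function (at type \<open>complex\<close>) and
  its restriction to the real line (at type \<open>real\<close>), which is what an upper bound needs.
\<close>

definition F_fun ::
  "(nat \<Rightarrow> real) \<Rightarrow> real \<Rightarrow> real \<Rightarrow> real \<Rightarrow> 'a \<Rightarrow> 'a::real_normed_field" where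
  "F_fun M lam \<theta> R' z = (1 + z) * (\<Prod>m. 1 + of_real (f_fun M lam \<theta> R' (real (Suc m))) * z)"

definition G_fun :: "(nat \<Rightarrow> real) \<Rightarrow> real \<Rightarrow> real \<Rightarrow> 'a \<Rightarrow> 'a::real_normed_field" where
  "G_fun M \<theta> R z = (\<Sum>n. of_real (\<Prod>k<n. g_fun M \<theta> R k) * z ^ n)"

end

theory Submission
  imports "HOL-Complex_Analysis.Complex_Analysis" "Jordan_Normal_Form.Schur_Decomposition" Defs
begin

text \<open>
  In the Fourier basis, and with the weights of \<open>\<H>\<close>, the truncation of \<open>\<L>\<close> to the frequencies
  \<open>\<bar>k\<bar> < \<theta>\<^sup>N\<close> is a finite matrix \<open>U + A\<close>, where \<open>U\<close> strictly lowers the frequency block and \<open>A\<close> is a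
  compression of \<open>\<L>\<^sub>c\<close>. Since \<open>det (1 - z U) = 1\<close>, its determinant is \<open>det (1 - z (1 - z U)\<^sup>-\<^sup>1 A)\<close>, which is
  at most \<open>\<Prod> (1 + \<bar>z\<bar> \<parallel>(1 - z U)\<^sup>-\<^sup>1\<parallel> s\<^sub>l)\<close>; the quotients of the weights bound the norm by a multiple of
  \<open>G (C \<bar>z\<bar>)\<close>. The traces of the powers of the truncations tend to the flat traces, so by Newton's
  identities the Taylor coefficients of these determinants tend to those of \<open>d\<close>; as the
  determinants are bounded uniformly in \<open>N\<close>, they converge to \<open>d\<close> everywhere and \<open>d\<close> inherits the bound.
\<close>

subsection \<open>The weight function and the two majorants\<close>

text \<open>Truncation makes the treatment of \<open>U\<close> algebraic: on finitely many blocks it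
  is nilpotent, so that \<open>(1 - z U)^-1\<close> is a finite Neumann series. The price is that
  every estimate has to be uniform in \<open>N\<close>. For the resolvent, a path of
  \<open>p\<close> strict changes of level collects a factor of \<open>g_fun\<close> for each level
  crossed. As \<open>g_fun\<close> decreases, \<open>p\<close> of these factors may be exchanged for
  the first \<open>p\<close>, which form a coefficient of \<open>G_fun\<close> in the variable
  \<open>z\<close>; the others sum up to the constant \<open>G_fun M \<theta> R (2 * lam)\<close>.
  For the traces, powering and truncating do not commute. The difference comes from closed paths
  that leave the truncation; each has a step that starts in a block of high frequency, where the
  entries concerned decay faster than any power of the number of frequencies available. In the final
  estimate the factor 1 + z of \<open>F_fun\<close> is kept for \<open>s 0\<close>, about which the
  bound for indices l >= 1 says nothing.\<close>

lemma weight_sequence_ge_1: "weight_sequence M \<Longrightarrow> M k \<ge> 1"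
  unfolding weight_sequence_def using monoD[of M 0 k] by auto

text \<open>The factorial beats every geometric decay and the \<open>M k\<close> are at least 1.
  Hence the infimum that defines \<open>wfun\<close> is a minimum.\<close>

lemma weight_term_at_top:
  assumes "weight_sequence M" "x > 0"
  shows "filterlim (\<lambda>k. x ^ k * fact k * M k) at_top sequentially"
proof (rule filterlim_at_top_mono)
  have "(\<lambda>n. (inverse x) ^ n / fact n) \<longlonglongrightarrow> 0"
    using summable_LIMSEQ_zero[OF summable_exp[of "inverse x"]] by (simp add: divide_inverse mult.commute)
  moreover have "eventually (\<lambda>n. (inverse x) ^ n / fact n > 0) sequentially"
    using assms by (auto intro!: always_eventually)
  ultimately have "filterlim (\<lambda>n. inverse ((inverse x) ^ n / fact n)) at_top sequentially"
    by (rule filterlim_inverse_at_top)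
  then show "filterlim (\<lambda>n. x ^ n * fact n) at_top sequentially"
    by (simp add: field_simps)
  show "eventually (\<lambda>k. x ^ k * fact k \<le> x ^ k * fact k * M k) sequentially"
    using assms weight_sequence_ge_1[OF assms(1)] by (auto intro!: always_eventually)
qed

lemma wfun_bdd: "weight_sequence M \<Longrightarrow> x > 0 \<Longrightarrow> bdd_below (range (\<lambda>k. x ^ k * fact k * M k))"
  by (rule bdd_belowI[of _ 0]) (auto simp: weight_sequence_def less_imp_le)

lemma wfun_le: "weight_sequence M \<Longrightarrow> x > 0 \<Longrightarrow> wfun M x \<le> x ^ k * fact k * M k"
  unfolding wfun_def by (rule cINF_lower[OF wfun_bdd]) auto

text \<open>Beyond some \<open>K\<close> all terms are at least the term of index 0, so a minimum
  over \<open>{..K}\<close> is global. Having a minimising index at hand is what yields positivity,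
  monotonicity and the decay of the quotients of weights.\<close>

lemma wfun_attained:
  assumes "weight_sequence M" "x > 0"
  shows "\<exists>k. wfun M x = x ^ k * fact k * M k"
proof -
  let ?t = "\<lambda>k. x ^ k * fact k * M k"
  have "eventually (\<lambda>k. ?t k \<ge> ?t 0) sequentially"
    using weight_term_at_top[OF assms] by (auto simp: filterlim_at_top)
  then obtain K where K: "\<And>k. k \<ge> K \<Longrightarrow> ?t k \<ge> ?t 0" by (auto simp: eventually_at_top_linorder)
  define m where "m = arg_min_on ?t {..K}"
  have m: "m \<in> {..K}" "\<And>k. k \<in> {..K} \<Longrightarrow> ?t m \<le> ?t k"
    unfolding m_def by (rule arg_min_if_finite, simp, simp) (rule arg_min_least, auto)
  have "?t m \<le> ?t k" for k
    using m(2)[of k] m(2)[of 0] K[of k] by (cases "k \<le> K") auto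
  then have "?t m \<le> wfun M x" unfolding wfun_def by (intro cINF_greatest) auto
  then show ?thesis using wfun_le[OF assms, of m] by (intro exI[of _ m]) auto
qed

lemma wfun_pos: "weight_sequence M \<Longrightarrow> x > 0 \<Longrightarrow> wfun M x > 0"
  using wfun_attained[of M x] by (auto simp: weight_sequence_def)

lemma wfun_mono:
  assumes "weight_sequence M" "0 < x" "x \<le> y"
  shows "wfun M x \<le> wfun M y"
proof -
  obtain k where k: "wfun M y = y ^ k * fact k * M k" using wfun_attained[of M y] assms by auto
  have "wfun M x \<le> x ^ k * fact k * M k" using wfun_le assms by auto
  also have "\<dots> \<le> y ^ k * fact k * M k"
    using assms weight_sequence_ge_1[OF assms(1), of k] by (intro mult_right_mono power_mono) auto
  finally show ?thesis using k by simp
qed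

text \<open>If the index k is optimal at y, using the same k at y / \<theta> shows that the quotient
  is at most \<theta> to the power -k. As y tends to 0, the optimal index exceeds any given
  \<open>K\<close>.\<close>

lemma wfun_ratio_tendsto_0:
  assumes W: "weight_sequence M" and "\<theta> > 1" "R > 0" "\<epsilon> > 0"
  shows "eventually (\<lambda>m. wfun M (R / \<theta> ^ m) / wfun M (R / \<theta> powi (int m - 1)) < \<epsilon>) sequentially"
proof -
  have "(\<lambda>k. (1/\<theta>) ^ k) \<longlonglongrightarrow> 0" using assms by (intro LIMSEQ_power_zero) auto
  then have "eventually (\<lambda>k. (1/\<theta>) ^ k < \<epsilon>) sequentially"
    using assms by (auto simp: order_tendsto_iff)
  then obtain K where K: "(1/\<theta>) ^ K < \<epsilon>" by (auto simp: eventually_at_top_linorder)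
  define y where "y m = R / \<theta> powi (int m - 1)" for m
  have y: "y m > 0" "R / \<theta> ^ m = y m / \<theta>" for m
    using assms by (auto simp: y_def power_int_diff)
  have ylim: "y \<longlonglongrightarrow> 0"
  proof -
    have "(\<lambda>m. R * \<theta> * (1/\<theta>) ^ m) \<longlonglongrightarrow> R * \<theta> * 0"
      using assms by (intro tendsto_intros LIMSEQ_power_zero) auto
    moreover have "y = (\<lambda>m. R * \<theta> * (1/\<theta>) ^ m)"
      using assms by (simp add: fun_eq_iff y_def power_int_diff field_simps)
    ultimately show ?thesis by simp
  qed
  \<comment> \<open>For these \<open>m\<close>, and y below 1, the term of index \<open>K\<close> is
    smaller than every term of lower index, so none of the latter can be the minimum.\<close>
  have ev: "eventually (\<lambda>m. \<forall>k\<in>{..<K}. y m * (fact K * M K) < fact k * M k) sequentially"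
  proof (rule eventually_ball_finite)
    show "\<forall>k\<in>{..<K}. eventually (\<lambda>m. y m * (fact K * M K) < fact k * M k) sequentially"
    proof
      fix k
      have "(\<lambda>m. y m * (fact K * M K)) \<longlonglongrightarrow> 0 * (fact K * M K)" by (intro tendsto_intros ylim)
      moreover have "fact k * M k > 0" using W by (auto simp: weight_sequence_def)
      ultimately show "eventually (\<lambda>m. y m * (fact K * M K) < fact k * M k) sequentially"
        by (auto simp: order_tendsto_iff)
    qed
  qed simp
  have ev1: "eventually (\<lambda>m. y m < 1) sequentially" using ylim by (auto simp: order_tendsto_iff)
  show ?thesis using ev ev1
  proof eventually_elim
    case (elim m)
    obtain k where k: "wfun M (y m) = y m ^ k * fact k * M k" using wfun_attained[OF W y(1)] by auto
    have "k \<ge> K"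
    proof (rule ccontr)
      assume "\<not> K \<le> k"
      then have kK: "k < K" by simp
      have "wfun M (y m) \<le> y m ^ K * fact K * M K" by (rule wfun_le[OF W y(1)])
      also have "\<dots> \<le> y m ^ Suc k * fact K * M K"
        using kK y(1)[of m] elim weight_sequence_ge_1[OF W, of K]
        by (intro mult_right_mono power_decreasing) (auto simp: less_imp_le)
      also have "\<dots> = y m ^ k * (y m * (fact K * M K))" by simp
      also have "\<dots> < y m ^ k * (fact k * M k)"
        using elim kK y(1)[of m] by (intro mult_strict_left_mono) auto
      finally show False using k by simp
    qed
    have "wfun M (y m / \<theta>) \<le> (y m / \<theta>) ^ k * fact k * M k"
      using y(1)[of m] assms by (intro wfun_le[OF W]) auto
    also have "\<dots> = (1/\<theta>) ^ k * wfun M (y m)" by (simp add: k field_simps)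
    finally have "wfun M (y m / \<theta>) / wfun M (y m) \<le> (1/\<theta>) ^ k"
      using wfun_pos[OF W y(1), of m] by (simp add: field_simps)
    also have "\<dots> \<le> (1/\<theta>) ^ K" using \<open>k \<ge> K\<close> assms by (intro power_decreasing) auto
    also have "\<dots> < \<epsilon>" by fact
    finally show ?case unfolding y(2) by (simp add: y_def)
  qed
qed

section \<open>Quotients of consecutive weights and their decreasing envelope\<close>

lemma wfun_ratio:
  assumes W: "weight_sequence M" and "\<theta> > 1" "R > 0"
  shows "0 < wfun M (R / \<theta> ^ m) / wfun M (R / \<theta> powi (int m - 1))"
    "wfun M (R / \<theta> ^ m) / wfun M (R / \<theta> powi (int m - 1)) \<le> 1"
proof -
  have "R / \<theta> ^ m \<le> R / \<theta> powi (int m - 1)"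
    using assms by (auto simp: power_int_diff field_simps)
  then have "wfun M (R / \<theta> ^ m) \<le> wfun M (R / \<theta> powi (int m - 1))"
    using assms by (intro wfun_mono[OF W]) auto
  then show "wfun M (R / \<theta> ^ m) / wfun M (R / \<theta> powi (int m - 1)) \<le> 1"
    using wfun_pos[OF W, of "R / \<theta> powi (int m - 1)"] assms by (simp add: field_simps)
  show "0 < wfun M (R / \<theta> ^ m) / wfun M (R / \<theta> powi (int m - 1))"
    using wfun_pos[OF W] assms by simp
qed

lemma g_fun_bdd:
  assumes W: "weight_sequence M" and "\<theta> > 1" "R > 0"
  shows "bdd_above ((\<lambda>m. wfun M (R / \<theta> ^ m) / wfun M (R / \<theta> powi (int m - 1))) ` {N..})"
  using wfun_ratio(2)[OF assms] by (auto intro!: bdd_aboveI2[of _ _ 1])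

lemma wfun_ratio_le_g:
  assumes W: "weight_sequence M" and "\<theta> > 1" "R > 0"
  shows "wfun M (R / \<theta> ^ m) / wfun M (R / \<theta> powi (int m - 1)) \<le> g_fun M \<theta> R m"
  unfolding g_fun_def by (rule cSUP_upper[OF _ g_fun_bdd[OF assms]]) auto

lemma g_fun_pos:
  assumes W: "weight_sequence M" and "\<theta> > 1" "R > 0"
  shows "g_fun M \<theta> R m > 0"
  using wfun_ratio_le_g[OF assms, of m] wfun_ratio(1)[OF assms, of m] by linarith

lemma g_fun_antimono:
  assumes W: "weight_sequence M" and "\<theta> > 1" "R > 0"
  shows "decseq (g_fun M \<theta> R)"
  unfolding decseq_def g_fun_def by (auto intro!: cSUP_subset_mono g_fun_bdd[OF assms])

lemma g_fun_tendsto_0: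
  assumes W: "weight_sequence M" and "\<theta> > 1" "R > 0"
  shows "g_fun M \<theta> R \<longlonglongrightarrow> 0"
proof (rule order_tendstoI)
  fix a :: real assume "a < 0"
  then show "\<forall>\<^sub>F x in sequentially. a < g_fun M \<theta> R x"
    using g_fun_pos[OF assms] by (intro always_eventually allI) (meson less_trans)
next
  fix a :: real assume "a > 0"
  then obtain N where N: "\<And>m. m \<ge> N \<Longrightarrow> wfun M (R / \<theta> ^ m) / wfun M (R / \<theta> powi (int m - 1)) < a / 2"
    using wfun_ratio_tendsto_0[OF assms, of "a/2"] by (auto simp: eventually_at_top_linorder)
  have "g_fun M \<theta> R n < a" if "n \<ge> N" for n
  proof -
    have "g_fun M \<theta> R n \<le> a / 2"
      unfolding g_fun_def using N that by (intro cSUP_least) (auto simp: less_imp_le)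
    then show ?thesis using \<open>a > 0\<close> by simp
  qed
  then show "\<forall>\<^sub>F x in sequentially. g_fun M \<theta> R x < a"
    by (auto simp: eventually_at_top_linorder)
qed

section \<open>The entire majorants\<close>

lemma G_summable:
  fixes z :: "'a::{real_normed_field,banach}"
  assumes W: "weight_sequence M" and "\<theta> > 1" "R > 0"
  shows "summable (\<lambda>n. of_real (\<Prod>k<n. g_fun M \<theta> R k) * z ^ n)"
proof -
  \<comment> \<open>This is the quotient of consecutive terms; the decay of \<open>g_fun\<close> is
    the reason why the series is entire.\<close>
  have "(\<lambda>n. g_fun M \<theta> R n * norm z) \<longlonglongrightarrow> 0 * norm z"
    by (intro tendsto_intros g_fun_tendsto_0[OF assms])
  then have "eventually (\<lambda>n. g_fun M \<theta> R n * norm z < 1/2) sequentially"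
    by (rule order_tendstoD) simp
  then obtain N where N: "\<And>n. n \<ge> N \<Longrightarrow> g_fun M \<theta> R n * norm z < 1/2"
    by (auto simp: eventually_at_top_linorder)
  show ?thesis
  proof (rule summable_ratio_test[of "1/2" N])
    fix n assume "n \<ge> N"
    have "norm (of_real (\<Prod>k<Suc n. g_fun M \<theta> R k) * z ^ Suc n)
        = (g_fun M \<theta> R n * norm z) * norm (of_real (\<Prod>k<n. g_fun M \<theta> R k) * z ^ n)"
      using g_fun_pos[OF assms, of n] by (simp add: norm_mult norm_power abs_mult)
    also have "\<dots> \<le> (1/2) * norm (of_real (\<Prod>k<n. g_fun M \<theta> R k) * z ^ n)"
      using N[OF \<open>n \<ge> N\<close>] by (intro mult_right_mono) auto
    finally show "norm (of_real (\<Prod>k<Suc n. g_fun M \<theta> R k) * z ^ Suc n)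
      \<le> 1/2 * norm (of_real (\<Prod>k<n. g_fun M \<theta> R k) * z ^ n)" .
  qed simp
qed

lemma G_holomorphic:
  assumes W: "weight_sequence M" and "\<theta> > 1" "R > 0"
  shows "(G_fun M \<theta> R :: complex \<Rightarrow> complex) holomorphic_on UNIV"
proof -
  show ?thesis
    unfolding holomorphic_on_open[OF open_UNIV]
  proof (intro ballI)
    fix z :: complex
    have "((\<lambda>z. \<Sum>n. of_real (\<Prod>k<n. g_fun M \<theta> R k) * z ^ n) has_field_derivative
       (\<Sum>n. diffs (\<lambda>n. of_real (\<Prod>k<n. g_fun M \<theta> R k)) n * z ^ n)) (at z)"
      by (rule termdiffs_strong[of _ "of_real (norm z + 1)"])
        (use G_summable[OF assms] in \<open>auto simp del: of_real_add\<close>)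
    then show "\<exists>f'. (G_fun M \<theta> R has_field_derivative f') (at z)"
      unfolding G_fun_def[abs_def] by blast
  qed
qed

lemma G_mono:
  assumes W: "weight_sequence M" and "\<theta> > 1" "R > 0" "0 \<le> x" "x \<le> (y::real)"
  shows "G_fun M \<theta> R x \<le> G_fun M \<theta> R y"
  unfolding G_fun_def using assms less_imp_le[OF g_fun_pos[OF assms(1-3)]]
  by (intro suminf_le G_summable mult_left_mono power_mono) (auto intro!: prod_nonneg)

lemma G_ge_1:
  assumes W: "weight_sequence M" and "\<theta> > 1" "R > 0" "0 \<le> (x::real)"
  shows "G_fun M \<theta> R x \<ge> 1"
proof -
  have "(\<Sum>n<1. of_real (\<Prod>k<n. g_fun M \<theta> R k) * x ^ n) \<le> G_fun M \<theta> R x"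
    unfolding G_fun_def using assms less_imp_le[OF g_fun_pos[OF assms(1-3)]]
    by (intro sum_le_suminf G_summable) (auto intro!: mult_nonneg_nonneg prod_nonneg)
  then show ?thesis by simp
qed

lemma f_fun_nonneg: "weight_sequence M \<Longrightarrow> R' > 0 \<Longrightarrow> x > 0 \<Longrightarrow> f_fun M lam \<theta> R' x \<ge> 0"
  unfolding f_fun_def using wfun_pos[of M "R'/x"] by auto

text \<open>One term of the infimum is enough: an index k of at least
  \<open>alpha lam \<theta> + 2\<close> turns the power of the argument into an inverse
  square.\<close>

lemma f_fun_summable:
  assumes W: "weight_sequence M" and "R' > 0"
  shows "summable (\<lambda>m. f_fun M lam \<theta> R' (real (Suc m)))"
proof -
  obtain k :: nat where k: "alpha lam \<theta> + 2 \<le> real k" using real_arch_simple by blast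
  let ?c = "R' ^ k * fact k * M k"
  have "summable (\<lambda>m. ?c * inverse (real (Suc m) ^ 2))"
    by (intro summable_mult) (use inverse_power_summable[of 2, where ?'a = real] summable_Suc_iff[of "\<lambda>m. inverse (real m ^ 2)"] in simp)
  then show ?thesis
  proof (rule summable_comparison_test'[where N=0])
    fix m :: nat
    let ?x = "real (Suc m)"
    have "f_fun M lam \<theta> R' ?x \<le> ?x powr alpha lam \<theta> * ((R' / ?x) ^ k * fact k * M k)"
      unfolding f_fun_def using assms by (intro mult_left_mono wfun_le) auto
    also have "\<dots> = ?c * (?x powr alpha lam \<theta> * ?x powr (- real k))"
      by (simp add: power_divide powr_minus powr_realpow field_simps)
    also have "?x powr alpha lam \<theta> * ?x powr (- real k) = ?x powr (alpha lam \<theta> - real k)"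
      by (simp add: powr_diff powr_minus field_simps)
    also have "?c * \<dots> \<le> ?c * ?x powr (- 2)"
      using assms weight_sequence_ge_1[OF W, of k] k
      by (intro mult_left_mono powr_mono) auto
    also have "\<dots> = ?c * inverse (?x ^ 2)"
      by (simp add: powr_minus)
    finally show "norm (f_fun M lam \<theta> R' ?x) \<le> ?c * inverse (?x ^ 2)"
      using f_fun_nonneg[OF assms, of ?x lam \<theta>] by (simp only: real_norm_def abs_of_nonneg)
  qed
qed

lemma F_abs_convergent:
  fixes z :: "'a::{real_normed_field,banach,complete_space}"
  assumes W: "weight_sequence M" and "R' > 0"
  shows "abs_convergent_prod (\<lambda>m. 1 + of_real (f_fun M lam \<theta> R' (real (Suc m))) * z)"
  unfolding abs_convergent_prod_conv_summable
  using summable_mult2[OF f_fun_summable[OF assms, of lam \<theta>], of "norm z"] f_fun_nonneg[OF assms, of "real (Suc m)" lam \<theta> for m]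
  by (simp add: norm_mult)

lemma F_convergent:
  fixes z :: "'a::{real_normed_field,banach,complete_space}"
  assumes W: "weight_sequence M" and "R' > 0"
  shows "convergent_prod (\<lambda>m. 1 + of_real (f_fun M lam \<theta> R' (real (Suc m))) * z)"
  using F_abs_convergent[OF assms] by (rule abs_convergent_prod_imp_convergent_prod)

lemma F_holomorphic:
  assumes W: "weight_sequence M" and "R' > 0"
  shows "(F_fun M lam \<theta> R' :: complex \<Rightarrow> complex) holomorphic_on UNIV"
proof -
  let ?f = "\<lambda>m (z::complex). 1 + of_real (f_fun M lam \<theta> R' (real (Suc m))) * z"
  have "(\<lambda>z. \<Prod>m. ?f m z) holomorphic_on UNIV"
  proof (rule holomorphic_uniform_sequence[OF open_UNIV])
    show "(\<lambda>z. \<Prod>m<n. ?f m z) holomorphic_on UNIV" for n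
      by (intro holomorphic_intros)
    fix x :: complex
    have "uniformly_convergent_on (cball x 1) (\<lambda>N z. \<Prod>m<N. ?f m z)"
    proof (rule uniformly_convergent_on_prod')
      show "continuous_on (cball x 1) (?f n)" for n by (intro continuous_intros)
      show "compact (cball x 1)" by simp
      show "uniformly_convergent_on (cball x 1) (\<lambda>N z. \<Sum>n<N. norm (?f n z - 1))"
      proof (rule Weierstrass_m_test')
        show "norm (norm (?f n z - 1)) \<le> f_fun M lam \<theta> R' (real (Suc n)) * (norm x + 1)"
          if "z \<in> cball x 1" for n z
        proof -
          have "norm z \<le> norm x + 1" using that norm_triangle_sub[of z x] by (simp add: dist_norm norm_minus_commute)
          then show ?thesis using f_fun_nonneg[OF assms, of "real (Suc n)" lam \<theta>]
            by (simp add: norm_mult mult_left_mono)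
        qed
        show "summable (\<lambda>n. f_fun M lam \<theta> R' (real (Suc n)) * (norm x + 1))"
          by (intro summable_mult2 f_fun_summable assms)
      qed
    qed
    then obtain l where l: "uniform_limit (cball x 1) (\<lambda>N z. \<Prod>m<N. ?f m z) l sequentially"
      by (auto simp: uniformly_convergent_on_def)
    have "l z = (\<Prod>m. ?f m z)" if "z \<in> cball x 1" for z
    proof (rule LIMSEQ_unique)
      show "(\<lambda>N. \<Prod>m<N. ?f m z) \<longlonglongrightarrow> l z" by (rule tendsto_uniform_limitI[OF l that])
      show "(\<lambda>N. \<Prod>m<N. ?f m z) \<longlonglongrightarrow> (\<Prod>m. ?f m z)"
        using convergent_prod_LIMSEQ[OF F_convergent[OF assms]] by (simp only: LIMSEQ_lessThan_iff_atMost)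
    qed
    then have "uniform_limit (cball x 1) (\<lambda>N z. \<Prod>m<N. ?f m z) (\<lambda>z. \<Prod>m. ?f m z) sequentially"
      using l uniform_limit_cong'[of "cball x 1" "\<lambda>N z. \<Prod>m<N. ?f m z" "\<lambda>N z. \<Prod>m<N. ?f m z" l] by auto
    then show "\<exists>d>0. cball x d \<subseteq> UNIV \<and> uniform_limit (cball x d) (\<lambda>N z. \<Prod>m<N. ?f m z) (\<lambda>z. \<Prod>m. ?f m z) sequentially"
      by (intro exI[of _ 1]) auto
  qed
  then show ?thesis unfolding F_fun_def[abs_def] by (intro holomorphic_intros)
qed

lemma prod_le_F:
  assumes W: "weight_sequence M" and "R' > 0" "0 \<le> x"
  shows "(1 + x) * (\<Prod>m<n. 1 + f_fun M lam \<theta> R' (real (Suc m)) * x) \<le> F_fun M lam \<theta> R' x"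
proof -
  have "(\<Prod>m<n. 1 + f_fun M lam \<theta> R' (real (Suc m)) * x) \<le> (\<Prod>m. 1 + f_fun M lam \<theta> R' (real (Suc m)) * x)"
    using assms convergent_prod_has_prod[OF F_convergent[OF assms(1,2), of lam \<theta> x]] f_fun_nonneg[OF assms(1,2)]
    by (intro prod_le_prodinf) (auto intro!: add_nonneg_nonneg)
  then show ?thesis unfolding F_fun_def using assms by (auto intro!: mult_left_mono)
qed

subsection \<open>Determinants of kernels on finite sets\<close>

text \<open>Kernels live on finite sets of frequencies, matrices on initial segments of the
  naturals. An arbitrary enumeration links them; as it is used for rows and columns alike,
  determinants and traces do not depend on it.\<close>

definition enum :: "'a set \<Rightarrow> nat \<Rightarrow> 'a" where
  "enum B = (SOME f. bij_betw f {0..<card B} B)"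

lemma enum_bij: "finite B \<Longrightarrow> bij_betw (enum B) {0..<card B} B"
  unfolding enum_def by (rule someI_ex[where P="\<lambda>f. bij_betw f _ _"]) (rule ex_bij_betw_nat_finite)

lemma enum_in: "finite B \<Longrightarrow> i < card B \<Longrightarrow> enum B i \<in> B"
  using bij_betwE[OF enum_bij[of B]] by auto

lemma enum_eq_iff: "finite B \<Longrightarrow> i < card B \<Longrightarrow> j < card B \<Longrightarrow> enum B i = enum B j \<longleftrightarrow> i = j"
  using bij_betw_imp_inj_on[OF enum_bij[of B]] by (auto simp: inj_on_def)

lemma sum_enum: "finite B \<Longrightarrow> (\<Sum>i = 0..<card B. f (enum B i)) = sum f B"
  using sum.reindex_bij_betw[OF enum_bij[of B], of f] by simp

definition fmat :: "'a set \<Rightarrow> 'b set \<Rightarrow> ('a \<Rightarrow> 'b \<Rightarrow> complex) \<Rightarrow> complex mat" where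
  "fmat A B a = mat (card A) (card B) (\<lambda>(i,j). a (enum A i) (enum B j))"

definition fdet :: "'a set \<Rightarrow> ('a \<Rightarrow> 'a \<Rightarrow> complex) \<Rightarrow> complex" where
  "fdet B a = Determinant.det (fmat B B a)"

abbreviation kron :: "'a \<Rightarrow> 'a \<Rightarrow> complex" where
  "kron j k \<equiv> (if j = k then 1 else 0)"

text \<open>Powers of the kernel truncated to \<open>B\<close>: the intermediate indices stay in
  \<open>B\<close>, the end points are free. These are powers of a section, to be distinguished from
  sections of a power; their comparison is the subject of \<open>trace_limit\<close>.\<close>

fun fpow :: "'a set \<Rightarrow> ('a \<Rightarrow> 'a \<Rightarrow> complex) \<Rightarrow> nat \<Rightarrow> 'a \<Rightarrow> 'a \<Rightarrow> complex" where
  "fpow B a 0 j k = kron j k"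
| "fpow B a (Suc p) j k = (\<Sum>m\<in>B. a j m * fpow B a p m k)"

lemma fmat_carrier [simp]: "fmat A B a \<in> carrier_mat (card A) (card B)"
  "dim_row (fmat A B a) = card A" "dim_col (fmat A B a) = card B"
  by (auto simp: fmat_def)

lemma fmat_mult:
  assumes "finite B"
  shows "fmat A B a * fmat B C b = fmat A C (\<lambda>j k. \<Sum>m\<in>B. a j m * b m k)"
  by (rule eq_matI) (auto simp: fmat_def scalar_prod_def sum_enum[OF assms, symmetric])

lemma fmat_one: "finite B \<Longrightarrow> fmat B B kron = 1\<^sub>m (card B)"
  by (rule eq_matI) (auto simp: fmat_def enum_eq_iff)

lemma fmat_minus: "fmat A B (\<lambda>j k. a j k - b j k) = fmat A B a - fmat A B b"
  by (rule eq_matI) (auto simp: fmat_def)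

lemma fmat_smult: "fmat A B (\<lambda>j k. z * a j k) = z \<cdot>\<^sub>m fmat A B a"
  by (rule eq_matI) (auto simp: fmat_def)

lemma fmat_cong: "finite A \<Longrightarrow> finite B \<Longrightarrow> (\<And>j k. j \<in> A \<Longrightarrow> k \<in> B \<Longrightarrow> a j k = b j k) \<Longrightarrow> fmat A B a = fmat A B b"
  by (rule eq_matI) (auto simp: fmat_def enum_in)

lemma fdet_cong: "finite B \<Longrightarrow> (\<And>j k. j \<in> B \<Longrightarrow> k \<in> B \<Longrightarrow> a j k = b j k) \<Longrightarrow> fdet B a = fdet B b"
  unfolding fdet_def using fmat_cong[of B B a b] by auto

lemma fdet_mult:
  assumes "finite B"
  shows "fdet B (\<lambda>j k. \<Sum>m\<in>B. a j m * b m k) = fdet B a * fdet B b"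
  unfolding fdet_def fmat_mult[OF assms, symmetric] by (rule det_mult) auto

text \<open>Both sides equal the determinant of the block matrix \<open>?M\<close>: multiplying it
  on the right by the unipotent \<open>?N1\<close> clears its lower left block, by
  \<open>?N2\<close> its upper right one.\<close>

lemma det_sylvester:
  fixes P Q :: "complex mat"
  assumes P: "P \<in> carrier_mat n q" and Q: "Q \<in> carrier_mat q n"
  shows "Determinant.det (1\<^sub>m n - P * Q) = Determinant.det (1\<^sub>m q - Q * P)"
proof -
  let ?M = "four_block_mat (1\<^sub>m n) P Q (1\<^sub>m q)"
  let ?N1 = "four_block_mat (1\<^sub>m n) (0\<^sub>m n q) (- Q) (1\<^sub>m q)"
  let ?N2 = "four_block_mat (1\<^sub>m n) (- P) (0\<^sub>m q n) (1\<^sub>m q)"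
  have M: "?M \<in> carrier_mat (n + q) (n + q)" and N1: "?N1 \<in> carrier_mat (n + q) (n + q)"
    and N2: "?N2 \<in> carrier_mat (n + q) (n + q)" using P Q by auto
  have PQ: "P * Q \<in> carrier_mat n n" "Q * P \<in> carrier_mat q q" using P Q by auto
  have "?M * ?N1 = four_block_mat (1\<^sub>m n * 1\<^sub>m n + P * (- Q)) (1\<^sub>m n * 0\<^sub>m n q + P * 1\<^sub>m q)
      (Q * 1\<^sub>m n + 1\<^sub>m q * (- Q)) (Q * 0\<^sub>m n q + 1\<^sub>m q * 1\<^sub>m q)"
    by (rule mult_four_block_mat) (use P Q in auto)
  also have "\<dots> = four_block_mat (1\<^sub>m n - P * Q) P (0\<^sub>m q n) (1\<^sub>m q)"
    using P Q PQ by (intro cong_four_block_mat eq_matI) auto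
  finally have e1: "?M * ?N1 = four_block_mat (1\<^sub>m n - P * Q) P (0\<^sub>m q n) (1\<^sub>m q)" .
  have "?M * ?N2 = four_block_mat (1\<^sub>m n * 1\<^sub>m n + P * 0\<^sub>m q n) (1\<^sub>m n * (- P) + P * 1\<^sub>m q)
      (Q * 1\<^sub>m n + 1\<^sub>m q * 0\<^sub>m q n) (Q * (- P) + 1\<^sub>m q * 1\<^sub>m q)"
    by (rule mult_four_block_mat) (use P Q in auto)
  also have "\<dots> = four_block_mat (1\<^sub>m n) (0\<^sub>m n q) Q (1\<^sub>m q - Q * P)"
    using P Q PQ by (intro cong_four_block_mat eq_matI) auto
  finally have e2: "?M * ?N2 = four_block_mat (1\<^sub>m n) (0\<^sub>m n q) Q (1\<^sub>m q - Q * P)" .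
  have d1: "Determinant.det ?N1 = 1"
    by (subst det_four_block_mat_upper_right_zero[of _ n _ q]) (use Q in auto)
  have d2: "Determinant.det ?N2 = 1"
    by (subst det_four_block_mat_lower_left_zero[of _ n _ q]) (use P in auto)
  have d3: "Determinant.det (four_block_mat (1\<^sub>m n - P * Q) P (0\<^sub>m q n) (1\<^sub>m q)) = Determinant.det (1\<^sub>m n - P * Q)"
    by (subst det_four_block_mat_lower_left_zero[of _ n _ q]) (use P Q in auto)
  have d4: "Determinant.det (four_block_mat (1\<^sub>m n) (0\<^sub>m n q) Q (1\<^sub>m q - Q * P)) = Determinant.det (1\<^sub>m q - Q * P)"
    by (subst det_four_block_mat_upper_right_zero[of _ n _ q]) (use P Q in auto)
  have "Determinant.det (1\<^sub>m n - P * Q) = Determinant.det ?M"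
    using det_mult[OF M N1] e1 d1 d3 by simp
  also have "\<dots> = Determinant.det (1\<^sub>m q - Q * P)"
    using det_mult[OF M N2] e2 d2 d4 by simp
  finally show ?thesis .
qed

lemma fdet_sylvester:
  assumes "finite A" "finite B"
  shows "fdet A (\<lambda>j k. kron j k - (\<Sum>l\<in>B. p j l * q l k)) = fdet B (\<lambda>l m. kron l m - (\<Sum>j\<in>A. q l j * p j m))"
  unfolding fdet_def fmat_minus fmat_one[OF assms(1)] fmat_one[OF assms(2)]
    fmat_mult[OF assms(1), symmetric] fmat_mult[OF assms(2), symmetric]
  by (rule det_sylvester) auto

text \<open>By the Leibniz formula the determinant is a polynomial in finitely many entries.\<close>

lemma fdet_tendsto:
  assumes "finite B" "\<And>j k. j \<in> B \<Longrightarrow> k \<in> B \<Longrightarrow> ((\<lambda>q. a q j k) \<longlongrightarrow> b j k) F"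
  shows "((\<lambda>q. fdet B (a q)) \<longlongrightarrow> fdet B b) F"
proof -
  have pl: "p i < n" if "p permutes {0..<n}" "i < n" for p and i n :: nat
    using permutes_in_image[OF that(1), of i] that(2) by simp
  have "fdet B c = (\<Sum>p | p permutes {0..<card B}. signof p * (\<Prod>i = 0..<card B. c (enum B i) (enum B (p i))))" for c
  proof -
    have "(\<Prod>i = 0..<card B. fmat B B c $$ (i, p i)) = (\<Prod>i = 0..<card B. c (enum B i) (enum B (p i)))"
      if "p permutes {0..<card B}" for p
      using that by (intro prod.cong refl) (simp add: fmat_def pl[of p])
    then show ?thesis unfolding fdet_def Determinant.det_def fmat_carrier if_P[OF refl] by (intro sum.cong refl) simp
  qed
  then have e: "fdet B = (\<lambda>c. \<Sum>p | p permutes {0..<card B}. signof p * (\<Prod>i = 0..<card B. c (enum B i) (enum B (p i))))"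
    by blast
  show ?thesis unfolding e
    using enum_in[OF assms(1)] pl[of _ "card B"]
    by (intro tendsto_sum tendsto_mult tendsto_prod tendsto_const assms(2)) auto
qed

lemma fdet_diag:
  assumes "finite B"
  shows "fdet B (\<lambda>j k. if j = k then c j else 0) = prod c B"
proof -
  let ?A = "fmat B B (\<lambda>j k. if j = k then c j else 0)"
  have "upper_triangular ?A"
    by (auto simp: fmat_def enum_eq_iff[OF assms] upper_triangular_def)
  then have "fdet B (\<lambda>j k. if j = k then c j else 0) = prod_list (diag_mat ?A)"
    unfolding fdet_def by (rule det_upper_triangular) auto
  also have "\<dots> = (\<Prod>i = 0..<card B. c (enum B i))"
    by (auto simp: prod_list_diag_prod fmat_def)
  also have "\<dots> = prod c B"
    by (rule prod.reindex_bij_betw[OF enum_bij[OF assms]])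
  finally show ?thesis .
qed

lemma triangularize:
  fixes A :: "complex mat"
  assumes "A \<in> carrier_mat n n"
  obtains T where "T \<in> carrier_mat n n" "upper_triangular T" "similar_mat A T"
    "char_poly A = (\<Prod>a\<leftarrow>diag_mat T. [:- a, 1:])"
proof -
  obtain es where "char_poly A = (\<Prod>a\<leftarrow>es. [:- a, 1:])"
    using char_poly_factorized[OF assms] by auto
  from schur_decomposition_exists[OF assms this] obtain T where
    T: "T \<in> carrier_mat n n" "upper_triangular T" "similar_mat A T" by auto
  moreover have "char_poly A = (\<Prod>a\<leftarrow>diag_mat T. [:- a, 1:])"
    using char_poly_similar[OF T(3)] char_poly_upper_triangular[OF T(1,2)] by simp
  ultimately show ?thesis using that by blast
qed

text \<open>The determinant is the product of the eigenvalues, and each eigenvalue lies in the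
  numerical range: insert an eigenvector into the quadratic form.\<close>

lemma cmod_det_le_one:
  assumes "finite B"
    and num: "\<And>v. cmod (\<Sum>j\<in>B. cnj (v j) * (\<Sum>k\<in>B. a j k * v k)) \<le> (\<Sum>j\<in>B. (cmod (v j))\<^sup>2)"
  shows "cmod (fdet B a) \<le> 1"
proof -
  let ?A = "fmat B B a" let ?n = "card B"
  obtain T where T: "T \<in> carrier_mat ?n ?n" "upper_triangular T" "similar_mat ?A T"
    "char_poly ?A = (\<Prod>a\<leftarrow>diag_mat T. [:- a, 1:])"
    using triangularize[of ?A ?n] by auto
  have le: "cmod \<mu> \<le> 1" if "\<mu> \<in> set (diag_mat T)" for \<mu>
  proof -
    have "poly (char_poly ?A) \<mu> = 0"
      using that unfolding T(4) poly_prod_list by (auto simp: prod_list_zero_iff image_iff intro!: bexI[of _ \<mu>])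
    then have "eigenvalue ?A \<mu>" by (subst eigenvalue_root_char_poly[of _ ?n]) auto
    then obtain v where v: "v \<in> carrier_vec ?n" "v \<noteq> 0\<^sub>v ?n" "?A *\<^sub>v v = \<mu> \<cdot>\<^sub>v v"
      unfolding eigenvalue_def eigenvector_def by auto
    \<comment> \<open>The eigenvector carried back from positions to elements of
      \<open>B\<close>.\<close>
    define w where "w = (\<lambda>j. vec_index v (the_inv_into {0..<?n} (enum B) j))"
    have w: "w (enum B i) = vec_index v i" if "i < ?n" for i
      unfolding w_def using the_inv_into_f_f[OF bij_betw_imp_inj_on[OF enum_bij[OF assms(1)]], of i] that by simp
    have eq: "(\<Sum>k\<in>B. a j k * w k) = \<mu> * w j" if jB: "j \<in> B" for j
    proof -
      obtain i where i: "i < ?n" "j = enum B i"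
        using jB bij_betw_imp_surj_on[OF enum_bij[OF assms(1)]] by force
      have "vec_index (?A *\<^sub>v v) i = vec_index (\<mu> \<cdot>\<^sub>v v) i" using v(3) by simp
      then have "(\<Sum>l = 0..<?n. a (enum B i) (enum B l) * w (enum B l)) = \<mu> * w (enum B i)"
        using i(1) v(1) by (auto simp: scalar_prod_def fmat_def w)
      then show ?thesis using sum_enum[OF assms(1), of "\<lambda>k. a j k * w k"] i by simp
    qed
    have "(\<Sum>j\<in>B. cnj (w j) * (\<Sum>k\<in>B. a j k * w k)) = (\<Sum>j\<in>B. \<mu> * of_real ((cmod (w j))\<^sup>2))"
      by (intro sum.cong refl) (simp add: eq complex_norm_square del: of_real_power)
    also have "\<dots> = \<mu> * of_real (\<Sum>j\<in>B. (cmod (w j))\<^sup>2)" by (simp add: sum_distrib_left)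
    finally have "cmod \<mu> * (\<Sum>j\<in>B. (cmod (w j))\<^sup>2) \<le> (\<Sum>j\<in>B. (cmod (w j))\<^sup>2)"
      using num[of w] by (simp add: norm_mult abs_of_nonneg sum_nonneg del: of_real_sum of_real_power)
    moreover have "(\<Sum>j\<in>B. (cmod (w j))\<^sup>2) > 0"
    proof -
      obtain i where "i < ?n" "vec_index v i \<noteq> 0" using v(1,2) by (metis carrier_vecD eq_vecI index_zero_vec)
      then have "w (enum B i) \<noteq> 0" "enum B i \<in> B" by (auto simp: w enum_in[OF assms(1)])
      then show ?thesis using assms(1) by (intro sum_pos2[of B "enum B i"]) auto
    qed
    ultimately show ?thesis by simp
  qed
  have "cmod (prod_list xs) \<le> 1" if "\<And>x. x \<in> set xs \<Longrightarrow> cmod x \<le> 1" for xs :: "complex list"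
    using that by (induction xs) (auto simp: norm_mult mult_le_one)
  moreover have "fdet B a = prod_list (diag_mat T)"
    unfolding fdet_def det_similar[OF T(3)] by (rule det_upper_triangular[OF T(2,1)])
  ultimately show ?thesis using le by simp
qed

section \<open>Traces of powers and eigenvalues\<close>

definition mtrace :: "complex mat \<Rightarrow> complex" where
  "mtrace A = (\<Sum>i<dim_row A. A $$ (i,i))"

lemma mtrace_comm:
  assumes "A \<in> carrier_mat n m" "B \<in> carrier_mat m n"
  shows "mtrace (A * B) = mtrace (B * A)"
proof -
  have "mtrace (A * B) = (\<Sum>i<n. \<Sum>j<m. A $$ (i,j) * B $$ (j,i))"
    using assms by (auto simp: mtrace_def scalar_prod_def atLeast0LessThan)
  also have "\<dots> = (\<Sum>j<m. \<Sum>i<n. B $$ (j,i) * A $$ (i,j))"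
    by (subst sum.swap) (simp add: mult.commute)
  also have "\<dots> = mtrace (B * A)"
    using assms by (auto simp: mtrace_def scalar_prod_def atLeast0LessThan)
  finally show ?thesis .
qed

lemma upper_triangular_pow_diag:
  fixes T :: "complex mat"
  assumes T: "T \<in> carrier_mat n n" "upper_triangular T"
  shows "upper_triangular (T ^\<^sub>m p) \<and> (\<forall>i<n. (T ^\<^sub>m p) $$ (i,i) = (T $$ (i,i)) ^ p)"
proof (induction p)
  case 0 then show ?case using T by auto
next
  case (Suc p)
  have Tp: "T ^\<^sub>m p \<in> carrier_mat n n" using T(1) by simp
  have e: "(T ^\<^sub>m Suc p) $$ (i,j) = (\<Sum>l<n. (T ^\<^sub>m p) $$ (i,l) * T $$ (l,j))" if "i < n" "j < n" for i j
    using that T(1) Tp by (auto simp: scalar_prod_def atLeast0LessThan)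
  have z1: "(T ^\<^sub>m p) $$ (i,l) = 0" if "i < n" "l < i" for i l
    using Suc that Tp by (auto simp: upper_triangular_def)
  have z2: "T $$ (i,l) = 0" if "i < n" "l < i" for i l
    using T that by (auto simp: upper_triangular_def)
  have "(T ^\<^sub>m Suc p) $$ (i,j) = 0" if "i < n" "j < i" for i j
  proof -
    have "(T ^\<^sub>m p) $$ (i,l) * T $$ (l,j) = 0" if "l < n" for l
      using z1[of i l] z2[of l j] \<open>i < n\<close> \<open>j < i\<close> that by (cases "l < i") auto
    then show ?thesis unfolding e[OF that(1) less_trans[OF that(2,1)]] by (intro sum.neutral) auto
  qed
  moreover have "(T ^\<^sub>m Suc p) $$ (i,i) = (T $$ (i,i)) ^ Suc p" if "i < n" for i
  proof -
    have "(T ^\<^sub>m p) $$ (i,l) * T $$ (l,i) = (if l = i then (T ^\<^sub>m p) $$ (i,i) * T $$ (i,i) else 0)" if "l < n" for l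
      using z1[of i l] z2[of l i] \<open>i < n\<close> that by (cases "l < i"; cases "l = i") auto
    then have "(T ^\<^sub>m Suc p) $$ (i,i) = (\<Sum>l<n. if l = i then (T ^\<^sub>m p) $$ (i,i) * T $$ (i,i) else 0)"
      unfolding e[OF that that] by (intro sum.cong) auto
    also have "\<dots> = (T ^\<^sub>m p) $$ (i,i) * T $$ (i,i)" using that by simp
    finally have "(T ^\<^sub>m Suc p) $$ (i,i) = (T ^\<^sub>m p) $$ (i,i) * T $$ (i,i)" .
    then show ?thesis using Suc that by (simp add: mult.commute)
  qed
  ultimately show ?case using T(1) Tp by (auto simp: upper_triangular_def)
qed

lemma fmat_fpow: "finite B \<Longrightarrow> fmat B B (fpow B a p) = fmat B B a ^\<^sub>m p"
proof (induction p)
  case 0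
  then show ?case using fmat_one[of B] by (simp add: fmat_def)
next
  case (Suc p)
  \<comment> \<open>\<open>fpow\<close> multiplies by the kernel on the left, the matrix power on
    the right.\<close>
  have comm: "A * A ^\<^sub>m p = A ^\<^sub>m p * A" if "A \<in> carrier_mat n n" for A :: "complex mat" and n p
  proof (induction p)
    case (Suc p)
    have "A * A ^\<^sub>m Suc p = (A * A ^\<^sub>m p) * A" using that by (simp add: assoc_mult_mat[of _ n n _ n _ n])
    then show ?case using Suc by simp
  qed (use that in auto)
  have "fmat B B (fpow B a (Suc p)) = fmat B B (\<lambda>j k. \<Sum>m\<in>B. a j m * fpow B a p m k)"
    by (simp add: fmat_def)
  also have "\<dots> = fmat B B a * fmat B B (fpow B a p)" by (rule fmat_mult[OF Suc.prems, symmetric])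
  also have "\<dots> = fmat B B a * fmat B B a ^\<^sub>m p" by (simp only: Suc.IH[OF Suc.prems])
  also have "\<dots> = fmat B B a ^\<^sub>m Suc p" using comm[of "fmat B B a" "card B"] by simp
  finally show ?case .
qed

text \<open>A single list of eigenvalues has to serve the determinant for every \<open>z\<close> and
  the traces of all powers at once, for Newton's identities relate the two. It is the diagonal of a
  triangular form.\<close>

lemma det_trace_spectrum:
  assumes "finite B"
  obtains ds where "\<And>z. fdet B (\<lambda>j k. kron j k - z * a j k) = (\<Prod>\<mu>\<leftarrow>ds. 1 - \<mu> * z)"
    "\<And>p. (\<Sum>j\<in>B. fpow B a p j j) = (\<Sum>\<mu>\<leftarrow>ds. \<mu> ^ p)"
proof -
  let ?A = "fmat B B a" let ?n = "card B"
  obtain T where T: "T \<in> carrier_mat ?n ?n" "upper_triangular T" "similar_mat ?A T"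
    using triangularize[of ?A ?n] by auto
  obtain P Q where PQ: "similar_mat_wit ?A T P Q" using T(3) by (auto simp: similar_mat_def)
  then have c: "P \<in> carrier_mat ?n ?n" "Q \<in> carrier_mat ?n ?n" "P * Q = 1\<^sub>m ?n" "Q * P = 1\<^sub>m ?n" and cA: "?A = P * T * Q"
    using similar_mat_witD2[OF fmat_carrier(1) PQ] by auto
  have "fdet B (\<lambda>j k. kron j k - z * a j k) = (\<Prod>\<mu>\<leftarrow>diag_mat T. 1 - \<mu> * z)" for z
  proof -
    have TP: "T * Q \<in> carrier_mat ?n ?n" using T c by auto
    have "fdet B (\<lambda>j k. kron j k - z * a j k) = Determinant.det (1\<^sub>m ?n - z \<cdot>\<^sub>m ?A)"
      unfolding fdet_def fmat_minus fmat_smult using assms by (simp add: fmat_one)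
    also have "\<dots> = Determinant.det (1\<^sub>m ?n - P * (z \<cdot>\<^sub>m (T * Q)))"
      unfolding cA assoc_mult_mat[OF c(1) T(1) c(2)] mult_smult_distrib[OF c(1) TP] ..
    \<comment> \<open>Sylvester's identity moves \<open>P\<close> behind \<open>Q\<close>, where the
      two cancel; for the trace below, cyclicity does the same.\<close>
    also have "\<dots> = Determinant.det (1\<^sub>m ?n - (z \<cdot>\<^sub>m (T * Q)) * P)"
      by (rule det_sylvester) (use c TP in auto)
    also have "(z \<cdot>\<^sub>m (T * Q)) * P = z \<cdot>\<^sub>m (T * (Q * P))"
      unfolding mult_smult_assoc_mat[OF TP c(1)] assoc_mult_mat[OF T(1) c(2) c(1)] ..
    also have "\<dots> = z \<cdot>\<^sub>m T" using c T by simp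
    also have "Determinant.det (1\<^sub>m ?n - z \<cdot>\<^sub>m T) = prod_list (diag_mat (1\<^sub>m ?n - z \<cdot>\<^sub>m T))"
      by (rule det_upper_triangular[of _ ?n]) (use T in \<open>auto simp: upper_triangular_def\<close>)
    also have "diag_mat (1\<^sub>m ?n - z \<cdot>\<^sub>m T) = map (\<lambda>\<mu>. 1 - \<mu> * z) (diag_mat T)"
      using T(1) by (auto simp: diag_mat_def)
    finally show ?thesis .
  qed
  moreover have "(\<Sum>j\<in>B. fpow B a p j j) = (\<Sum>\<mu>\<leftarrow>diag_mat T. \<mu> ^ p)" for p
  proof -
    have Tp: "T ^\<^sub>m p \<in> carrier_mat ?n ?n" using T by simp
    have w: "similar_mat_wit (?A ^\<^sub>m p) (T ^\<^sub>m p) P Q" by (rule similar_mat_wit_pow[OF PQ])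
    then have Ap: "?A ^\<^sub>m p = P * T ^\<^sub>m p * Q"
      by (auto simp: similar_mat_wit_def Let_def)
    have "(\<Sum>j\<in>B. fpow B a p j j) = (\<Sum>i=0..<?n. fpow B a p (enum B i) (enum B i))"
      using sum_enum[OF assms, of "\<lambda>j. fpow B a p j j"] by simp
    also have "\<dots> = mtrace (fmat B B (fpow B a p))"
      by (simp add: mtrace_def fmat_def atLeast0LessThan)
    also have "\<dots> = mtrace (P * (T ^\<^sub>m p * Q))"
      unfolding fmat_fpow[OF assms] Ap assoc_mult_mat[OF c(1) Tp c(2)] ..
    also have "\<dots> = mtrace ((T ^\<^sub>m p * Q) * P)"
      by (rule mtrace_comm) (use c Tp in auto)
    also have "(T ^\<^sub>m p * Q) * P = T ^\<^sub>m p * (Q * P)"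
      by (rule assoc_mult_mat[OF Tp c(2) c(1)])
    also have "\<dots> = T ^\<^sub>m p" unfolding c(4) by (rule right_mult_one_mat[OF Tp])
    also have "mtrace (T ^\<^sub>m p) = (\<Sum>i<?n. (T $$ (i,i)) ^ p)"
      using upper_triangular_pow_diag[OF T(1,2), of p] carrier_matD(1)[OF Tp] unfolding mtrace_def by (intro sum.cong) auto
    also have "\<dots> = (\<Sum>\<mu>\<leftarrow>diag_mat T. \<mu> ^ p)"
      using T(1) by (simp add: diag_mat_def interv_sum_list_conv_sum_set_nat atLeast0LessThan comp_def)
    finally show ?thesis .
  qed
  ultimately show ?thesis using that by blast
qed

subsection \<open>Newton's identities\<close>

lemma has_fps_expansion_prod_linear:
  "(\<lambda>z::complex. \<Prod>\<mu>\<leftarrow>ds. 1 - \<mu> * z) has_fps_expansion (\<Prod>\<mu>\<leftarrow>ds. 1 - fps_const \<mu> * fps_X)"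
proof (induction ds)
  case (Cons a ds)
  have "(\<lambda>z::complex. 1 - a * z) has_fps_expansion 1 - fps_const a * fps_X"
    by (intro fps_expansion_intros)
  from has_fps_expansion_mult[OF this Cons.IH] show ?case by simp
qed simp

text \<open>The logarithmic derivative of 1 - aX is minus the geometric series with coefficients
  a^(n+1); over all factors these add up to the generating series of the power sums.\<close>

lemma fps_deriv_prod_linear:
  fixes ds :: "complex list"
  shows "fps_deriv (\<Prod>\<mu>\<leftarrow>ds. 1 - fps_const \<mu> * fps_X)
    = - (Abs_fps (\<lambda>n. \<Sum>\<mu>\<leftarrow>ds. \<mu> ^ Suc n) * (\<Prod>\<mu>\<leftarrow>ds. 1 - fps_const \<mu> * fps_X))"
proof (induction ds)
  case Nil
  have "Abs_fps (\<lambda>n. 0) = (0 :: complex fps)" by (simp add: fps_eq_iff)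
  then show ?case by simp
next
  case (Cons a ds)
  let ?P = "\<Prod>\<mu>\<leftarrow>ds. 1 - fps_const \<mu> * fps_X" let ?L = "1 - fps_const a * fps_X"
  let ?S = "Abs_fps (\<lambda>n. \<Sum>\<mu>\<leftarrow>ds. \<mu> ^ Suc n)" let ?T = "Abs_fps (\<lambda>n. a ^ Suc n)"
  have split: "Abs_fps (\<lambda>n. \<Sum>\<mu>\<leftarrow>a # ds. \<mu> ^ Suc n) = ?T + ?S"
    by (simp add: fps_eq_iff)
  have "?T * ?L = fps_const a"
  proof (rule fps_ext)
    fix n show "fps_nth (?T * ?L) n = fps_nth (fps_const a) n"
      by (cases n) (simp_all add: algebra_simps)
  qed
  then have T: "?T * (?L * ?P) = fps_const a * ?P" by (simp only: mult.assoc[symmetric])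
  have "fps_deriv (?L * ?P) = ?L * fps_deriv ?P - fps_const a * ?P"
    by (simp add: algebra_simps)
  also have "\<dots> = - (?S * (?L * ?P)) - ?T * (?L * ?P)"
    unfolding Cons.IH T by (simp add: algebra_simps)
  also have "\<dots> = - ((?T + ?S) * (?L * ?P))" by (simp add: algebra_simps)
  finally show ?case unfolding split by simp
qed

lemma newton_recurrence:
  fixes F S :: "complex fps"
  assumes "fps_deriv F = - (S * F)"
  shows "of_nat (Suc k) * fps_nth F (Suc k) = - (\<Sum>i\<le>k. fps_nth S i * fps_nth F (k - i))"
  using arg_cong[OF assms, of "\<lambda>f. fps_nth f k"] by (simp add: fps_mult_nth atLeast0AtMost)

text \<open>The relation between a sequence of traces and the Taylor coefficients of the exponential
  of minus the series of t p z^p / p. It is stated as a recursion so that it applies equally to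
  finite determinants and to \<open>d\<close>.\<close>

definition newton :: "(nat \<Rightarrow> complex) \<Rightarrow> (nat \<Rightarrow> complex) \<Rightarrow> bool" where
  "newton t c \<longleftrightarrow> c 0 = 1 \<and> (\<forall>k. of_nat (Suc k) * c (Suc k) = - (\<Sum>i\<le>k. t (Suc i) * c (k - i)))"

text \<open>Each coefficient is a polynomial in finitely many traces, so convergence of traces,
  exponent by exponent, suffices.\<close>

lemma newton_tendsto:
  assumes t: "\<And>p. p \<ge> 1 \<Longrightarrow> (\<lambda>N. t N p) \<longlonglongrightarrow> t' p"
    and c: "\<And>N. newton (t N) (c N)" and c': "newton t' c'"
  shows "(\<lambda>N. c N k) \<longlonglongrightarrow> c' k"
proof (induction k rule: less_induct)
  case (less k)
  show ?case
  proof (cases k)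
    case 0
    then show ?thesis using c c' by (simp add: newton_def)
  next
    case (Suc m)
    have e: "b (Suc m) = - (\<Sum>i\<le>m. s (Suc i) * b (m - i)) / of_nat (Suc m)" if "newton s b" for s b
      using that unfolding newton_def by (simp add: field_simps del: of_nat_Suc)
    show ?thesis unfolding Suc e[OF c] e[OF c']
      by (intro tendsto_intros t less) (auto simp: Suc simp del: of_nat_Suc)
  qed
qed

lemma has_fps_expansion_sums:
  fixes f :: "complex \<Rightarrow> complex"
  assumes "f has_fps_expansion F" "f holomorphic_on UNIV"
  shows "(\<lambda>n. fps_nth F n * z ^ n) sums f z"
  using holomorphic_power_series[of f 0 "norm z + 1" z] assms
  by (auto simp: fps_nth_fps_expansion[OF assms(1)] intro: holomorphic_on_subset)

lemma fdet_newton: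
  assumes "finite B"
  obtains c where "newton (\<lambda>p. \<Sum>j\<in>B. fpow B a p j j) c"
    "\<And>z. (\<lambda>n. c n * z ^ n) sums fdet B (\<lambda>j k. kron j k - z * a j k)"
    "(\<lambda>z. fdet B (\<lambda>j k. kron j k - z * a j k)) holomorphic_on UNIV"
proof -
  obtain ds where ds: "\<And>z. fdet B (\<lambda>j k. kron j k - z * a j k) = (\<Prod>\<mu>\<leftarrow>ds. 1 - \<mu> * z)"
    "\<And>p. (\<Sum>j\<in>B. fpow B a p j j) = (\<Sum>\<mu>\<leftarrow>ds. \<mu> ^ p)"
    using det_trace_spectrum[OF assms, of a] by blast
  let ?F = "\<Prod>\<mu>\<leftarrow>ds. 1 - fps_const \<mu> * fps_X :: complex fps"
  have hol: "(\<lambda>z. \<Prod>\<mu>\<leftarrow>ds. 1 - \<mu> * z) holomorphic_on UNIV" for ds :: "complex list"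
    by (induction ds) (auto intro!: holomorphic_intros)
  have F0: "fps_nth (\<Prod>\<mu>\<leftarrow>ds. 1 - fps_const \<mu> * fps_X) 0 = 1" for ds :: "complex list"
    by (induction ds) auto
  have "newton (\<lambda>p. \<Sum>j\<in>B. fpow B a p j j) (fps_nth ?F)"
    unfolding newton_def ds(2) using F0 newton_recurrence[OF fps_deriv_prod_linear, of _ ds] by simp
  moreover have "(\<lambda>n. fps_nth ?F n * z ^ n) sums fdet B (\<lambda>j k. kron j k - z * a j k)" for z
    unfolding ds(1) by (rule has_fps_expansion_sums[OF has_fps_expansion_prod_linear hol])
  ultimately show ?thesis using that[of "fps_nth ?F"] hol unfolding ds(1) by blast
qed

text \<open>The formula for \<open>d\<close> is known only near 0, but that determines the Taylor
  coefficients, and as \<open>d\<close> is entire its Taylor series then represents it everywhere.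
  The geometric bound on \<open>t\<close> gives the exponent a positive radius of
  convergence.\<close>

lemma exp_trace_newton:
  fixes d :: "complex \<Rightarrow> complex"
  assumes hol: "d holomorphic_on UNIV"
    and ev: "\<forall>\<^sub>F z in nhds 0. d z = exp (- (\<Sum>n. 1 / of_nat (Suc n) * t (Suc n) * z ^ Suc n))"
    and t: "\<And>n. cmod (t (Suc n)) \<le> K * D ^ Suc n" and D: "D > 0"
  obtains c where "newton t c" "\<And>z. (\<lambda>n. c n * z ^ n) sums d z"
proof -
  define S where "S = Abs_fps (\<lambda>n. if n = 0 then 0 else - t n / of_nat n)"
  let ?s = "\<lambda>z. - (\<Sum>n. 1 / of_nat (Suc n) * t (Suc n) * z ^ Suc n)"
  have "0 \<le> K * D ^ Suc 0" using t[of 0] norm_ge_zero order_trans by blast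
  then have K: "K \<ge> 0" using D by (simp add: zero_le_mult_iff)
  have Sn: "fps_nth S (Suc n) * z ^ Suc n = - (1 / of_nat (Suc n) * t (Suc n) * z ^ Suc n)" for n z
    by (simp add: S_def)
  \<comment> \<open>The radius \<open>1 / (2 * D)\<close> makes the terms at most
    \<open>K * (1/2) ^ Suc n\<close>.\<close>
  have summ: "summable (\<lambda>n. fps_nth S n * z ^ n)" if z: "norm z \<le> 1 / (2 * D)" for z
  proof -
    have "summable (\<lambda>n. fps_nth S (Suc n) * z ^ Suc n)"
    proof (rule summable_comparison_test'[where N=0 and g="\<lambda>n. K * (1/2) ^ Suc n"])
      show "summable (\<lambda>n. K * (1/2) ^ Suc n :: real)"
        by (intro summable_mult) (simp only: summable_Suc_iff, simp)
      fix n
      have "norm (fps_nth S (Suc n) * z ^ Suc n) = 1 / real (Suc n) * (cmod (t (Suc n)) * norm z ^ Suc n)"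
        unfolding Sn by (simp only: norm_minus_cancel norm_mult norm_divide norm_power norm_of_nat norm_one mult.assoc)
      also have "\<dots> \<le> 1 * ((K * D ^ Suc n) * (1 / (2 * D)) ^ Suc n)"
        using K D by (intro mult_mono t power_mono z) (auto simp del: power_Suc)
      also have "\<dots> = K * (D * (1 / (2 * D))) ^ Suc n"
        unfolding power_mult_distrib by simp
      also have "D * (1 / (2 * D)) = 1/2" using D by simp
      finally show "norm (fps_nth S (Suc n) * z ^ Suc n) \<le> K * (1/2) ^ Suc n" .
    qed
    then show ?thesis by (rule summable_Suc_iff[THEN iffD1])
  qed
  have "ereal (norm (of_real (1 / (2 * D)) :: complex)) \<le> fps_conv_radius S"
    unfolding fps_conv_radius_def by (rule conv_radius_geI) (rule summ, use D in \<open>simp add: norm_divide\<close>)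
  moreover have "0 < ereal (norm (of_real (1 / (2 * D)) :: complex))" using D by (simp add: norm_divide)
  ultimately have rad: "fps_conv_radius S > 0" by (rule less_le_trans[rotated])
  have S: "?s has_fps_expansion S"
    unfolding has_fps_expansion_def
  proof (intro conjI rad)
    have "eventually (\<lambda>z::complex. norm z < 1 / (2 * D)) (nhds 0)"
      using D by (auto simp: eventually_nhds_metric intro!: exI[of _ "1 / (2 * D)"])
    then show "\<forall>\<^sub>F z in nhds 0. eval_fps S z = ?s z"
    proof eventually_elim
      case (elim z)
      then have s1: "summable (\<lambda>n. fps_nth S n * z ^ n)" by (intro summ) auto
      then have s2: "summable (\<lambda>n. - (1 / of_nat (Suc n) * t (Suc n) * z ^ Suc n))"
        unfolding Sn[symmetric] by (rule summable_Suc_iff[THEN iffD2])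
      have "eval_fps S z = (\<Sum>n. fps_nth S (Suc n) * z ^ Suc n)"
        using suminf_split_head[OF s1] by (simp add: eval_fps_def S_def)
      also have "\<dots> = ?s z" unfolding Sn
        by (rule suminf_minus) (use s2 in \<open>simp only: summable_minus_iff\<close>)
      finally show ?case .
    qed
  qed
  define E where "E = fps_compose (fps_exp 1) S"
  have S0: "fps_nth S 0 = 0" by (simp add: S_def)
  have "((\<lambda>z. exp (1 * z)) \<circ> ?s) has_fps_expansion E"
    unfolding E_def by (rule has_fps_expansion_compose[OF has_fps_expansion_exp S S0])
  then have "d has_fps_expansion E"
    using has_fps_expansion_cong[OF ev refl, of E] by (simp add: comp_def)
  then have sums: "(\<lambda>n. fps_nth E n * z ^ n) sums d z" for z
    by (rule has_fps_expansion_sums[OF _ hol])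
  have "fps_deriv E = - (Abs_fps (\<lambda>n. t (Suc n)) * E)"
  proof -
    have "fps_deriv S = - Abs_fps (\<lambda>n. t (Suc n))"
      by (rule fps_ext) (simp add: S_def field_simps del: of_nat_Suc)
    then show ?thesis unfolding E_def fps_compose_deriv[OF S0] by simp
  qed
  from newton_recurrence[OF this] have "newton t (fps_nth E)"
    unfolding newton_def by (simp add: E_def)
  then show ?thesis using that sums by blast
qed

text \<open>Cauchy's inequality on a circle of radius larger than |z| bounds the coefficients
  uniformly in \<open>N\<close>. The series at \<open>z\<close> then have a common geometric
  majorant, and Tannery's theorem carries convergence of coefficients over to the values.\<close>

lemma entire_limit_bound:
  fixes f :: "nat \<Rightarrow> complex \<Rightarrow> complex" and \<Phi> :: "real \<Rightarrow> real"
  assumes hol: "\<And>N. f N holomorphic_on UNIV"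
    and sums: "\<And>N z. (\<lambda>n. c N n * z ^ n) sums f N z"
    and bound: "\<And>N z. cmod (f N z) \<le> \<Phi> (cmod z)"
    and lim: "\<And>n. (\<lambda>N. c N n) \<longlonglongrightarrow> c' n"
    and sums': "\<And>z. (\<lambda>n. c' n * z ^ n) sums d z"
  shows "cmod (d z) \<le> \<Phi> (cmod z)"
proof -
  define r where "r = cmod z + 1"
  have r: "r > 0" "cmod z / r < 1" "cmod z / r \<ge> 0" unfolding r_def
    using norm_ge_zero[of z] by (auto simp: field_simps add_nonneg_pos simp del: norm_ge_zero)
  have cb: "cmod (c N n) \<le> \<Phi> r / r ^ n" for N n
  proof -
    have "f N has_fps_expansion Abs_fps (c N)"
      unfolding has_fps_expansion_def
    proof
      have "ereal (norm (1::complex)) \<le> fps_conv_radius (Abs_fps (c N))"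
        unfolding fps_conv_radius_def
        by (rule conv_radius_geI) (use sums_summable[OF sums[of N 1]] in simp)
      moreover have "0 < ereal (norm (1::complex))" by simp
      ultimately show "fps_conv_radius (Abs_fps (c N)) > 0" by (rule less_le_trans[rotated])
      show "\<forall>\<^sub>F z in nhds 0. eval_fps (Abs_fps (c N)) z = f N z"
        using sums_unique[OF sums[of N]] by (auto simp: eval_fps_def intro!: always_eventually)
    qed
    from fps_nth_fps_expansion[OF this, of n]
    have "c N n = (deriv ^^ n) (f N) 0 / fact n" by simp
    moreover have "cmod ((deriv ^^ n) (f N) 0) \<le> fact n * \<Phi> r / r ^ n"
    proof (rule Cauchy_inequality)
      show "f N holomorphic_on ball 0 r" "continuous_on (cball 0 r) (f N)"
        using hol[of N] holomorphic_on_imp_continuous_on holomorphic_on_subset by blast+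
      show "cmod (f N x) \<le> \<Phi> r" if "cmod (0 - x) = r" for x
        using bound[of N x] that by simp
    qed (use r in auto)
    then have "cmod ((deriv ^^ n) (f N) 0) / fact n \<le> \<Phi> r / r ^ n"
      using divide_right_mono[of _ "fact n * \<Phi> r / r ^ n" "fact n :: real"] by fastforce
    ultimately show ?thesis by (simp add: norm_divide)
  qed
  have "eventually (\<lambda>N. summable (\<lambda>k. norm (c N k * z ^ k))) sequentially \<and>
           summable (\<lambda>n. norm (c' n * z ^ n)) \<and>
           (\<lambda>N. suminf (\<lambda>k. c N k * z ^ k)) \<longlonglongrightarrow> suminf (\<lambda>k. c' k * z ^ k)"
  proof (rule tannerys_theorem[where M="\<lambda>n. \<Phi> r * (cmod z / r) ^ n"])
    show "(\<lambda>N. c N k * z ^ k) \<longlonglongrightarrow> c' k * z ^ k" for k by (intro tendsto_intros lim)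
    have "norm (c N k * z ^ k) \<le> \<Phi> r * (cmod z / r) ^ k" for N k
      using mult_right_mono[OF cb[of N k], of "cmod z ^ k"] by (simp add: norm_mult norm_power power_divide)
    then show "eventually (\<lambda>(k,N). norm (c N k * z ^ k) \<le> \<Phi> r * (cmod z / r) ^ k) (sequentially \<times>\<^sub>F sequentially)"
      by (auto intro!: always_eventually)
    show "summable (\<lambda>n. \<Phi> r * (cmod z / r) ^ n)"
      using r by (intro summable_mult summable_geometric) auto
  qed simp
  then have "(\<lambda>N. f N z) \<longlonglongrightarrow> d z"
    by (simp add: sums_unique[OF sums, symmetric] sums_unique[OF sums', symmetric])
  then have "(\<lambda>N. cmod (f N z)) \<longlonglongrightarrow> cmod (d z)" by (rule tendsto_norm)
  then show ?thesis by (rule LIMSEQ_le_const2) (use bound in auto)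
qed

text \<open>The function-theoretic half of the argument in isolation. What remains for the dynamics
  is the convergence of the traces of the sections and a bound on their determinants that does not
  depend on \<open>N\<close>.\<close>

lemma determinant_limit_bound:
  fixes d :: "complex \<Rightarrow> complex" and B :: "nat \<Rightarrow> 'a set"
  assumes hol: "d holomorphic_on UNIV"
    and ev: "\<forall>\<^sub>F z in nhds 0. d z = exp (- (\<Sum>n. 1 / of_nat (Suc n) * t (Suc n) * z ^ Suc n))"
    and t: "\<And>n. cmod (t (Suc n)) \<le> K * D ^ Suc n" and D: "D > 0"
    and B: "\<And>N. finite (B N)"
    and tr: "\<And>p. p \<ge> 1 \<Longrightarrow> (\<lambda>N. \<Sum>j\<in>B N. fpow (B N) a p j j) \<longlonglongrightarrow> t p"
    and bound: "\<And>N z. cmod (fdet (B N) (\<lambda>j k. kron j k - z * a j k)) \<le> \<Phi> (cmod z)"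
  shows "cmod (d z) \<le> \<Phi> (cmod z)"
proof -
  obtain c' where c': "newton t c'" "\<And>z. (\<lambda>n. c' n * z ^ n) sums d z"
    using exp_trace_newton[OF hol ev t D] by blast
  have "\<forall>N. \<exists>c. newton (\<lambda>p. \<Sum>j\<in>B N. fpow (B N) a p j j) c \<and>
    (\<forall>z. (\<lambda>n. c n * z ^ n) sums fdet (B N) (\<lambda>j k. kron j k - z * a j k)) \<and>
    (\<lambda>z. fdet (B N) (\<lambda>j k. kron j k - z * a j k)) holomorphic_on UNIV"
  proof
    fix N
    from fdet_newton[OF B[of N], of a] show "\<exists>c. newton (\<lambda>p. \<Sum>j\<in>B N. fpow (B N) a p j j) c \<and>
      (\<forall>z. (\<lambda>n. c n * z ^ n) sums fdet (B N) (\<lambda>j k. kron j k - z * a j k)) \<and>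
      (\<lambda>z. fdet (B N) (\<lambda>j k. kron j k - z * a j k)) holomorphic_on UNIV" by blast
  qed
  from choice[OF this] obtain c where c: "\<And>N. newton (\<lambda>p. \<Sum>j\<in>B N. fpow (B N) a p j j) (c N)"
    "\<And>N z. (\<lambda>n. c N n * z ^ n) sums fdet (B N) (\<lambda>j k. kron j k - z * a j k)"
    "\<And>N. (\<lambda>z. fdet (B N) (\<lambda>j k. kron j k - z * a j k)) holomorphic_on UNIV"
    by blast
  show ?thesis
    by (rule entire_limit_bound[OF c(3,2) bound newton_tendsto[OF tr c(1) c'(1)] c'(2)])
qed

subsection \<open>Determinant bounds\<close>

abbreviation nrm :: "'a set \<Rightarrow> ('a \<Rightarrow> complex) \<Rightarrow> real" where
  "nrm B x \<equiv> L2_set (\<lambda>j. cmod (x j)) B"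

lemma nrm_sq: "(nrm B x)\<^sup>2 = (\<Sum>j\<in>B. (cmod (x j))\<^sup>2)"
  by (simp add: L2_set_def sum_nonneg)

lemma nrm_add: "nrm B (\<lambda>j. x j + y j) \<le> nrm B x + nrm B y"
  by (rule order_trans[OF L2_set_mono L2_set_triangle_ineq]) (auto intro: norm_triangle_ineq)

lemma nrm_scale: "nrm B (\<lambda>j. c * x j) = cmod c * nrm B x"
  by (simp add: norm_mult L2_set_right_distrib)

lemma nrm_sum: "finite I \<Longrightarrow> nrm B (\<lambda>j. \<Sum>i\<in>I. x i j) \<le> (\<Sum>i\<in>I. nrm B (x i))"
proof (induction I rule: finite_induct)
  case empty
  then show ?case by (simp add: L2_set_def)
next
  case (insert a I)
  then show ?case using nrm_add[of "x a" "\<lambda>j. \<Sum>i\<in>I. x i j" B] by simp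
qed

lemma nrm_inner: "cmod (\<Sum>j\<in>B. cnj (x j) * y j) \<le> nrm B x * nrm B y"
proof -
  have "cmod (\<Sum>j\<in>B. cnj (x j) * y j) \<le> (\<Sum>j\<in>B. \<bar>cmod (x j)\<bar> * \<bar>cmod (y j)\<bar>)"
    by (rule order_trans[OF norm_sum]) (simp add: norm_mult)
  also have "\<dots> \<le> nrm B x * nrm B y" by (rule L2_set_mult_ineq)
  finally show ?thesis .
qed

lemma sum_kron_left: "finite B \<Longrightarrow> j \<in> B \<Longrightarrow> (\<Sum>m\<in>B. kron j m * x m) = x j"
  by (subst sum.mono_neutral_right[of B "{j}"]) auto

lemma sum_kron_right: "finite B \<Longrightarrow> k \<in> B \<Longrightarrow> (\<Sum>m\<in>B. x m * kron m k) = x k"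
  by (subst sum.mono_neutral_right[of B "{k}"]) auto

lemma fdet_scale:
  assumes "finite B"
  shows "fdet B (\<lambda>j k. u j * a j k * v k) = prod u B * fdet B a * prod v B"
proof -
  have "fdet B (\<lambda>j k. u j * a j k * v k)
    = fdet B (\<lambda>j k. \<Sum>m\<in>B. (if j = m then u j else 0) * (\<Sum>n\<in>B. a m n * (if n = k then v n else 0)))"
    using assms by (intro fdet_cong) (auto simp: if_distrib if_distribR sum.delta sum.delta' cong: if_cong)
  also have "\<dots> = prod u B * (fdet B a * prod v B)"
    by (simp only: fdet_mult[OF assms] fdet_diag[OF assms])
  finally show ?thesis by simp
qed

text \<open>By Sylvester's identity the determinant is one of size \<open>q\<close>, namely of \<open>K = 1 - z S Q\<^sup>* X P S\<close> with
  \<open>S\<^sup>2 = diag s\<close>. Dividing it on both sides by the square root of \<open>diag (1 + \<bar>z\<bar> c s)\<close> makes its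
  numerical radius, hence every eigenvalue, at most one.\<close>

lemma cmod_fdet_le:
  fixes s :: "nat \<Rightarrow> real"
  assumes B: "finite B" and c: "c \<ge> 0" and s: "\<And>l. s l \<ge> 0"
    and X: "\<And>x. nrm B (\<lambda>j. \<Sum>k\<in>B. X j k * x k) \<le> c * nrm B x"
    and P: "\<And>x. nrm B (\<lambda>j. \<Sum>l<q. P j l * x l) \<le> nrm {..<q} x"
    and Q: "\<And>x. nrm B (\<lambda>j. \<Sum>l<q. Q j l * x l) \<le> nrm {..<q} x"
  shows "cmod (fdet B (\<lambda>j k. kron j k - z * (\<Sum>m\<in>B. X j m * (\<Sum>l<q. P m l * of_real (s l) * cnj (Q k l)))))
    \<le> (\<Prod>l<q. 1 + cmod z * c * s l)"
proof -
  define r where "r l = complex_of_real (sqrt (s l))" for l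
  define w where "w l = complex_of_real (sqrt (1 + cmod z * c * s l))" for l
  have w: "w l \<noteq> 0" "w l * w l = 1 + cmod z * c * s l" "cnj (w l) = w l" for l
    using c s[of l] by (auto simp: w_def add_nonneg_eq_0_iff simp flip: of_real_mult)
  have r: "r l * r l = s l" "cnj (r l) = r l" for l
    using s[of l] by (auto simp: r_def simp flip: of_real_mult)
  define p where "p j l = z * (\<Sum>m\<in>B. X j m * P m l) * r l" for j l
  define q' where "q' l k = r l * cnj (Q k l)" for l k
  define K where "K l m = kron l m - (\<Sum>j\<in>B. q' l j * p j m)" for l m
  have "fdet B (\<lambda>j k. kron j k - z * (\<Sum>m\<in>B. X j m * (\<Sum>l<q. P m l * of_real (s l) * cnj (Q k l))))
      = fdet B (\<lambda>j k. kron j k - (\<Sum>l<q. p j l * q' l k))"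
  proof (rule fdet_cong[OF B])
    fix j k
    have "z * (\<Sum>m\<in>B. X j m * (\<Sum>l<q. P m l * of_real (s l) * cnj (Q k l)))
      = (\<Sum>m\<in>B. \<Sum>l<q. z * X j m * P m l * (r l * r l) * cnj (Q k l))"
      by (simp add: sum_distrib_left mult_ac r)
    also have "\<dots> = (\<Sum>l<q. p j l * q' l k)"
      by (subst sum.swap) (simp add: p_def q'_def sum_distrib_left sum_distrib_right mult_ac)
    finally show "kron j k - z * (\<Sum>m\<in>B. X j m * (\<Sum>l<q. P m l * of_real (s l) * cnj (Q k l)))
      = kron j k - (\<Sum>l<q. p j l * q' l k)" by simp
  qed
  also have "\<dots> = fdet {..<q} K"
    unfolding K_def[abs_def] by (rule fdet_sylvester[OF B]) simp
  also have "\<dots> = fdet {..<q} (\<lambda>l m. w l * (inverse (w l) * K l m * inverse (w m)) * w m)"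
    by (rule fdet_cong) (simp_all add: w(1))
  also have "\<dots> = (\<Prod>l<q. w l * w l) * fdet {..<q} (\<lambda>l m. inverse (w l) * K l m * inverse (w m))"
    by (subst fdet_scale) (simp_all add: prod.distrib)
  finally have eq: "fdet B (\<lambda>j k. kron j k - z * (\<Sum>m\<in>B. X j m * (\<Sum>l<q. P m l * of_real (s l) * cnj (Q k l))))
     = (\<Prod>l<q. w l * w l) * fdet {..<q} (\<lambda>l m. inverse (w l) * K l m * inverse (w m))" .
  have "cmod (fdet {..<q} (\<lambda>l m. inverse (w l) * K l m * inverse (w m))) \<le> 1"
  proof (rule cmod_det_le_one)
    fix v :: "nat \<Rightarrow> complex"
    \<comment> \<open>With v = w x, the form of the normalised kernel at \<open>v\<close> is the
      form of \<open>K\<close> at \<open>x\<close>. The vector \<open>y\<close> places the square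
      root of the singular values on either side of the middle factor, so that the bounds on
      \<open>Q\<close>, \<open>X\<close> and \<open>P\<close> apply to it.\<close>
    define x where "x l = inverse (w l) * v l" for l
    define y where "y l = r l * x l" for l
    have v: "v l = w l * x l" for l using w by (simp add: x_def)
    have "(\<Sum>l<q. cnj (v l) * (\<Sum>m<q. inverse (w l) * K l m * inverse (w m) * v m))
      = (\<Sum>l<q. cnj (x l) * (\<Sum>m<q. K l m * x m))"
    proof (intro sum.cong refl)
      fix l
      have "(\<Sum>m<q. inverse (w l) * K l m * inverse (w m) * v m) = inverse (w l) * (\<Sum>m<q. K l m * x m)"
        by (simp only: x_def sum_distrib_left mult.assoc)
      moreover have "cnj (v l) * inverse (w l) = cnj (x l)" using w(1)[of l] w(3)[of l] by (simp add: v)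
      ultimately show "cnj (v l) * (\<Sum>m<q. inverse (w l) * K l m * inverse (w m) * v m)
        = cnj (x l) * (\<Sum>m<q. K l m * x m)" by (simp only: mult.assoc[symmetric])
    qed
    also have "\<dots> = (\<Sum>l<q. cnj (x l) * x l) - (\<Sum>l<q. cnj (x l) * (\<Sum>m<q. (\<Sum>j\<in>B. q' l j * p j m) * x m))"
    proof -
      have "(\<Sum>m<q. K l m * x m) = x l - (\<Sum>m<q. (\<Sum>j\<in>B. q' l j * p j m) * x m)" if "l < q" for l
        using that by (simp add: K_def left_diff_distrib sum_subtractf sum_kron_left)
      then have "(\<Sum>l<q. cnj (x l) * (\<Sum>m<q. K l m * x m))
        = (\<Sum>l<q. cnj (x l) * (x l - (\<Sum>m<q. (\<Sum>j\<in>B. q' l j * p j m) * x m)))"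
        by (intro sum.cong) auto
      then show ?thesis by (simp only: right_diff_distrib sum_subtractf)
    qed
    also have "(\<Sum>l<q. cnj (x l) * (\<Sum>m<q. (\<Sum>j\<in>B. q' l j * p j m) * x m))
      = z * (\<Sum>j\<in>B. cnj (\<Sum>l<q. Q j l * y l) * (\<Sum>k\<in>B. X j k * (\<Sum>m<q. P k m * y m)))"
    proof -
      have q: "(\<Sum>l<q. cnj (x l) * q' l j) = cnj (\<Sum>l<q. Q j l * y l)" for j
        by (simp add: q'_def y_def r mult_ac)
      have p: "(\<Sum>m<q. p j m * x m) = z * (\<Sum>k\<in>B. X j k * (\<Sum>m<q. P k m * y m))" for j
      proof -
        have "(\<Sum>m<q. p j m * x m) = (\<Sum>m<q. \<Sum>k\<in>B. z * X j k * P k m * y m)"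
          by (simp add: p_def y_def sum_distrib_left sum_distrib_right mult_ac)
        also have "\<dots> = z * (\<Sum>k\<in>B. X j k * (\<Sum>m<q. P k m * y m))"
          by (subst sum.swap) (simp add: sum_distrib_left mult_ac)
        finally show ?thesis .
      qed
      have "(\<Sum>m<q. (\<Sum>j\<in>B. q' l j * p j m) * x m) = (\<Sum>j\<in>B. q' l j * (\<Sum>m<q. p j m * x m))" for l
        by (simp add: sum_distrib_left sum_distrib_right mult_ac) (rule sum.swap)
      then have "(\<Sum>l<q. cnj (x l) * (\<Sum>m<q. (\<Sum>j\<in>B. q' l j * p j m) * x m))
        = (\<Sum>l<q. \<Sum>j\<in>B. cnj (x l) * q' l j * (\<Sum>m<q. p j m * x m))"
        by (simp add: sum_distrib_left mult_ac)
      also have "\<dots> = (\<Sum>j\<in>B. (\<Sum>l<q. cnj (x l) * q' l j) * (\<Sum>m<q. p j m * x m))"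
        by (subst sum.swap) (simp add: sum_distrib_right)
      finally show ?thesis unfolding p q by (simp add: sum_distrib_left mult_ac)
    qed
    finally have e: "(\<Sum>l<q. cnj (v l) * (\<Sum>m<q. inverse (w l) * K l m * inverse (w m) * v m))
      = (\<Sum>l<q. cnj (x l) * x l) - z * (\<Sum>j\<in>B. cnj (\<Sum>l<q. Q j l * y l) * (\<Sum>k\<in>B. X j k * (\<Sum>m<q. P k m * y m)))" .
    have "cmod (\<Sum>j\<in>B. cnj (\<Sum>l<q. Q j l * y l) * (\<Sum>k\<in>B. X j k * (\<Sum>m<q. P k m * y m)))
      \<le> nrm B (\<lambda>j. \<Sum>l<q. Q j l * y l) * nrm B (\<lambda>j. \<Sum>k\<in>B. X j k * (\<Sum>m<q. P k m * y m))"
      by (rule nrm_inner)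
    also have "\<dots> \<le> nrm {..<q} y * (c * nrm {..<q} y)"
      by (intro mult_mono Q order_trans[OF X mult_left_mono[OF P c]]) (auto intro: c)
    also have "\<dots> = c * (\<Sum>l<q. (cmod (y l))\<^sup>2)" by (simp only: nrm_sq[symmetric]) (simp add: power2_eq_square)
    finally have b: "cmod (\<Sum>j\<in>B. cnj (\<Sum>l<q. Q j l * y l) * (\<Sum>k\<in>B. X j k * (\<Sum>m<q. P k m * y m)))
      \<le> c * (\<Sum>l<q. (cmod (y l))\<^sup>2)" .
    have "cmod (\<Sum>l<q. cnj (v l) * (\<Sum>m<q. inverse (w l) * K l m * inverse (w m) * v m))
      \<le> cmod (\<Sum>l<q. cnj (x l) * x l) + cmod z * (c * (\<Sum>l<q. (cmod (y l))\<^sup>2))"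
      unfolding e by (rule order_trans[OF norm_triangle_ineq4], unfold norm_mult) (intro add_mono order_refl mult_left_mono b norm_ge_zero)
    also have "cmod (\<Sum>l<q. cnj (x l) * x l) \<le> (\<Sum>l<q. (cmod (x l))\<^sup>2)"
      by (rule order_trans[OF norm_sum]) (simp add: norm_mult power2_eq_square)
    also have "(\<Sum>l<q. (cmod (x l))\<^sup>2) + cmod z * (c * (\<Sum>l<q. (cmod (y l))\<^sup>2))
       = (\<Sum>l<q. (1 + cmod z * c * s l) * (cmod (x l))\<^sup>2)"
    proof -
      have y2: "(cmod (y l))\<^sup>2 = s l * (cmod (x l))\<^sup>2" for l
        using s[of l] by (simp add: y_def norm_mult power_mult_distrib r_def)
      show ?thesis unfolding y2 sum_distrib_left sum.distrib[symmetric]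
        by (intro sum.cong refl) (simp add: algebra_simps)
    qed
    also have "\<dots> = (\<Sum>l<q. (cmod (v l))\<^sup>2)"
      using c s by (intro sum.cong) (auto simp: v norm_mult power_mult_distrib w_def)
    finally show "cmod (\<Sum>l<q. cnj (v l) * (\<Sum>m<q. inverse (w l) * K l m * inverse (w m) * v m)) \<le> (\<Sum>l<q. (cmod (v l))\<^sup>2)"
      by simp
  qed simp
  moreover have "cmod (\<Prod>l<q. w l * w l) = (\<Prod>l<q. 1 + cmod z * c * s l)"
  proof -
    have "(\<Prod>l<q. w l * w l) = of_real (\<Prod>l<q. 1 + cmod z * c * s l)" unfolding w by simp
    moreover have "(\<Prod>l<q. 1 + cmod z * c * s l) \<ge> 0" using c s by (intro prod_nonneg) auto
    ultimately show ?thesis by (simp only: norm_of_real abs_of_nonneg)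
  qed
  moreover have "(\<Prod>l<q. 1 + cmod z * c * s l) \<ge> 0" using c s by (intro prod_nonneg) auto
  ultimately show ?thesis unfolding eq norm_mult by (simp only: mult_left_le)
qed

subsection \<open>Strictly triangular block matrices\<close>

lemma nrm_levels:
  assumes "finite B" "\<And>j. j \<in> B \<Longrightarrow> lev j \<le> (N::nat)"
  shows "nrm B x = L2_set (\<lambda>m. nrm {j\<in>B. lev j = m} x) {..N}"
proof -
  have "(\<Sum>j\<in>B. (cmod (x j))\<^sup>2) = (\<Sum>m\<le>N. \<Sum>j\<in>{j\<in>B. lev j = m}. (cmod (x j))\<^sup>2)"
    using assms by (intro sum.group[symmetric]) auto
  then show ?thesis by (simp add: L2_set_def sum_nonneg)
qed

lemma sum_levels:
  assumes "finite B" "\<And>j. j \<in> B \<Longrightarrow> lev j \<le> (N::nat)"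
  shows "(\<Sum>j\<in>B. x j) = (\<Sum>m\<le>N. \<Sum>j\<in>{j\<in>B. lev j = m}. x j)"
  using assms by (intro sum.group[symmetric]) auto

text \<open>Moving a window towards the origin can only increase the product of a decreasing
  sequence. Done twice, this detaches the first \<open>p\<close> factors, which will be a
  coefficient of \<open>G_fun\<close>, from a rest that is summed separately.\<close>

lemma prod_decseq_split:
  fixes g :: "nat \<Rightarrow> real"
  assumes "decseq g" "\<And>n. g n > 0" "p \<le> D"
  shows "(\<Prod>i\<in>{m..<m+D}. g i) \<le> (\<Prod>i<p. g i) * (\<Prod>i<D-p. g i)"
proof -
  have a: "(\<Prod>i\<in>{m..<m+D}. g i) \<le> (\<Prod>i<D. g i)" for m D
  proof -
    have "(\<Prod>i\<in>{m..<m+D}. g i) = (\<Prod>i<D. g (m + i))"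
      by (rule prod.reindex_bij_witness[of _ "\<lambda>i. m + i" "\<lambda>i. i - m"]) auto
    also have "\<dots> \<le> (\<Prod>i<D. g i)"
      using assms by (intro prod_mono) (auto simp: less_imp_le decseq_def)
    finally show ?thesis .
  qed
  have "(\<Prod>i<D. g i) = (\<Prod>i<p. g i) * (\<Prod>i\<in>{p..<p+(D-p)}. g i)"
    using assms(3) by (simp add: lessThan_atLeast0 prod.atLeastLessThan_concat)
  also have "\<dots> \<le> (\<Prod>i<p. g i) * (\<Prod>i<D-p. g i)"
    using assms by (intro mult_left_mono a prod_nonneg) (auto simp: less_imp_le)
  finally show ?thesis using a[of m D] by simp
qed

text \<open>A path of \<open>p\<close> strict increases from level \<open>m\<close> to level \<open>n\<close> can be chosen in at most \<open>2\<^bsup>n - m\<^esup>\<close> ways,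
  which accounts for the factor \<open>2 * lam\<close>.\<close>

lemma fpow_triangular_bound:
  fixes lev :: "'a \<Rightarrow> nat" and g :: "nat \<Rightarrow> real"
  assumes B: "finite B" "\<And>j. j \<in> B \<Longrightarrow> lev j \<le> N"
    and g: "decseq g" "\<And>n. g n > 0" and C: "C \<ge> 0" and lam: "lam > 0"
    and tri: "\<And>j k. j \<in> B \<Longrightarrow> k \<in> B \<Longrightarrow> \<not> lev j < lev k \<Longrightarrow> u j k = 0"
    and block: "\<And>m n x. m < n \<Longrightarrow> nrm {j\<in>B. lev j = m} (\<lambda>j. \<Sum>k\<in>{k\<in>B. lev k = n}. u j k * x k)
       \<le> C * lam ^ (n - m) * (\<Prod>i\<in>{m..<n}. g i) * nrm {k\<in>B. lev k = n} x"
    and G: "\<And>n. (\<Sum>i<n. (2 * lam) ^ i * (\<Prod>k<i. g k)) \<le> G"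
  shows "nrm B (\<lambda>j. \<Sum>k\<in>B. fpow B u p j k * x k) \<le> G * (2 * lam * C) ^ p * (\<Prod>k<p. g k) * nrm B x"
proof -
  define Bl where "Bl m = {j\<in>B. lev j = m}" for m
  define X where "X m = nrm (Bl m) x" for m
  define y where "y p j = (\<Sum>k\<in>B. fpow B u p j k * x k)" for p j
  define \<psi> where "\<psi> m n = (\<Prod>i\<in>{m..<n}. g i)" for m n
  \<comment> \<open>Bound for the block (m, n) of the p-th power. It vanishes below n = m + p, since
    each step raises the level; the products \<psi> along a path concatenate to \<psi> m n.\<close>
  define b where "b p m n = (if m + p \<le> n then C ^ p * (2 * lam) ^ (n - m) * \<psi> m n else 0)" for p m n
  have X0: "X m \<ge> 0" for m by (simp add: X_def)
  have psi0: "\<psi> m n > 0" for m n unfolding \<psi>_def using g by (intro prod_pos) auto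
  have b0: "b p m n \<ge> 0" for p m n unfolding b_def using C lam psi0[of m n] by auto
  have ySuc: "y (Suc p) j = (\<Sum>m\<in>B. u j m * y p m)" for p j
    unfolding y_def by (simp add: sum_distrib_left sum_distrib_right mult_ac) (rule sum.swap)
  have bnd: "nrm (Bl m) (y p) \<le> (\<Sum>n\<le>N. b p m n * X n)" if "m \<le> N" for p m
    using that
  proof (induction p arbitrary: m)
    case 0
    have "nrm (Bl m) (y 0) = X m"
      unfolding X_def using B(1) by (intro L2_set_cong) (auto simp: y_def Bl_def sum_kron_left)
    also have "\<dots> = b 0 m m * X m" by (simp add: b_def \<psi>_def)
    also have "\<dots> \<le> (\<Sum>n\<le>N. b 0 m n * X n)"
      using 0 b0 X0 by (intro member_le_sum[of m "{..N}" "\<lambda>n. b 0 m n * X n"]) auto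
    finally show ?case .
  next
    case (Suc p)
    let ?\<beta> = "\<lambda>n'. if m < n' then C * lam ^ (n' - m) * \<psi> m n' else 0"
    have "nrm (Bl m) (y (Suc p)) = nrm (Bl m) (\<lambda>j. \<Sum>n'\<le>N. \<Sum>k\<in>Bl n'. u j k * y p k)"
      unfolding ySuc Bl_def by (subst sum_levels[OF B]) auto
    also have "\<dots> \<le> (\<Sum>n'\<le>N. nrm (Bl m) (\<lambda>j. \<Sum>k\<in>Bl n'. u j k * y p k))"
      by (rule nrm_sum) simp
    also have "\<dots> \<le> (\<Sum>n'\<le>N. ?\<beta> n' * nrm (Bl n') (y p))"
    proof (rule sum_mono)
      fix n'
      show "nrm (Bl m) (\<lambda>j. \<Sum>k\<in>Bl n'. u j k * y p k) \<le> ?\<beta> n' * nrm (Bl n') (y p)"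
      proof (cases "m < n'")
        case True
        then show ?thesis using block[OF True, of "y p"] by (simp add: Bl_def \<psi>_def)
      next
        case False
        have "nrm (Bl m) (\<lambda>j. \<Sum>k\<in>Bl n'. u j k * y p k) = nrm (Bl m) (\<lambda>j. 0)"
          using False by (intro L2_set_cong refl arg_cong[of _ _ cmod] sum.neutral) (auto simp: Bl_def tri)
        then show ?thesis using False by (simp add: L2_set_def)
      qed
    qed
    also have "\<dots> \<le> (\<Sum>n'\<le>N. ?\<beta> n' * (\<Sum>n\<le>N. b p n' n * X n))"
      using C lam psi0 by (intro sum_mono mult_left_mono Suc.IH) (auto intro!: mult_nonneg_nonneg less_imp_le[OF psi0])
    also have "\<dots> = (\<Sum>n\<le>N. (\<Sum>n'\<le>N. ?\<beta> n' * b p n' n) * X n)"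
      by (simp only: sum_distrib_left sum_distrib_right mult.assoc) (rule sum.swap)
    also have "\<dots> \<le> (\<Sum>n\<le>N. b (Suc p) m n * X n)"
    proof (intro sum_mono mult_right_mono X0)
      fix n assume "n \<in> {..N}"
      show "(\<Sum>n'\<le>N. ?\<beta> n' * b p n' n) \<le> b (Suc p) m n"
      proof (cases "m + Suc p \<le> n")
        case False
        then have "?\<beta> n' * b p n' n = 0" for n' by (auto simp: b_def)
        then show ?thesis using False by (simp add: b_def)
      next
        case True
        have "(\<Sum>n'\<le>N. ?\<beta> n' * b p n' n) \<le> (\<Sum>n'\<in>{m<..n}. C ^ Suc p * lam ^ (n - m) * \<psi> m n * 2 ^ (n - n'))"
        proof -
          have "(\<Sum>n'\<le>N. ?\<beta> n' * b p n' n) = (\<Sum>n'\<in>{n'\<in>{..N}. m < n' \<and> n' + p \<le> n}. ?\<beta> n' * b p n' n)"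
            by (intro sum.mono_neutral_right) (auto simp: b_def)
          also have "\<dots> = (\<Sum>n'\<in>{n'\<in>{..N}. m < n' \<and> n' + p \<le> n}. C ^ Suc p * lam ^ (n - m) * \<psi> m n * 2 ^ (n - n'))"
          proof (intro sum.cong refl)
            fix n' assume n': "n' \<in> {n'\<in>{..N}. m < n' \<and> n' + p \<le> n}"
            then have "lam ^ (n' - m) * lam ^ (n - n') = lam ^ (n - m)" by (simp flip: power_add)
            moreover have "\<psi> m n' * \<psi> n' n = \<psi> m n"
              unfolding \<psi>_def using n' by (intro prod.atLeastLessThan_concat) auto
            moreover have "?\<beta> n' * b p n' n = C * C ^ p * (lam ^ (n' - m) * lam ^ (n - n')) * (\<psi> m n' * \<psi> n' n) * 2 ^ (n - n')"
              using n' by (simp add: b_def power_mult_distrib mult_ac)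
            ultimately show "?\<beta> n' * b p n' n = C ^ Suc p * lam ^ (n - m) * \<psi> m n * 2 ^ (n - n')" by simp
          qed
          also have "\<dots> \<le> (\<Sum>n'\<in>{m<..n}. C ^ Suc p * lam ^ (n - m) * \<psi> m n * 2 ^ (n - n'))"
            using C lam psi0[of m n] by (intro sum_mono2) (auto intro!: mult_nonneg_nonneg)
          finally show ?thesis .
        qed
        also have "\<dots> = C ^ Suc p * lam ^ (n - m) * \<psi> m n * (\<Sum>n'\<in>{m<..n}. 2 ^ (n - n'))"
          by (simp add: sum_distrib_left)
        also have "\<dots> \<le> C ^ Suc p * lam ^ (n - m) * \<psi> m n * 2 ^ (n - m)"
        proof (rule mult_left_mono)
          have "(\<Sum>n'\<in>{m<..n}. 2 ^ (n - n')) = (\<Sum>i<n-m. (2::real) ^ i)"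
            by (rule sum.reindex_bij_witness[of _ "\<lambda>i. n - i" "\<lambda>n'. n - n'"]) auto
          also have "\<dots> \<le> 2 ^ (n - m)"
            by (subst sum_gp_strict) auto
          finally show "(\<Sum>n'\<in>{m<..n}. (2::real) ^ (n - n')) \<le> 2 ^ (n - m)" .
          show "0 \<le> C ^ Suc p * lam ^ (n - m) * \<psi> m n"
            using C lam psi0[of m n] by (auto intro!: mult_nonneg_nonneg)
        qed
        also have "\<dots> = b (Suc p) m n" using True by (simp add: b_def power_mult_distrib mult_ac)
        finally show ?thesis .
      qed
    qed
    finally show ?case .
  qed
  define \<gamma> where "\<gamma> n = (\<Prod>i<n. g i)" for n
  have gam0: "\<gamma> n > 0" for n unfolding \<gamma>_def using g by (intro prod_pos) auto
  \<comment> \<open>From here on the bounds depend on the difference D = n - m of levels only. The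
    D-th diagonal of blocks acts like a shift of levels and has norm at most \<open>?e D\<close>;
    \<open>?X\<close> is the sequence of block norms, extended by 0 beyond \<open>N\<close> so that
    it can be shifted. The norms are then added over D.\<close>
  let ?e = "\<lambda>D. C ^ p * (2 * lam) ^ D * (\<gamma> p * \<gamma> (D - p))"
  let ?X = "\<lambda>n. if n \<le> N then X n else 0"
  have e0: "?e D \<ge> 0" for D using C lam gam0[of p] gam0[of "D - p"] by (auto intro!: mult_nonneg_nonneg)
  have "nrm B (y p) = L2_set (\<lambda>m. nrm (Bl m) (y p)) {..N}"
    unfolding Bl_def by (rule nrm_levels[OF B])
  also have "\<dots> \<le> L2_set (\<lambda>m. \<Sum>D\<in>{p..N}. ?e D * ?X (m + D)) {..N}"
  proof (rule L2_set_mono)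
    fix m assume m: "m \<in> {..N}"
    have "nrm (Bl m) (y p) \<le> (\<Sum>n\<le>N. b p m n * X n)" using bnd m by simp
    also have "\<dots> = (\<Sum>n\<in>{m+p..N}. b p m n * X n)"
      by (intro sum.mono_neutral_right) (auto simp: b_def)
    also have "\<dots> \<le> (\<Sum>n\<in>{m+p..N}. ?e (n - m) * X n)"
    proof (intro sum_mono mult_right_mono X0)
      fix n assume n: "n \<in> {m+p..N}"
      have "\<psi> m n \<le> \<gamma> p * \<gamma> (n - m - p)"
      proof -
        have "p \<le> n - m" "m + (n - m) = n" using n by auto
        with prod_decseq_split[OF g, of p "n - m" m] show ?thesis unfolding \<psi>_def \<gamma>_def by simp
      qed
      then show "b p m n \<le> ?e (n - m)" unfolding b_def using n C lam by (auto intro!: mult_left_mono)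
    qed
    also have "\<dots> = (\<Sum>D\<in>{p..N-m}. ?e D * ?X (m + D))"
      by (rule sum.reindex_bij_witness[of _ "\<lambda>D. m + D" "\<lambda>n. n - m"]) (use m in auto)
    also have "\<dots> \<le> (\<Sum>D\<in>{p..N}. ?e D * ?X (m + D))"
      using e0 X0 by (intro sum_mono2) auto
    finally show "nrm (Bl m) (y p) \<le> (\<Sum>D\<in>{p..N}. ?e D * ?X (m + D))" .
  qed simp
  also have "\<dots> \<le> (\<Sum>D\<in>{p..N}. L2_set (\<lambda>m. ?e D * ?X (m + D)) {..N})"
  proof -
    have "L2_set (\<lambda>m. \<Sum>D\<in>S. ?e D * ?X (m + D)) {..N} \<le> (\<Sum>D\<in>S. L2_set (\<lambda>m. ?e D * ?X (m + D)) {..N})"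
      if "finite S" for S using that
    proof (induction S rule: finite_induct)
      case (insert D S)
      then show ?case using L2_set_triangle_ineq[of "\<lambda>m. ?e D * ?X (m + D)" "\<lambda>m. \<Sum>D\<in>S. ?e D * ?X (m + D)" "{..N}"]
        by simp
    qed (simp add: L2_set_def)
    then show ?thesis by simp
  qed
  also have "\<dots> \<le> (\<Sum>D\<in>{p..N}. ?e D * nrm B x)"
  proof (rule sum_mono)
    fix D
    have "L2_set (\<lambda>m. ?e D * ?X (m + D)) {..N} = ?e D * L2_set (\<lambda>m. ?X (m + D)) {..N}"
      using e0 by (simp add: L2_set_right_distrib)
    also have "L2_set (\<lambda>m. ?X (m + D)) {..N} \<le> L2_set X {..N}"
    proof -
      have "(\<Sum>m\<le>N. (?X (m + D))\<^sup>2) = (\<Sum>n\<in>{D..N+D}. (?X n)\<^sup>2)"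
        by (rule sum.reindex_bij_witness[of _ "\<lambda>n. n - D" "\<lambda>m. m + D"]) auto
      also have "\<dots> = (\<Sum>n\<in>{D..N}. (X n)\<^sup>2)"
        by (intro sum.mono_neutral_cong_right) auto
      also have "\<dots> \<le> (\<Sum>n\<le>N. (X n)\<^sup>2)" by (intro sum_mono2) auto
      finally show ?thesis unfolding L2_set_def by (rule real_sqrt_le_mono)
    qed
    also have "L2_set X {..N} = nrm B x" unfolding X_def Bl_def by (rule nrm_levels[OF B, symmetric])
    finally show "L2_set (\<lambda>m. ?e D * ?X (m + D)) {..N} \<le> ?e D * nrm B x"
      using e0[of D] by (simp add: mult_left_mono)
  qed
  also have "\<dots> = (\<Sum>i<Suc N - p. ?e (p + i)) * nrm B x"
    unfolding sum_distrib_right[symmetric]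
    by (intro arg_cong2[where f="(*)"] refl sum.reindex_bij_witness[of _ "\<lambda>i. p + i" "\<lambda>D. D - p"]) auto
  also have "(\<Sum>i<Suc N - p. ?e (p + i)) = (2 * lam * C) ^ p * \<gamma> p * (\<Sum>i<Suc N - p. (2 * lam) ^ i * (\<Prod>k<i. g k))"
    by (simp add: sum_distrib_left power_add power_mult_distrib \<gamma>_def mult_ac)
  also have "\<dots> * nrm B x \<le> (2 * lam * C) ^ p * \<gamma> p * G * nrm B x"
    using C lam gam0[of p] by (intro mult_right_mono mult_left_mono G) auto
  finally show ?thesis by (simp add: y_def[abs_def] \<gamma>_def mult_ac)
qed

text \<open>Every step of a path that contributes raises the level by at least one.\<close>

lemma fpow_triangular_zero:
  assumes "finite B" and tri: "\<And>j k. j \<in> B \<Longrightarrow> k \<in> B \<Longrightarrow> \<not> lev j < (lev k :: nat) \<Longrightarrow> u j k = 0"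
    and "j \<in> B" "k \<in> B" "\<not> lev j + p \<le> lev k"
  shows "fpow B u p j k = 0"
  using assms(3-5)
proof (induction p arbitrary: j)
  case (Suc p)
  have "u j m * fpow B u p m k = 0" if "m \<in> B" for m
    using Suc.IH[of m] tri[of j m] Suc.prems that by (cases "lev j < lev m") auto
  then show ?case by simp
qed auto

text \<open>The traces of all positive powers vanish, and Newton's identities then leave only the
  constant coefficient 1. They take the place of an enumeration of \<open>B\<close> adapted to the
  levels.\<close>

lemma fdet_triangular:
  assumes "finite B" and tri: "\<And>j k. j \<in> B \<Longrightarrow> k \<in> B \<Longrightarrow> \<not> lev j < (lev k :: nat) \<Longrightarrow> u j k = 0"
  shows "fdet B (\<lambda>j k. kron j k - z * u j k) = 1"
proof -
  obtain c where c: "newton (\<lambda>p. \<Sum>j\<in>B. fpow B u p j j) c"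
    "\<And>z. (\<lambda>n. c n * z ^ n) sums fdet B (\<lambda>j k. kron j k - z * u j k)"
    using fdet_newton[OF assms(1), of u] by blast
  have tr: "(\<Sum>j\<in>B. fpow B u (Suc p) j j) = 0" for p
  proof (intro sum.neutral ballI)
    fix j assume "j \<in> B"
    then show "fpow B u (Suc p) j j = 0"
      by (intro fpow_triangular_zero[of B lev u, OF assms(1) tri]) auto
  qed
  have "of_nat (Suc k) * c (Suc k) = 0" for k
    using c(1) unfolding newton_def tr by simp
  note c_Suc = this
  have "c (Suc k) = 0" for k using c_Suc[of k] of_nat_neq_0[of k, where ?'a = complex] by (simp del: of_nat_Suc)
  then have "(\<lambda>n. c n * z ^ n) = (\<lambda>n. if n = 0 then 1 else 0)"
    using c(1) unfolding newton_def by (intro ext, rename_tac n, case_tac n) auto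
  then have "(\<lambda>n. c n * z ^ n) sums 1" using sums_single[of 0 "\<lambda>_. 1::complex"] by simp
  then show ?thesis using c(2)[of z] sums_unique2 by blast
qed

text \<open>\<open>V z\<close> is the Neumann series of the inverse of 1 - z u. It stops at the
  exponent \<open>N\<close> because there are only the levels 0 to \<open>N\<close>, so a path with
  \<open>N + 1\<close> strict increases cannot exist. Factoring out 1 - z u leaves 1 - z V
  b.\<close>

lemma fdet_split_triangular:
  fixes lev :: "'a \<Rightarrow> nat"
  assumes B: "finite B" "\<And>j. j \<in> B \<Longrightarrow> lev j \<le> N"
    and tri: "\<And>j k. j \<in> B \<Longrightarrow> k \<in> B \<Longrightarrow> \<not> lev j < lev k \<Longrightarrow> u j k = 0"
  defines "V \<equiv> \<lambda>z j k. \<Sum>p\<le>N. z ^ p * fpow B u p j k"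
  shows "fdet B (\<lambda>j k. kron j k - z * (u j k + b j k)) = fdet B (\<lambda>j k. kron j k - z * (\<Sum>m\<in>B. V z j m * b m k))"
proof -
  have z0: "fpow B u (Suc N) j k = 0" if "j \<in> B" "k \<in> B" for j k
  proof -
    have "\<not> lev j + Suc N \<le> lev k" using B(2)[OF that(2)] by linarith
    from fpow_triangular_zero[OF B(1) tri that this] show ?thesis .
  qed
  have inv: "(\<Sum>m\<in>B. (kron j m - z * u j m) * V z m k) = kron j k" if jk: "j \<in> B" "k \<in> B" for j k
  proof -
    have "(\<Sum>m\<in>B. z * u j m * V z m k) = (\<Sum>m\<in>B. \<Sum>p\<le>N. z ^ Suc p * (u j m * fpow B u p m k))"
      by (simp add: V_def sum_distrib_left mult_ac)
    also have "\<dots> = (\<Sum>p\<le>N. z ^ Suc p * fpow B u (Suc p) j k)"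
      by (subst sum.swap) (simp add: sum_distrib_left)
    also have "\<dots> = (\<Sum>p\<in>{1..Suc N}. z ^ p * fpow B u p j k)"
      by (rule sum.reindex_bij_witness[of _ "\<lambda>p. p - 1" Suc]) auto
    also have "\<dots> = (\<Sum>p\<in>{1..N}. z ^ p * fpow B u p j k)"
      using z0[OF jk] by (simp del: fpow.simps)
    finally have e: "(\<Sum>m\<in>B. z * u j m * V z m k) = (\<Sum>p\<in>{1..N}. z ^ p * fpow B u p j k)" .
    have "V z j k = kron j k + (\<Sum>p\<in>{1..N}. z ^ p * fpow B u p j k)"
      unfolding V_def atMost_atLeast0 by (subst sum.atLeast_Suc_atMost) auto
    moreover have "(\<Sum>m\<in>B. kron j m * V z m k) = V z j k"
      by (rule sum_kron_left[OF B(1) jk(1)])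
    ultimately show ?thesis using e by (simp add: left_diff_distrib sum_subtractf)
  qed
  have "fdet B (\<lambda>j k. kron j k - z * (u j k + b j k))
    = fdet B (\<lambda>j k. \<Sum>m\<in>B. (kron j m - z * u j m) * (kron m k - z * (\<Sum>n\<in>B. V z m n * b n k)))"
  proof (rule fdet_cong[OF B(1)])
    fix j k assume jk: "j \<in> B" "k \<in> B"
    have "(\<Sum>m\<in>B. (kron j m - z * u j m) * (kron m k - z * (\<Sum>n\<in>B. V z m n * b n k)))
      = (\<Sum>m\<in>B. (kron j m - z * u j m) * kron m k) - z * (\<Sum>m\<in>B. \<Sum>n\<in>B. (kron j m - z * u j m) * V z m n * b n k)"
      by (simp only: right_diff_distrib sum_subtractf sum_distrib_left mult_ac)
    also have "(\<Sum>m\<in>B. (kron j m - z * u j m) * kron m k) = kron j k - z * u j k"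
      by (rule sum_kron_right[OF B(1) jk(2)])
    also have "(\<Sum>m\<in>B. \<Sum>n\<in>B. (kron j m - z * u j m) * V z m n * b n k)
      = (\<Sum>n\<in>B. (\<Sum>m\<in>B. (kron j m - z * u j m) * V z m n) * b n k)"
      by (subst sum.swap) (simp only: sum_distrib_right)
    also have "\<dots> = (\<Sum>n\<in>B. kron j n * b n k)" by (intro sum.cong refl) (simp only: inv[OF jk(1)])
    also have "\<dots> = b j k" by (rule sum_kron_left[OF B(1) jk(1)])
    finally show "kron j k - z * (u j k + b j k)
      = (\<Sum>m\<in>B. (kron j m - z * u j m) * (kron m k - z * (\<Sum>n\<in>B. V z m n * b n k)))"
      by (simp add: algebra_simps)
  qed
  also have "\<dots> = fdet B (\<lambda>j k. kron j k - z * (\<Sum>m\<in>B. V z j m * b m k))"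
    unfolding fdet_mult[OF B(1)] using fdet_triangular[of B lev u z, OF B(1) tri] by simp
  finally show ?thesis .
qed

subsection \<open>Fourier series of differentiable functions\<close>

lemma fourier_e_cis: "fourier_e k x = cis (2 * pi * of_int k * x)"
  unfolding fourier_e_def cis_conv_exp by (simp add: mult_ac)

lemma norm_fourier_e [simp]: "cmod (fourier_e k x) = 1"
  by (simp add: fourier_e_cis)

lemma fourier_e_0 [simp]: "fourier_e 0 x = 1" "fourier_e k 0 = 1"
  by (simp_all add: fourier_e_def)

lemma fourier_e_add: "fourier_e (j + k) x = fourier_e j x * fourier_e k x"
  "fourier_e k (x + y) = fourier_e k x * fourier_e k y"
  by (simp_all add: fourier_e_cis cis_mult algebra_simps)

lemma fourier_e_cnj: "cnj (fourier_e k x) = fourier_e (- k) x" "cnj (fourier_e k x) = fourier_e k (- x)"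
  by (simp_all add: fourier_e_cis cis_cnj)

lemma fourier_e_eq_1_iff: "fourier_e 1 x = 1 \<longleftrightarrow> x \<in> \<int>"
proof -
  have "fourier_e 1 x = 1 \<longleftrightarrow> (\<exists>n::int. 2 * pi * x = of_int (2 * n) * pi)"
    unfolding fourier_e_def exp_eq_1 by simp
  also have "\<dots> \<longleftrightarrow> (\<exists>n::int. x = of_int n)" by simp
  finally show ?thesis by (auto simp: Ints_def)
qed

lemma fourier_e_Ints:
  assumes "x \<in> \<int>" shows "fourier_e k x = 1"
proof -
  obtain n where n: "x = of_int n" using assms by (auto elim: Ints_cases)
  show ?thesis unfolding fourier_e_def exp_eq_1 by (auto simp: n intro!: exI[of _ "k * n"])
qed

lemma fourier_e_periodic: "fourier_e k (x + 1) = fourier_e k x"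
  by (simp add: fourier_e_add fourier_e_Ints)

lemma fourier_e_deriv: "(fourier_e k has_vector_derivative 2 * \<i> * pi * of_int k * fourier_e k x) (at x within S)"
proof -
  have "((\<lambda>z. exp (2 * \<i> * pi * of_int k * z)) has_field_derivative
    2 * \<i> * pi * of_int k * exp (2 * \<i> * pi * of_int k * of_real x)) (at (of_real x))"
    by (auto intro!: derivative_eq_intros)
  from has_vector_derivative_real_field[OF this] show ?thesis
    by (simp add: fourier_e_def[abs_def])
qed

lemma fourier_e_continuous [continuous_intros]:
  "continuous_on S f \<Longrightarrow> continuous_on S (\<lambda>x. fourier_e k (f x))"
  unfolding fourier_e_def by (intro continuous_intros)

lemma integral_fourier_e: "integral {0..1} (fourier_e k) = (if k = 0 then 1 else 0)"
proof (cases "k = 0")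
  case True
  have "fourier_e 0 = (\<lambda>x. 1)" by auto
  then show ?thesis using True by simp
next
  case False
  have "(fourier_e k has_integral fourier_e k 1 / (2 * \<i> * pi * of_int k) - fourier_e k 0 / (2 * \<i> * pi * of_int k)) {0..1}"
  proof (rule fundamental_theorem_of_calculus)
    fix x :: real
    have "((\<lambda>x. fourier_e k x / (2 * \<i> * pi * of_int k)) has_vector_derivative
      (2 * \<i> * pi * of_int k * fourier_e k x) / (2 * \<i> * pi * of_int k)) (at x within {0..1})"
      by (intro has_vector_derivative_divide fourier_e_deriv)
    then show "((\<lambda>x. fourier_e k x / (2 * \<i> * pi * of_int k)) has_vector_derivative fourier_e k x) (at x within {0..1})"
      using False by simp
  qed simp
  then show ?thesis using False by (simp add: fourier_e_Ints integral_unique)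
qed

text \<open>Fourier coefficients as gauge integrals over the closed interval, suited to continuous
  functions; \<open>hat_continuous\<close> identifies them with the Lebesgue coefficients of
  \<open>L2_inner\<close>.\<close>

definition fc :: "(real \<Rightarrow> complex) \<Rightarrow> int \<Rightarrow> complex" where
  "fc f m = integral {0..1} (\<lambda>x. f x * cnj (fourier_e m x))"

lemma fc_fourier_e: "fc (fourier_e k) m = kron k m"
proof -
  have "fourier_e k x * cnj (fourier_e m x) = fourier_e (k - m) x" for x
    using fourier_e_add(1)[of k "- m" x] by (simp add: fourier_e_cnj)
  then have "fc (fourier_e k) m = integral {0..1} (fourier_e (k - m))" by (simp add: fc_def)
  then show ?thesis by (simp add: integral_fourier_e)
qed

lemma norm_integral_le:
  fixes f :: "real \<Rightarrow> complex"
  assumes "continuous_on {0..1} f" "\<And>x. x \<in> {0..1} \<Longrightarrow> cmod (f x) \<le> b"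
  shows "cmod (integral {0..1} f) \<le> b"
  using integral_bound[of 0 1 f b] assms by auto

lemma integral_of_real_01:
  "continuous_on {0..1} f \<Longrightarrow> integral {0..1} (\<lambda>x. complex_of_real (f x)) = of_real (integral {0..1::real} f)"
  using integral_linear[OF integrable_continuous_interval bounded_linear_of_real, of 0 1 f] by (simp add: comp_def)

lemma integral_Re_01:
  "continuous_on {0..1} f \<Longrightarrow> integral {0..1} (\<lambda>x. Re (f x)) = Re (integral {0..1::real} f)"
  using integral_linear[OF integrable_continuous_interval bounded_linear_Re, of 0 1 f] by (simp add: comp_def)

lemma integral_cnj_01:
  "continuous_on {0..1} f \<Longrightarrow> integral {0..1} (\<lambda>x. cnj (f x)) = cnj (integral {0..1::real} f)"
  using integral_linear[OF integrable_continuous_interval bounded_linear_cnj, of 0 1 f] by (simp add: comp_def)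

lemma parseval_trig:
  assumes "finite B"
  shows "integral {0..1} (\<lambda>x. (cmod (\<Sum>k\<in>B. c k * fourier_e k x))\<^sup>2) = (\<Sum>k\<in>B. (cmod (c k))\<^sup>2)"
proof -
  have "complex_of_real (integral {0..1} (\<lambda>x. (cmod (\<Sum>k\<in>B. c k * fourier_e k x))\<^sup>2))
    = integral {0..1} (\<lambda>x. complex_of_real ((cmod (\<Sum>k\<in>B. c k * fourier_e k x))\<^sup>2))"
    by (rule integral_of_real_01[symmetric]) (intro continuous_intros)
  also have "\<dots> = integral {0..1} (\<lambda>x. \<Sum>j\<in>B. cnj (c j) * (\<Sum>k\<in>B. c k * (fourier_e k x * cnj (fourier_e j x))))"
    unfolding complex_norm_square
    by (intro integral_cong) (simp add: sum_distrib_left sum_distrib_right mult_ac)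
  also have "\<dots> = (\<Sum>j\<in>B. cnj (c j) * (\<Sum>k\<in>B. c k * fc (fourier_e k) j))"
  proof -
    have 1: "integral {0..1} (\<lambda>x. \<Sum>k\<in>B. c k * (fourier_e k x * cnj (fourier_e j x))) = (\<Sum>k\<in>B. c k * fc (fourier_e k) j)" for j
      unfolding fc_def by (subst integral_sum) (auto simp: assms intro!: integrable_continuous_interval continuous_intros)
    show ?thesis unfolding 1[symmetric]
      by (subst integral_sum) (auto simp: assms intro!: integrable_continuous_interval continuous_intros)
  qed
  also have "\<dots> = (\<Sum>j\<in>B. cnj (c j) * c j)"
    by (intro sum.cong refl arg_cong2[where f="(*)"]) (simp add: fc_fourier_e sum_kron_right assms)
  also have "\<dots> = complex_of_real (\<Sum>k\<in>B. (cmod (c k))\<^sup>2)"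
    by (simp add: complex_norm_square mult.commute del: of_real_power)
  finally show ?thesis unfolding of_real_eq_iff .
qed

lemma bessel:
  assumes "finite B" and g: "continuous_on {0..1} g"
  shows "(\<Sum>k\<in>B. (cmod (fc g k))\<^sup>2) \<le> integral {0..1} (\<lambda>x. (cmod (g x))\<^sup>2)"
proof -
  let ?p = "\<lambda>x. \<Sum>k\<in>B. fc g k * fourier_e k x"
  have p: "continuous_on {0..1} ?p" by (intro continuous_intros)
  have "integral {0..1} (\<lambda>x. g x * cnj (?p x)) = integral {0..1} (\<lambda>x. \<Sum>k\<in>B. cnj (fc g k) * (g x * cnj (fourier_e k x)))"
    by (intro integral_cong) (simp add: sum_distrib_left mult_ac)
  also have "\<dots> = (\<Sum>k\<in>B. cnj (fc g k) * fc g k)"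
    unfolding fc_def[of g] by (subst integral_sum) (auto intro!: assms integrable_continuous_interval continuous_intros g)
  also have "\<dots> = complex_of_real (\<Sum>k\<in>B. (cmod (fc g k))\<^sup>2)"
    by (simp add: complex_norm_square mult.commute del: of_real_power)
  finally have gp: "integral {0..1} (\<lambda>x. Re (g x * cnj (?p x))) = (\<Sum>k\<in>B. (cmod (fc g k))\<^sup>2)"
    by (subst integral_Re_01) (auto intro!: continuous_intros g)
  have "0 \<le> integral {0..1} (\<lambda>x. (cmod (g x - ?p x))\<^sup>2)"
    by (intro integral_nonneg integrable_continuous_interval continuous_intros g) auto
  also have "\<dots> = integral {0..1} (\<lambda>x. (cmod (g x))\<^sup>2 + (cmod (?p x))\<^sup>2 - 2 * Re (g x * cnj (?p x)))"
  proof -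
    have "(cmod (a - b))\<^sup>2 = (cmod a)\<^sup>2 + (cmod b)\<^sup>2 - 2 * Re (a * cnj b)" for a b
      unfolding cmod_power2 by (simp add: power2_eq_square algebra_simps)
    then show ?thesis by presburger
  qed
  also have "\<dots> = integral {0..1} (\<lambda>x. (cmod (g x))\<^sup>2) + integral {0..1} (\<lambda>x. (cmod (?p x))\<^sup>2)
      - 2 * integral {0..1} (\<lambda>x. Re (g x * cnj (?p x)))"
    by (subst integral_diff integral_add integral_mult_right;
        (intro integrable_continuous_interval continuous_intros g refl)?)+
  finally show ?thesis using gp parseval_trig[OF assms(1), of "fc g"] by simp
qed

text \<open>The Riemann-Lebesgue lemma, read off from Bessel's inequality. An arbitrary injection is
  allowed because telescoping leaves a term at either end of the range of frequencies.\<close>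

lemma fc_tendsto_0:
  assumes g: "continuous_on {0..1} g" and i: "inj (i :: nat \<Rightarrow> int)"
  shows "(\<lambda>n. fc g (i n)) \<longlonglongrightarrow> 0"
proof -
  have "summable (\<lambda>n. (cmod (fc g (i n)))\<^sup>2)"
  proof (rule bounded_imp_summable)
    fix n
    have "(\<Sum>k\<le>n. (cmod (fc g (i k)))\<^sup>2) = (\<Sum>k\<in>i ` {..n}. (cmod (fc g k))\<^sup>2)"
      using i by (subst sum.reindex) (auto simp: inj_on_def)
    also have "\<dots> \<le> integral {0..1} (\<lambda>x. (cmod (g x))\<^sup>2)" by (rule bessel[OF _ g]) simp
    finally show "(\<Sum>k\<le>n. (cmod (fc g (i k)))\<^sup>2) \<le> integral {0..1} (\<lambda>x. (cmod (g x))\<^sup>2)" .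
  qed simp
  from summable_LIMSEQ_zero[OF this] have "(\<lambda>n. sqrt ((cmod (fc g (i n)))\<^sup>2)) \<longlonglongrightarrow> sqrt 0"
    by (rule tendsto_real_sqrt)
  then show ?thesis by (simp add: tendsto_norm_zero_iff)
qed

text \<open>Serves periodic functions, with \<open>c\<close> zero, as well as lifts of circle maps,
  with \<open>c\<close> the degree.\<close>

lemma add_int_shift:
  fixes f :: "real \<Rightarrow> 'a::real_algebra_1"
  assumes "\<And>x. f (x + 1) = f x + c"
  shows "f (x + of_int n) = f x + of_int n * c"
proof -
  have nat: "f (x + of_nat n) = f x + of_nat n * c" for x and n :: nat
  proof (induction n)
    case (Suc n)
    have "f (x + of_nat (Suc n)) = f ((x + of_nat n) + 1)" by (simp add: add_ac)
    then show ?case using Suc assms[of "x + of_nat n"] by (simp add: algebra_simps)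
  qed simp
  show ?thesis
  proof (cases "n \<ge> 0")
    case True
    then show ?thesis using nat[of x "nat n"] by simp
  next
    case False
    then show ?thesis using nat[of "x + of_int n" "nat (- n)"] by simp
  qed
qed

lemma periodic_add_int:
  fixes f :: "real \<Rightarrow> 'a::real_algebra_1"
  shows "periodic1 f \<Longrightarrow> f (x + of_int n) = f x"
  using add_int_shift[of f 0 x n] by (simp add: periodic1_def)

lemma has_vector_derivative_quotient:
  fixes f :: "real \<Rightarrow> complex"
  assumes "(f has_vector_derivative D) (at x)"
  shows "(\<lambda>h. (f (x + h) - f x) / of_real h) \<midarrow>0\<rightarrow> D"
proof -
  have "(\<lambda>h. norm (f (x + h) - f x - h *\<^sub>R D) / norm h) \<midarrow>0\<rightarrow> 0"
    using assms unfolding has_vector_derivative_def has_derivative_at by simp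
  then have "(\<lambda>h. norm ((f (x + h) - f x) / of_real h - D)) \<midarrow>0\<rightarrow> 0"
  proof (rule Lim_transform_eventually)
    have "eventually (\<lambda>h::real. h \<noteq> 0) (at 0)" by (simp add: eventually_at_filter)
    then show "eventually (\<lambda>h. norm (f (x + h) - f x - h *\<^sub>R D) / norm h = norm ((f (x + h) - f x) / of_real h - D)) (at 0)"
    proof eventually_elim
      case (elim h)
      then have "(f (x + h) - f x) / of_real h - D = (f (x + h) - f x - h *\<^sub>R D) / of_real h"
        by (simp add: scaleR_conv_of_real field_simps)
      then show ?case by (simp only: norm_divide norm_of_real real_norm_def)
    qed
  qed
  then show ?thesis by (simp add: tendsto_norm_zero_iff LIM_zero_iff)
qed

text \<open>Following Chernoff, \<open>f - f x0\<close> is divided by \<open>e\<^sub>1 - e\<^sub>1 x0\<close>: the partial sums then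
  telescope, and what is left tends to zero by Bessel's inequality.\<close>

lemma fourier_series_pointwise:
  assumes f: "continuous_on UNIV f" "periodic1 f" and D: "(f has_vector_derivative D) (at x0)"
  shows "(\<lambda>K. \<Sum>m\<in>{- int K..int K}. fc f m * fourier_e m x0) \<longlonglongrightarrow> f x0"
proof -
  note per = periodic_add_int[OF f(2)]
  \<comment> \<open>The value at the integers is the quotient of the derivatives of numerator and
    denominator, which makes \<gamma> continuous there.\<close>
  define \<gamma> where "\<gamma> x = (if x \<in> \<int> then D / (2 * \<i> * pi) else (f (x + x0) - f x0) / (fourier_e 1 x - 1))" for x
  have eq: "f x = f x0 + (fourier_e 1 (x - x0) - 1) * \<gamma> (x - x0)" for x
  proof (cases "x - x0 \<in> \<int>")
    case True
    then obtain n where "x - x0 = of_int n" by (auto elim: Ints_cases)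
    then have "x = x0 + of_int n" by simp
    then show ?thesis using per[of x0 n] by (simp add: fourier_e_Ints)
  next
    case False
    then show ?thesis using fourier_e_eq_1_iff[of "x - x0"] by (simp add: \<gamma>_def)
  qed
  have gper: "\<gamma> (x + of_int n) = \<gamma> x" for x and n :: int
  proof -
    have "x + of_int n \<in> \<int> \<longleftrightarrow> x \<in> \<int>"
      by (metis Ints_add Ints_diff Ints_of_int add_diff_cancel_right')
    moreover have "f (x + of_int n + x0) = f (x + x0)" using per[of "x + x0" n] by (simp add: add_ac)
    ultimately show ?thesis by (simp add: \<gamma>_def fourier_e_add fourier_e_Ints)
  qed
  have cont0: "isCont \<gamma> 0"
    unfolding isCont_def
  proof (rule Lim_transform_eventually)
    have "(\<lambda>h. ((f (x0 + h) - f x0) / of_real h) / ((fourier_e 1 (0 + h) - fourier_e 1 0) / of_real h))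
      \<midarrow>0\<rightarrow> D / (2 * \<i> * pi * of_int 1 * fourier_e 1 0)"
      by (intro tendsto_divide has_vector_derivative_quotient D fourier_e_deriv) simp
    then show "(\<lambda>h. ((f (x0 + h) - f x0) / of_real h) / ((fourier_e 1 (0 + h) - fourier_e 1 0) / of_real h)) \<midarrow>0\<rightarrow> \<gamma> 0"
      by (simp add: \<gamma>_def)
    have "eventually (\<lambda>h::real. h \<noteq> 0 \<and> \<bar>h\<bar> < 1) (at 0)"
      by (auto simp: eventually_at intro!: exI[of _ 1])
    then show "eventually (\<lambda>h. ((f (x0 + h) - f x0) / of_real h) / ((fourier_e 1 (0 + h) - fourier_e 1 0) / of_real h) = \<gamma> h) (at 0)"
    proof eventually_elim
      case (elim h)
      then have "h \<notin> \<int>" by (auto elim!: Ints_cases)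
      then show ?case using elim by (simp add: \<gamma>_def add.commute)
    qed
  qed
  have cont: "isCont \<gamma> x" for x
  proof (cases "x \<in> \<int>")
    case True
    then obtain n where n: "x = of_int n" by (auto elim: Ints_cases)
    have "isCont (\<lambda>y. \<gamma> (y - of_int n)) x"
      by (rule isCont_o2[where f="\<lambda>y. y - of_int n" and g=\<gamma>]) (use cont0 n in simp_all)
    moreover have "(\<lambda>y. \<gamma> (y - of_int n)) = \<gamma>" using gper[of _ "- n"] by (intro ext) simp
    ultimately show ?thesis by (simp only:)
  next
    case False
    have "open (- \<int> :: real set)" by (rule open_Compl[OF closed_Ints])
    then have "eventually (\<lambda>y. y \<in> - \<int>) (nhds x)" using False by (intro eventually_nhds_in_open) auto
    then have "eventually (\<lambda>y. (f (y + x0) - f x0) / (fourier_e 1 y - 1) = \<gamma> y) (nhds x)"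
      by eventually_elim (simp add: \<gamma>_def)
    moreover have "isCont (\<lambda>y. (f (y + x0) - f x0) / (fourier_e 1 y - 1)) x"
    proof (intro continuous_intros)
      show "isCont (\<lambda>y. f (y + x0)) x"
        by (rule isCont_o2[where f="\<lambda>y. y + x0" and g=f]) (use f(1) in \<open>simp_all add: continuous_on_eq_continuous_at\<close>)
      have "continuous_on UNIV (fourier_e 1)" using fourier_e_continuous[of UNIV "\<lambda>x. x"] by simp
      then show "isCont (fourier_e 1) x" by (simp add: continuous_on_eq_continuous_at)
      show "fourier_e 1 x - 1 \<noteq> 0" using False fourier_e_eq_1_iff[of x] by simp
    qed
    ultimately show ?thesis by (simp add: isCont_cong)
  qed
  define g where "g x = \<gamma> (x - x0)" for x
  have g: "continuous_on {0..1} g"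
    unfolding g_def
    by (intro continuous_at_imp_continuous_on ballI, rule isCont_o2[where f="\<lambda>y. y - x0" and g=\<gamma>]) (simp_all add: cont)
  define c where "c m = fc g m * fourier_e m x0" for m
  have coeff: "fc f m * fourier_e m x0 = (if m = 0 then f x0 else 0) + (c (m - 1) - c m)" for m
  proof -
    have "f x * cnj (fourier_e m x) = f x0 * (fourier_e 0 x * cnj (fourier_e m x))
        + (cnj (fourier_e 1 x0) * (g x * cnj (fourier_e (m - 1) x)) - g x * cnj (fourier_e m x))" for x
    proof -
      have "fourier_e 1 (x - x0) * cnj (fourier_e m x) = cnj (fourier_e 1 x0) * cnj (fourier_e (m - 1) x)"
      proof -
        have "fourier_e 1 (x - x0) = fourier_e 1 x * cnj (fourier_e 1 x0)"
          using fourier_e_add(2)[of 1 x "- x0"] by (simp add: fourier_e_cnj(2))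
        moreover have "fourier_e 1 x * cnj (fourier_e m x) = cnj (fourier_e (m - 1) x)"
          using fourier_e_add(1)[of 1 "- m" x] by (simp add: fourier_e_cnj(1))
        ultimately show ?thesis by (simp add: mult_ac)
      qed
      then show ?thesis by (subst eq) (simp add: g_def algebra_simps)
    qed
    then have "fc f m = integral {0..1} (\<lambda>x. f x0 * (fourier_e 0 x * cnj (fourier_e m x))
        + (cnj (fourier_e 1 x0) * (g x * cnj (fourier_e (m - 1) x)) - g x * cnj (fourier_e m x)))"
      by (simp add: fc_def)
    also have "\<dots> = f x0 * fc (fourier_e 0) m + (cnj (fourier_e 1 x0) * fc g (m - 1) - fc g m)"
      unfolding fc_def by (subst integral_add integral_diff integral_mult_right;
        (intro integrable_continuous_interval continuous_intros g refl)?)+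
    finally have e: "fc f m = f x0 * kron 0 m + (cnj (fourier_e 1 x0) * fc g (m - 1) - fc g m)"
      by (simp only: fc_fourier_e)
    have "cnj (fourier_e 1 x0) * fourier_e m x0 = fourier_e (m - 1) x0"
      using fourier_e_add(1)[of "- 1" m x0] by (simp add: fourier_e_cnj)
    then have 1: "cnj (fourier_e 1 x0) * fc g (m - 1) * fourier_e m x0 = c (m - 1)"
      by (simp add: c_def mult_ac)
    have 2: "kron 0 m * fourier_e m x0 = kron m 0" by simp
    have "fc f m * fourier_e m x0 = f x0 * (kron 0 m * fourier_e m x0)
        + (cnj (fourier_e 1 x0) * fc g (m - 1) * fourier_e m x0 - c m)"
      unfolding e c_def by (simp only: distrib_right left_diff_distrib mult.assoc)
    then show ?thesis unfolding 1 2 by simp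
  qed
  have sum: "(\<Sum>m\<in>{- int K..int K}. fc f m * fourier_e m x0) = f x0 + (c (- int K - 1) - c (int K))" for K
  proof (induction K)
    case 0
    show ?case using coeff[of 0] by simp
  next
    case (Suc K)
    have "{- int (Suc K)..int (Suc K)} = insert (- int K - 1) (insert (int K + 1) {- int K..int K})" by auto
    then show ?case using Suc by (simp add: coeff add.commute)
  qed
  have "(\<lambda>K. c (i K)) \<longlonglongrightarrow> 0" if "inj (i :: nat \<Rightarrow> int)" for i
    using tendsto_norm_zero[OF fc_tendsto_0[OF g that]]
    by (intro tendsto_norm_zero_cancel[of "\<lambda>K. c (i K)"]) (simp add: c_def norm_mult)
  from this[of "\<lambda>K. - int K - 1"] this[of int]
  have "(\<lambda>K. c (- int K - 1)) \<longlonglongrightarrow> 0" "(\<lambda>K. c (int K)) \<longlonglongrightarrow> 0" by (auto simp: inj_def)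
  then have "(\<lambda>K. f x0 + (c (- int K - 1) - c (int K))) \<longlonglongrightarrow> f x0 + (0 - 0)"
    by (intro tendsto_intros)
  then show ?thesis unfolding sum by simp
qed

section \<open>Absolutely convergent Fourier series\<close>

lemma fc_deriv:
  assumes "\<And>x. (f has_vector_derivative f' x) (at x)" "continuous_on {0..1} f'" "periodic1 f"
  shows "fc f' m = 2 * \<i> * pi * of_int m * fc f m"
proof -
  have f: "continuous_on {0..1} f"
    using assms(1) by (meson continuous_at_imp_continuous_on has_vector_derivative_continuous)
  have "((\<lambda>x. f' x * cnj (fourier_e m x) - 2 * \<i> * pi * of_int m * (f x * cnj (fourier_e m x))) has_integral
      f 1 * cnj (fourier_e m 1) - f 0 * cnj (fourier_e m 0)) {0..1}"
  proof (rule fundamental_theorem_of_calculus)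
    fix x :: real
    have "((\<lambda>x. f x * fourier_e (- m) x) has_vector_derivative
      f x * (2 * \<i> * pi * of_int (- m) * fourier_e (- m) x) + f' x * fourier_e (- m) x) (at x within {0..1})"
      by (intro has_vector_derivative_mult fourier_e_deriv has_vector_derivative_at_within[OF assms(1)])
    then show "((\<lambda>x. f x * cnj (fourier_e m x)) has_vector_derivative
      f' x * cnj (fourier_e m x) - 2 * \<i> * pi * of_int m * (f x * cnj (fourier_e m x))) (at x within {0..1})"
      by (simp add: fourier_e_cnj(1) algebra_simps)
  qed simp
  moreover have "f 1 = f 0" using assms(3) unfolding periodic1_def by (metis add_0)
  ultimately have "integral {0..1} (\<lambda>x. f' x * cnj (fourier_e m x) - 2 * \<i> * pi * of_int m * (f x * cnj (fourier_e m x))) = 0"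
    by (simp add: integral_unique fourier_e_Ints)
  moreover have "integral {0..1} (\<lambda>x. f' x * cnj (fourier_e m x) - 2 * \<i> * pi * of_int m * (f x * cnj (fourier_e m x)))
     = fc f' m - 2 * \<i> * pi * of_int m * fc f m"
    unfolding fc_def by (subst integral_diff integral_mult_right;
        (intro integrable_continuous_interval continuous_intros f assms refl)?)+
  ultimately show ?thesis by simp
qed

text \<open>Folds a two-sided family into a sequence, so that symmetric partial sums become ordinary
  ones and the theorems of Weierstrass and Tannery apply. The case 0 is separate in order to count
  \<open>f 0\<close> once.\<close>

definition sym_pair :: "(int \<Rightarrow> 'a::comm_monoid_add) \<Rightarrow> nat \<Rightarrow> 'a" where
  "sym_pair f n = (if n = 0 then f 0 else f (int n) + f (- int n))"

lemma sum_sym_pair: "(\<Sum>n\<le>K. sym_pair f n) = (\<Sum>m\<in>{- int K..int K}. f m)"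
proof (induction K)
  case (Suc K)
  have "{- int (Suc K)..int (Suc K)} = insert (- int (Suc K)) (insert (int (Suc K)) {- int K..int K})" by auto
  then show ?case using Suc by (simp add: sym_pair_def add_ac)
qed (simp add: sym_pair_def)

lemma norm_sym_pair_le:
  fixes f :: "int \<Rightarrow> 'a::real_normed_vector"
  assumes "\<And>m. m = int n \<or> m = - int n \<Longrightarrow> norm (f m) \<le> b"
  shows "norm (sym_pair f n) \<le> 2 * b"
proof -
  have "0 \<le> norm (f (int n))" by simp
  then have "0 \<le> b" using assms[of "int n"] by linarith
  then show ?thesis using assms[of "int n"] assms[of "- int n"] norm_triangle_ineq[of "f (int n)" "f (- int n)"]
    by (auto simp: sym_pair_def)
qed

text \<open>Two integrations by parts gain the factor m^2; adding the plain bound on the coefficient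
  produces a denominator that also covers m = 0.\<close>

lemma fc_decay:
  assumes "\<And>x. (f has_vector_derivative f' x) (at x)" "\<And>x. (f' has_vector_derivative f'' x) (at x)"
    "continuous_on UNIV f''" "periodic1 f"
  obtains b where "b \<ge> 0" "\<And>m. cmod (fc f m) \<le> b / (1 + (of_int m)\<^sup>2)"
proof -
  have f': "continuous_on S f'" and f: "continuous_on S f" for S
    using assms(1,2) by (meson continuous_at_imp_continuous_on has_vector_derivative_continuous)+
  have "periodic1 f'"
    unfolding periodic1_def
  proof
    fix x
    have "((f \<circ> (\<lambda>x. x + 1)) has_vector_derivative 1 *\<^sub>R f' (x + 1)) (at x)"
      by (rule vector_diff_chain_at) (auto intro!: derivative_eq_intros assms(1) simp: has_vector_derivative_add_const)
    moreover have "f \<circ> (\<lambda>x. x + 1) = f" using assms(4) by (auto simp: periodic1_def)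
    ultimately show "f' (x + 1) = f' x" using assms(1)[of x] vector_derivative_unique_at by fastforce
  qed
  then have 2: "fc f'' m = (2 * \<i> * pi * of_int m)\<^sup>2 * fc f m" for m
    using fc_deriv[OF assms(2) continuous_on_subset[OF assms(3)], of m] fc_deriv[OF assms(1) f' assms(4), of m]
    by (simp add: power2_eq_square)
  have "compact (f ` {0..1} \<union> f'' ` {0..1})"
    by (intro compact_Un compact_continuous_image f continuous_on_subset[OF assms(3)]) auto
  then obtain b where b: "\<forall>y\<in>f ` {0..1} \<union> f'' ` {0..1}. norm y \<le> b"
    using compact_imp_bounded bounded_iff by blast
  have fcb: "cmod (fc h m) \<le> b" if "continuous_on {0..1} h" "\<And>x. x \<in> {0..1} \<Longrightarrow> cmod (h x) \<le> b" for h m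
    unfolding fc_def by (rule norm_integral_le) (auto intro!: continuous_intros that simp: norm_mult)
  have b0: "0 \<le> b" using b by (meson UnI1 atLeastAtMost_iff image_eqI norm_ge_zero order_trans zero_le_one order_refl)
  have "cmod (fc f m) \<le> 2 * b / (1 + (of_int m)\<^sup>2)" for m
  proof (cases "m = 0")
    case True
    then show ?thesis using fcb[of f m] f b b0 by fastforce
  next
    case False
    have "cmod (fc f'' m) = (2 * pi)\<^sup>2 * (of_int m)\<^sup>2 * cmod (fc f m)"
      unfolding 2 by (simp add: norm_mult norm_power power_mult_distrib)
    moreover have "cmod (fc f'' m) \<le> b"
      by (rule fcb) (use b in \<open>auto intro: continuous_on_subset[OF assms(3)]\<close>)
    moreover have "(of_int m)\<^sup>2 * cmod (fc f m) \<le> (2 * pi)\<^sup>2 * ((of_int m)\<^sup>2 * cmod (fc f m))"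
    proof -
      have "1 \<le> (2 * pi)\<^sup>2" using pi_gt3 by (intro one_le_power) auto
      then show ?thesis using mult_right_mono[of 1 "(2 * pi)\<^sup>2" "(of_int m)\<^sup>2 * cmod (fc f m)"] by simp
    qed
    ultimately have "(of_int m)\<^sup>2 * cmod (fc f m) \<le> b" by (simp add: mult.assoc)
    moreover have "cmod (fc f m) \<le> b" using fcb[of f m] f b by auto
    ultimately have "(1 + (of_int m)\<^sup>2) * cmod (fc f m) \<le> 2 * b" by (simp add: distrib_right)
    then show ?thesis by (simp add: pos_le_divide_eq add_pos_nonneg mult.commute)
  qed
  then show ?thesis using that[of "2 * b"] b0 by simp
qed

lemma summable_decay: "summable (\<lambda>n. b / (1 + (of_int (int n))\<^sup>2) :: real)"
proof -
  have "summable (\<lambda>n. \<bar>b\<bar> * inverse (real n ^ 2))"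
    by (intro summable_mult inverse_power_summable) simp
  then show ?thesis
  proof (rule summable_comparison_test'[where N=1])
    fix n :: nat assume "n \<ge> 1"
    then show "norm (b / (1 + (of_int (int n))\<^sup>2)) \<le> \<bar>b\<bar> * inverse (real n ^ 2)"
      by (simp add: divide_inverse abs_mult) (intro mult_left_mono le_imp_inverse_le; simp)
  qed
qed

text \<open>The quadratic decay gives a uniform limit, and the pointwise theorem identifies it as
  \<open>f\<close>.\<close>

lemma fourier_series_uniform:
  assumes "\<And>x. (f has_vector_derivative f' x) (at x)" "\<And>x. (f' has_vector_derivative f'' x) (at x)"
    "continuous_on UNIV f''" "periodic1 f"
  shows "uniform_limit UNIV (\<lambda>K x. \<Sum>m\<in>{- int K..int K}. fc f m * fourier_e m x) f sequentially"
proof -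
  obtain b where b: "b \<ge> 0" "\<And>m. cmod (fc f m) \<le> b / (1 + (of_int m)\<^sup>2)"
    using fc_decay[OF assms] by blast
  have f: "continuous_on UNIV f"
    using assms(1) by (meson continuous_at_imp_continuous_on has_vector_derivative_continuous)
  have "uniform_limit UNIV (\<lambda>K x. \<Sum>n<K. sym_pair (\<lambda>m. fc f m * fourier_e m x) n) (\<lambda>x. \<Sum>n. sym_pair (\<lambda>m. fc f m * fourier_e m x) n) sequentially"
    by (rule Weierstrass_m_test[where M="\<lambda>n. 2 * (b / (1 + (of_int (int n))\<^sup>2))"])
      (auto intro!: norm_sym_pair_le order_trans[OF b(2)] summable_mult summable_decay simp only: norm_mult norm_fourier_e mult_1_right of_int_minus power2_minus)
  then have "uniform_limit UNIV (\<lambda>K x. \<Sum>n\<le>K. sym_pair (\<lambda>m. fc f m * fourier_e m x) n) (\<lambda>x. \<Sum>n. sym_pair (\<lambda>m. fc f m * fourier_e m x) n) sequentially"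
    using filterlim_compose[OF _ filterlim_Suc] unfolding lessThan_Suc_atMost[symmetric] by blast
  moreover from tendsto_uniform_limitI[OF this UNIV_I]
  have "(\<Sum>n. sym_pair (\<lambda>m. fc f m * fourier_e m x) n) = f x" for x
    unfolding sum_sym_pair using fourier_series_pointwise[OF f assms(4) assms(1)] LIMSEQ_unique by blast
  ultimately show ?thesis unfolding sum_sym_pair by simp
qed

subsection \<open>Circle maps and the transfer operator\<close>

lemma integral_periodic:
  fixes f :: "real \<Rightarrow> complex"
  assumes f: "continuous_on UNIV f" "periodic1 f"
  shows "integral {c..c+1} f = integral {0..1} f"
proof -
  define n where "n = \<lfloor>c\<rfloor>"
  define r where "r = c - of_int n"
  have r: "0 \<le> r" "r \<le> 1" "c = r + of_int n" unfolding r_def n_def by linarith+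
  have shift: "integral {a..b} f = integral {a + of_int k..b + of_int k} f" for a b and k :: int
  proof -
    have "f \<circ> (\<lambda>x. x + of_int k) = f" using periodic_add_int[OF f(2)] by (auto simp: fun_eq_iff)
    then show ?thesis
      using integral_shift[of a "of_int k" b f] continuous_on_subset[OF f(1)] by simp
  qed
  have int: "f integrable_on {a..b}" for a b
    using continuous_on_subset[OF f(1)] by (intro integrable_continuous_interval) auto
  have "integral {c..c+1} f = integral {r..r+1} f"
    using shift[of r "r+1" n] r(3) by (simp add: add_ac)
  also have "\<dots> = integral {r..1} f + integral {1..r+1} f"
    using r by (intro Henstock_Kurzweil_Integration.integral_combine[symmetric] int) auto
  also have "integral {1..r+1} f = integral {0..r} f"
    using shift[of 0 r 1] by (simp add: add_ac)
  also have "integral {r..1} f + integral {0..r} f = integral {0..1} f"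
    using r by (subst add.commute) (intro Henstock_Kurzweil_Integration.integral_combine int, auto)
  finally show ?thesis .
qed

lemma transfer_periodic: "periodic1 (transfer V \<phi>)"
  unfolding periodic1_def transfer_def
proof
  fix x :: real
  have "V y - (x + 1) \<in> \<int> \<longleftrightarrow> V y - x \<in> \<int>" for y
    by (metis Ints_1 Ints_add Ints_diff diff_diff_eq diff_add_cancel)
  then show "(\<Sum>y\<in>{y\<in>{0..<1}. V y - (x + 1) \<in> \<int>}. of_real (1 / \<bar>deriv V y\<bar>) * \<phi> y) =
    (\<Sum>y\<in>{y\<in>{0..<1}. V y - x \<in> \<int>}. of_real (1 / \<bar>deriv V y\<bar>) * \<phi> y)" by simp
qed

text \<open>Covering maps of the circle given by an increasing lift. Expansion is not built in:
  besides \<open>T\<close> itself, the theory is to be applied to the displacement of its iterates,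
  whose zeros modulo 1 are the periodic points.\<close>

locale circle_cover =
  fixes V V' :: "real \<Rightarrow> real" and V'' :: "real \<Rightarrow> real" and deg :: nat
  assumes deg: "V (x + 1) = V x + real deg"
    and V: "(V has_real_derivative V' x) (at x)"
    and V': "(V' has_real_derivative V'' x) (at x)"
    and pos: "V' x > 0"
begin

lemma isCont_V: "isCont V x" and isCont_V': "isCont V' x"
  using V V' DERIV_isCont by blast+

lemma strict_mono_V: "strict_mono V"
proof (rule strict_monoI)
  fix x y :: real assume "x < y"
  then show "V x < V y"
    using DERIV_pos_imp_increasing[of x y V] V pos by blast
qed

lemma deg_pos: "deg > 0"
  using strict_monoD[OF strict_mono_V, of 0 1] deg[of 0] by (cases deg) auto

lemma V_int: "V (x + of_int n) = V x + of_int n * real deg"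
  by (rule add_int_shift[of V, OF deg])

lemma surj_V: "\<exists>y. V y = u"
proof -
  obtain n :: nat where n: "\<bar>u - V 0\<bar> \<le> real n" using real_arch_simple by blast
  have "real n \<le> real n * real deg" using deg_pos by (cases deg) (auto simp: algebra_simps)
  then have "V (- real n) \<le> u" "u \<le> V (real n)"
    using V_int[of 0 "int n"] V_int[of 0 "- int n"] n by auto
  then show ?thesis using IVT[of V "- real n" u "real n"] isCont_V by auto
qed

text \<open>The inverse of the lift on the whole line. The preimages of the circle point u are the
  values S (u + i), for i < \<open>deg\<close>, modulo 1.\<close>

definition S :: "real \<Rightarrow> real" where "S = inv_into UNIV V"

lemma V_S [simp]: "V (S u) = u"
  unfolding S_def by (rule f_inv_into_f) (metis surj_V rangeI)

lemma S_V [simp]: "S (V x) = x"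
  unfolding S_def by (rule inv_into_f_f) (auto intro: strict_mono_imp_inj_on strict_mono_V)

lemma DERIV_S: "(S has_real_derivative inverse (V' (S u))) (at u)"
proof (rule DERIV_inverse_function[where f=V and a="u - 1" and b="u + 1"])
  show "(V has_real_derivative V' (S u)) (at (S u))" by (rule V)
  show "isCont S u"
  proof -
    have "isCont S (V (S u))"
      by (rule isCont_inverse_function[where d=1]) (simp_all add: isCont_V)
    then show ?thesis by simp
  qed
qed (use pos[of "S u"] in auto)

lemma isCont_S: "isCont S u"
  using DERIV_S DERIV_isCont by blast

lemma S_add_int: "S (u + of_int n * real deg) = S u + of_int n"
  using S_V[of "S u + of_int n"] by (simp only: V_int V_S)

text \<open>Adding \<open>deg\<close> to the argument adds 1 to the value of \<open>S\<close>, hence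
  S (u + i) modulo 1 depends exactly on the class of i modulo \<open>deg\<close>.\<close>

lemma preimages:
  "bij_betw (\<lambda>i. frac (S (u + real i))) {..<deg} {y\<in>{0..<1}. V y - u \<in> \<int>}"
proof (rule bij_betwI')
  fix i j assume ij: "i \<in> {..<deg}" "j \<in> {..<deg}"
  show "(frac (S (u + real i)) = frac (S (u + real j))) = (i = j)"
  proof
    assume "frac (S (u + real i)) = frac (S (u + real j))"
    then have "S (u + real i) = S (u + real j) + of_int (\<lfloor>S (u + real i)\<rfloor> - \<lfloor>S (u + real j)\<rfloor>)"
      by (simp add: frac_def)
    then obtain n :: int where "S (u + real i) = S (u + real j) + of_int n" by blast
    then have "V (S (u + real i)) = V (S (u + real j)) + of_int n * real deg" by (simp only: V_int)
    then have "real i = real j + of_int n * real deg" by simp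
    then have "int i = int j + n * int deg"
      by (metis (mono_tags, lifting) of_int_add of_int_eq_iff of_int_mult of_int_of_nat_eq)
    then have "int i mod int deg = int j mod int deg" by simp
    then show "i = j" using ij by (simp add: zmod_int[symmetric])
  qed simp
next
  fix i assume "i \<in> {..<deg}"
  have "V (frac (S (u + real i))) - u = of_int (int i + (- \<lfloor>S (u + real i)\<rfloor>) * int deg)"
    using V_int[of "S (u + real i)" "- \<lfloor>S (u + real i)\<rfloor>"] by (simp add: frac_def)
  then show "frac (S (u + real i)) \<in> {y\<in>{0..<1}. V y - u \<in> \<int>}"
    using Ints_of_int by (auto simp: frac_ge_0 frac_lt_1 simp del: of_int_add of_int_mult)
next
  fix y assume y: "y \<in> {y\<in>{0..<1}. V y - u \<in> \<int>}"
  then obtain n where n: "V y = u + of_int n" by (auto elim!: Ints_cases simp: algebra_simps)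
  define i where "i = nat (n mod int deg)"
  have i: "i < deg" "int i = n mod int deg" using deg_pos by (auto simp: i_def nat_less_iff)
  have "n = int i + (n div int deg) * int deg" using i(2) by simp
  then have "V y = (u + real i) + of_int (n div int deg) * real deg"
    unfolding n by (metis add.assoc of_int_add of_int_mult of_int_of_nat_eq)
  then have "y = S (u + real i) + of_int (n div int deg)"
    using S_add_int[of "u + real i" "n div int deg"] S_V[of y] by simp
  then have "frac (S (u + real i)) = frac y" by (simp add: frac_def)
  also have "\<dots> = y" using y by (simp add: frac_eq)
  finally show "\<exists>i\<in>{..<deg}. y = frac (S (u + real i))" using i by auto
qed

lemma V'_periodic: "V' (x + of_int n) = V' x"
proof -
  have "((\<lambda>x. V (x + of_int n)) has_real_derivative V' (x + of_int n)) (at x)"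
    using DERIV_shift[of V "V' (x + of_int n)" x "of_int n"] V by (simp add: add.commute)
  moreover have "((\<lambda>x. V x + of_int n * real deg) has_real_derivative V' x) (at x)"
    by (auto intro!: derivative_eq_intros V)
  ultimately show ?thesis unfolding V_int using DERIV_unique by blast
qed

lemma deriv_V: "deriv V x = V' x"
  by (rule DERIV_imp_deriv[OF V])

lemma transfer_eq:
  assumes "periodic1 \<phi>"
  shows "transfer V \<phi> u = (\<Sum>i<deg. of_real (inverse (V' (S (u + real i)))) * \<phi> (S (u + real i)))"
proof -
  have "transfer V \<phi> u = (\<Sum>i<deg. of_real (1 / \<bar>deriv V (frac (S (u + real i)))\<bar>) * \<phi> (frac (S (u + real i))))"
    unfolding transfer_def by (rule sum.reindex_bij_betw[OF preimages, symmetric])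
  also have "\<dots> = (\<Sum>i<deg. of_real (inverse (V' (S (u + real i)))) * \<phi> (S (u + real i)))"
  proof (intro sum.cong refl)
    fix i
    have f: "frac (S (u + real i)) = S (u + real i) + of_int (- \<lfloor>S (u + real i)\<rfloor>)" by (simp add: frac_def)
    show "of_real (1 / \<bar>deriv V (frac (S (u + real i)))\<bar>) * \<phi> (frac (S (u + real i)))
      = of_real (inverse (V' (S (u + real i)))) * \<phi> (S (u + real i))"
      unfolding deriv_V f V'_periodic periodic_add_int[OF assms] using pos[of "S (u + real i)"]
      by (simp add: divide_inverse)
  qed
  finally show ?thesis .
qed

lemma continuous_transfer:
  assumes "periodic1 \<phi>" "continuous_on UNIV \<phi>"
  shows "continuous_on UNIV (transfer V \<phi>)"
proof -
  have e: "transfer V \<phi> = (\<lambda>u. \<Sum>i<deg. of_real (inverse (V' (S (u + real i)))) * \<phi> (S (u + real i)))"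
    using transfer_eq[OF assms(1)] by blast
  have S: "continuous_on UNIV (\<lambda>u. S (u + real i))" for i
    by (rule continuous_on_compose2[of UNIV S]) (auto intro!: continuous_intros continuous_at_imp_continuous_on isCont_S)
  have V': "continuous_on UNIV (\<lambda>u. V' (S (u + real i)))" for i
    by (rule continuous_on_compose2[of UNIV V' _ "\<lambda>u. S (u + real i)"]) (auto intro!: S continuous_at_imp_continuous_on isCont_V')
  have \<phi>: "continuous_on UNIV (\<lambda>u. \<phi> (S (u + real i)))" for i
    by (rule continuous_on_compose2[of UNIV \<phi> _ "\<lambda>u. S (u + real i)"]) (auto intro!: S assms)
  have nz: "V' (S (u + real i)) \<noteq> 0" for u i using pos[of "S (u + real i)"] by simp
  show ?thesis unfolding e by (intro continuous_intros V' \<phi>) (use nz in auto)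
qed

text \<open>Change of variables u = V y: the fundamental interval [S 0, S 0 + 1] is mapped onto
  [0, deg], which consists of \<open>deg\<close> unit intervals, one for each inverse branch.
  Periodicity brings the domain back to [0, 1].\<close>

lemma transfer_duality:
  assumes \<phi>: "periodic1 \<phi>" "continuous_on UNIV \<phi>" and \<psi>: "periodic1 \<psi>" "continuous_on UNIV \<psi>"
  shows "integral {0..1} (\<lambda>x. transfer V \<phi> x * \<psi> x) = integral {0..1} (\<lambda>y. \<phi> y * \<psi> (V y))"
proof -
  let ?h = "\<lambda>u. of_real (inverse (V' (S u))) * \<phi> (S u) * \<psi> u"
  have cS: "continuous_on A S" and cV: "continuous_on A V" for A
    by (auto intro!: continuous_at_imp_continuous_on isCont_S isCont_V)
  have ch: "continuous_on A ?h" for A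
  proof -
    have "continuous_on A (\<lambda>u. V' (S u))" "continuous_on A (\<lambda>u. \<phi> (S u))"
      by (rule continuous_on_compose2[of UNIV _ _ S]; auto intro!: cS continuous_at_imp_continuous_on isCont_V' \<phi>)+
    moreover have "V' (S u) \<noteq> 0" for u using pos[of "S u"] by simp
    ultimately show ?thesis by (intro continuous_intros continuous_on_subset[OF \<psi>(2)]) auto
  qed
  have "integral {0..1} (\<lambda>x. transfer V \<phi> x * \<psi> x) = integral {0..1} (\<lambda>u. \<Sum>i<deg. ?h (u + real i))"
    unfolding transfer_eq[OF \<phi>(1)] using periodic_add_int[OF \<psi>(1), of _ "int _"] by (simp add: sum_distrib_right)
  also have "\<dots> = (\<Sum>i<deg. integral {0..1} (\<lambda>u. ?h (u + real i)))"
  proof (rule integral_sum)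
    fix i
    have "continuous_on {0..1} (\<lambda>u. ?h (u + real i))"
      by (rule continuous_on_compose2[OF ch[of UNIV], of _ "\<lambda>u. u + real i"]) (auto intro!: continuous_intros)
    then show "(\<lambda>u. ?h (u + real i)) integrable_on {0..1}" by (rule integrable_continuous_interval)
  qed simp
  also have "\<dots> = (\<Sum>i<deg. integral {real i..real i + 1} ?h)"
  proof (intro sum.cong refl)
    fix i
    show "integral {0..1} (\<lambda>u. ?h (u + real i)) = integral {real i..real i + 1} ?h"
      using integral_shift[where a=0 and b=1 and c="real i", OF ch] unfolding comp_def add_0_left by (simp only: add.commute[of 1])
  qed
  also have "\<dots> = integral {0..real deg} ?h"
  proof -
    have "(\<Sum>i<n. integral {real i..real i + 1} ?h) = integral {0..real n} ?h" for n
    proof (induction n)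
      case (Suc n)
      have "integral {0..real n} ?h + integral {real n..real n + 1} ?h = integral {0..real n + 1} ?h"
        by (rule Henstock_Kurzweil_Integration.integral_combine, simp, simp, rule integrable_continuous_interval, rule ch)
      then show ?case using Suc by (simp add: add.commute)
    qed simp
    then show ?thesis .
  qed
  also have "\<dots> = integral {S 0..S 0 + 1} (\<lambda>y. \<phi> y * \<psi> (V y))"
  proof -
    have "((\<lambda>y. V' y *\<^sub>R ?h (V y)) has_integral (integral {V (S 0)..V (S 0 + 1)} ?h)) {S 0..S 0 + 1}"
    proof (rule has_integral_substitution[where c="V (S 0)" and d="V (S 0 + 1)"])
      show "V (S 0) \<le> V (S 0 + 1)" unfolding deg by simp
      show "V ` {S 0..S 0 + 1} \<subseteq> {V (S 0)..V (S 0 + 1)}"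
        by (auto simp: strict_mono_less_eq[OF strict_mono_V] simp del: V_S)
      show "(V has_real_derivative V' x) (at x within {S 0..S 0 + 1})" for x
        using V by (rule has_field_derivative_at_within)
      show "continuous_on {V (S 0)..V (S 0 + 1)} ?h" by (rule ch)
    qed simp
    moreover have "V' y *\<^sub>R ?h (V y) = \<phi> y * \<psi> (V y)" for y
      using pos[of y] by (simp add: scaleR_conv_of_real)
    ultimately show ?thesis by (simp add: integral_unique deg)
  qed
  also have "\<dots> = integral {0..1} (\<lambda>y. \<phi> y * \<psi> (V y))"
  proof (rule integral_periodic)
    show "continuous_on UNIV (\<lambda>y. \<phi> y * \<psi> (V y))"
      by (intro continuous_intros \<phi> continuous_on_compose2[OF \<psi>(2) cV]) auto
    show "periodic1 (\<lambda>y. \<phi> y * \<psi> (V y))"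
      using \<phi>(1) periodic_add_int[OF \<psi>(1), of _ "int deg"] by (simp add: periodic1_def deg)
  qed
  finally show ?thesis .
qed

text \<open>Provides the differentiability at a point which \<open>fourier_series_pointwise\<close>
  asks for; this is where the second derivative \<open>V''\<close> enters.\<close>

lemma DERIV_transfer_1:
  obtains D where "(transfer V (\<lambda>_. 1) has_vector_derivative D) (at u)"
proof -
  have e: "transfer V (\<lambda>_. 1) = (\<lambda>u. of_real (\<Sum>i<deg. inverse (V' (S (u + real i)))))"
    using transfer_eq[of "\<lambda>_. 1"] by (auto simp: periodic1_def)
  have "((\<lambda>u. inverse (V' (S (u + real i)))) has_real_derivative
     - (inverse (V' (S (u + real i))) * (V'' (S (u + real i)) * (inverse (V' (S (u + real i))) * 1)) * inverse (V' (S (u + real i))))) (at u)" for i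
    by (rule DERIV_inverse'[OF DERIV_chain2[OF V' DERIV_chain2[OF DERIV_S]]])
      (auto intro!: derivative_eq_intros simp: pos[THEN less_imp_neq, symmetric])
  then have "((\<lambda>u. \<Sum>i<deg. inverse (V' (S (u + real i)))) has_real_derivative
    (\<Sum>i<deg. - (inverse (V' (S (u + real i))) * (V'' (S (u + real i)) * (inverse (V' (S (u + real i))) * 1)) * inverse (V' (S (u + real i)))))) (at u)"
    by (intro DERIV_sum)
  then have "((\<lambda>u. complex_of_real (\<Sum>i<deg. inverse (V' (S (u + real i))))) has_vector_derivative
    of_real (\<Sum>i<deg. - (inverse (V' (S (u + real i))) * (V'' (S (u + real i)) * (inverse (V' (S (u + real i))) * 1)) * inverse (V' (S (u + real i)))))) (at u)"
    unfolding has_real_derivative_iff_has_vector_derivative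
    by (rule bounded_linear.has_vector_derivative[OF bounded_linear_of_real])
  then show ?thesis unfolding e[symmetric] by (rule that)
qed

end

text \<open>Covers both orientations, with the signed degree \<open>D\<close>; subtracting the
  identity from an iterate of \<open>T\<close> leads to either of them.\<close>

locale circle_immersion =
  fixes V V' V'' :: "real \<Rightarrow> real" and D :: int
  assumes D: "V (x + 1) = V x + of_int D"
    and V: "(V has_real_derivative V' x) (at x)"
    and V': "(V' has_real_derivative V'' x) (at x)"
    and nz: "V' x \<noteq> 0"
begin

lemma sign_cases: "(\<forall>x. V' x > 0) \<or> (\<forall>x. V' x < 0)"
proof (rule ccontr)
  assume "\<not> ?thesis"
  then obtain x y where xy: "V' x < 0" "V' y > 0" using nz by (metis linorder_neqE_linordered_idom)
  have c: "isCont V' z" for z using V' DERIV_isCont by blast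
  have "\<exists>z. V' z = 0"
  proof (cases "x \<le> y")
    case True
    then show ?thesis using IVT[of V' x 0 y] xy c by force
  next
    case False
    then show ?thesis using IVT2[of V' x 0 y] xy c by force
  qed
  then show False using nz by blast
qed

lemma D_nat:
  assumes "\<forall>x. V' x > 0" shows "real (nat D) = of_int D"
proof -
  have "V 0 < V 1" using DERIV_pos_imp_increasing[of 0 1 V] V assms by force
  then show ?thesis using D[of 0] by simp
qed

lemma cover_pos:
  assumes "\<forall>x. V' x > 0" shows "circle_cover V V' V'' (nat D)"
  using assms D_nat[OF assms] D V V' by unfold_locales auto

end

lemma circle_immersion_uminus:
  assumes "circle_immersion V V' V'' D"
  shows "circle_immersion (\<lambda>x. - V x) (\<lambda>x. - V' x) (\<lambda>x. - V'' x) (- D)"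
proof -
  interpret circle_immersion V V' V'' D by fact
  show ?thesis using D nz by unfold_locales (auto intro!: derivative_eq_intros V V')
qed

lemma transfer_uminus:
  assumes "circle_immersion V V' V'' D"
  shows "transfer V \<phi> x = transfer (\<lambda>x. - V x) \<phi> (- x)"
proof -
  interpret circle_immersion V V' V'' D by fact
  have "V y - x \<in> \<int> \<longleftrightarrow> - V y - - x \<in> \<int>" for y
    by (metis Ints_minus minus_diff_eq minus_diff_minus)
  moreover have "deriv V y = V' y" "deriv (\<lambda>x. - V x) y = - V' y" for y
    by (auto intro!: DERIV_imp_deriv derivative_eq_intros V)
  ultimately show ?thesis by (simp add: transfer_def)
qed

context circle_immersion
begin

text \<open>A map that reverses orientation becomes a \<open>circle_cover\<close> after x -> -x in
  the target, which composes the transfer operator with the same reflection. All further facts are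
  first shown for increasing lifts and then carried over.\<close>

lemma reflect_cases:
  assumes "circle_cover V V' V'' (nat D) \<Longrightarrow> P"
    and "circle_cover (\<lambda>x. - V x) (\<lambda>x. - V' x) (\<lambda>x. - V'' x) (nat (- D)) \<Longrightarrow>
      transfer V = (\<lambda>\<phi> x. transfer (\<lambda>x. - V x) \<phi> (- x)) \<Longrightarrow> P"
  shows P
  using sign_cases
proof
  assume "\<forall>x. V' x > 0"
  then show P using assms(1) cover_pos by blast
next
  assume neg: "\<forall>x. V' x < 0"
  have im: "circle_immersion V V' V'' D" by unfold_locales
  interpret U: circle_immersion "\<lambda>x. - V x" "\<lambda>x. - V' x" "\<lambda>x. - V'' x" "- D"
    by (rule circle_immersion_uminus[OF im])
  have "circle_cover (\<lambda>x. - V x) (\<lambda>x. - V' x) (\<lambda>x. - V'' x) (nat (- D))"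
    by (rule U.cover_pos) (use neg in auto)
  then show P using assms(2) transfer_uminus[OF im] by (simp add: fun_eq_iff)
qed

lemma transfer_continuous:
  assumes "periodic1 \<phi>" "continuous_on UNIV \<phi>"
  shows "continuous_on A (transfer V \<phi>)"
proof (rule reflect_cases)
  assume "circle_cover V V' V'' (nat D)"
  then show ?thesis using circle_cover.continuous_transfer[OF _ assms] continuous_on_subset by blast
next
  assume c: "circle_cover (\<lambda>x. - V x) (\<lambda>x. - V' x) (\<lambda>x. - V'' x) (nat (- D))"
    and e: "transfer V = (\<lambda>\<phi> x. transfer (\<lambda>x. - V x) \<phi> (- x))"
  show ?thesis unfolding e
    by (rule continuous_on_compose2[OF circle_cover.continuous_transfer[OF c assms], of _ uminus]) (auto intro: continuous_intros)
qed

lemma transfer_dual: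
  assumes \<phi>: "periodic1 \<phi>" "continuous_on UNIV \<phi>" and \<psi>: "periodic1 \<psi>" "continuous_on UNIV \<psi>"
  shows "integral {0..1} (\<lambda>x. transfer V \<phi> x * \<psi> x) = integral {0..1} (\<lambda>y. \<phi> y * \<psi> (V y))"
proof (rule reflect_cases)
  assume "circle_cover V V' V'' (nat D)"
  then show ?thesis by (rule circle_cover.transfer_duality) fact+
next
  assume c: "circle_cover (\<lambda>x. - V x) (\<lambda>x. - V' x) (\<lambda>x. - V'' x) (nat (- D))"
    and e: "transfer V = (\<lambda>\<phi> x. transfer (\<lambda>x. - V x) \<phi> (- x))"
  let ?h = "\<lambda>x. transfer (\<lambda>x. - V x) \<phi> x * \<psi> (- x)"
  have \<psi>': "continuous_on UNIV (\<lambda>x. \<psi> (- x))"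
    by (rule continuous_on_compose2[OF \<psi>(2), of _ uminus]) (auto intro: continuous_intros)
  have p\<psi>: "periodic1 (\<lambda>x. \<psi> (- x))"
    unfolding periodic1_def using periodic_add_int[OF \<psi>(1), of "- _" "- 1"] by simp
  have h: "continuous_on UNIV ?h" "periodic1 ?h"
    using circle_cover.continuous_transfer[OF c \<phi>] transfer_periodic[of "\<lambda>x. - V x" \<phi>] p\<psi> \<psi>'
    by (auto simp: periodic1_def intro!: continuous_intros)
  have "integral {0..1} (\<lambda>x. transfer V \<phi> x * \<psi> x) = integral {0..1} (\<lambda>x. ?h (- x))"
    unfolding e by simp
  also have "\<dots> = integral {-1..-0} ?h"
    using Henstock_Kurzweil_Integration.integral_reflect_real[of 0 "- 1" ?h] by simp
  also have "\<dots> = integral {0..1} ?h"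
    using integral_periodic[OF h, of "- 1"] by simp
  also have "\<dots> = integral {0..1} (\<lambda>y. \<phi> y * \<psi> (- (- V y)))"
    by (rule circle_cover.transfer_duality[OF c \<phi> p\<psi> \<psi>'])
  finally show ?thesis by simp
qed

lemma transfer_1_differentiable:
  obtains d where "(transfer V (\<lambda>_. 1) has_vector_derivative d) (at 0)"
proof (rule reflect_cases)
  assume "circle_cover V V' V'' (nat D)"
  then show ?thesis using circle_cover.DERIV_transfer_1 that by blast
next
  assume c: "circle_cover (\<lambda>x. - V x) (\<lambda>x. - V' x) (\<lambda>x. - V'' x) (nat (- D))"
    and e: "transfer V = (\<lambda>\<phi> x. transfer (\<lambda>x. - V x) \<phi> (- x))"
  obtain d where d: "(transfer (\<lambda>x. - V x) (\<lambda>_. 1) has_vector_derivative d) (at (- 0))"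
    using circle_cover.DERIV_transfer_1[OF c, of 0] by auto
  have "((transfer (\<lambda>x. - V x) (\<lambda>_. 1) \<circ> uminus) has_vector_derivative (-1) *\<^sub>R d) (at 0)"
    by (rule vector_diff_chain_at[where f=uminus and x=0 and f'="-1", OF _ d]) (auto intro!: derivative_eq_intros)
  then show ?thesis using that unfolding e by (simp add: comp_def)
qed

text \<open>There are |D| branches, each of weight at most 1 / c.\<close>

lemma transfer_1_bound:
  assumes c: "c > 0" "\<And>x. \<bar>V' x\<bar> \<ge> c"
  shows "cmod (transfer V (\<lambda>_. 1) u) \<le> of_int \<bar>D\<bar> / c"
proof -
  have p: "periodic1 (\<lambda>_. 1 :: complex)" by (simp add: periodic1_def)
  have b: "cmod (\<Sum>i<n. complex_of_real (inverse (f i)) * 1) \<le> real n / c" if "\<And>i. \<bar>f i\<bar> \<ge> c" for n :: nat and f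
  proof -
    have "cmod (\<Sum>i<n. complex_of_real (inverse (f i)) * 1) \<le> (\<Sum>i<n. inverse c)"
    proof (rule order_trans[OF norm_sum sum_mono])
      fix i
      show "cmod (complex_of_real (inverse (f i)) * 1) \<le> inverse c"
        using that[of i] c(1) by (simp add: norm_inverse le_imp_inverse_le)
    qed
    then show ?thesis by (simp add: divide_inverse)
  qed
  have n: "real (nat x) \<le> of_int \<bar>x\<bar>" for x by simp
  show ?thesis
  proof (rule reflect_cases)
    assume cc: "circle_cover V V' V'' (nat D)"
    show ?thesis unfolding circle_cover.transfer_eq[OF cc p]
      by (rule order_trans[OF b]) (use c n[of D] in \<open>auto intro!: divide_right_mono\<close>)
  next
    assume cc: "circle_cover (\<lambda>x. - V x) (\<lambda>x. - V' x) (\<lambda>x. - V'' x) (nat (- D))"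
      and e: "transfer V = (\<lambda>\<phi> x. transfer (\<lambda>x. - V x) \<phi> (- x))"
    show ?thesis unfolding e circle_cover.transfer_eq[OF cc p]
      by (rule order_trans[OF b]) (use c n[of "- D"] in \<open>auto intro!: divide_right_mono\<close>)
  qed
qed

lemma continuous_V: "continuous_on A V"
  using V DERIV_isCont continuous_at_imp_continuous_on by blast

end

text \<open>The entry (j, k) of the transfer operator in the Fourier basis, written by duality as an
  integral against e_j composed with \<open>V\<close>. In this form it is visibly bounded by 1, and
  it can be formed for all iterates, including the identity.\<close>

definition mc :: "(real \<Rightarrow> real) \<Rightarrow> int \<Rightarrow> int \<Rightarrow> complex" where
  "mc V j k = integral {0..1} (\<lambda>y. fourier_e k y * cnj (fourier_e j (V y)))"

lemma mc_le_1:
  assumes "continuous_on {0..1} V" shows "cmod (mc V j k) \<le> 1"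
  unfolding mc_def using assms by (intro norm_integral_le continuous_intros) (auto simp: norm_mult)

lemma fourier_e_periodic1: "periodic1 (fourier_e k)" "periodic1 (\<lambda>x. cnj (fourier_e k x))"
  by (simp_all add: periodic1_def fourier_e_periodic)

lemma fourier_e_cont: "continuous_on A (fourier_e k)" "continuous_on A (\<lambda>x. cnj (fourier_e k x))"
  using fourier_e_continuous[of A "\<lambda>x. x"] by (auto intro: continuous_intros)

context circle_immersion
begin

lemma fc_transfer: "fc (transfer V (fourier_e k)) j = mc V j k"
  unfolding fc_def mc_def by (rule transfer_dual[OF fourier_e_periodic1(1) fourier_e_cont(1) fourier_e_periodic1(2) fourier_e_cont(2)])

text \<open>With u and v the trigonometric polynomials of x and of the image y, the square of the
  norm of y is the integral of u against the conjugate of v composed with \<open>V\<close>. By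
  duality the mean square of that composition is an integral of |v|^2 against
  \<open>transfer V (\<lambda>_. 1)\<close>, which is at most |D| when the derivative is at least 1
  in modulus.\<close>

lemma mc_operator_bound:
  assumes B: "finite B" and c: "\<And>x. \<bar>V' x\<bar> \<ge> 1"
  shows "nrm B (\<lambda>j. \<Sum>k\<in>B. mc V j k * x k) \<le> sqrt (of_int \<bar>D\<bar>) * nrm B x"
proof -
  define y where "y j = (\<Sum>k\<in>B. mc V j k * x k)" for j
  define u where "u t = (\<Sum>k\<in>B. x k * fourier_e k t)" for t
  define v where "v t = (\<Sum>k\<in>B. y k * fourier_e k t)" for t
  let ?D = "of_int \<bar>D\<bar> :: real"
  have u: "continuous_on A u" and v: "continuous_on A v" for A
    unfolding u_def v_def by (intro continuous_intros)+
  have vV: "continuous_on A (\<lambda>t. v (V t))" for A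
    by (rule continuous_on_compose2[OF v[of UNIV] continuous_V]) auto
  have D0: "?D > 0"
  proof -
    have "D \<noteq> 0"
    proof
      assume "D = 0"
      then have "circle_cover V V' V'' 0 \<or> circle_cover (\<lambda>x. - V x) (\<lambda>x. - V' x) (\<lambda>x. - V'' x) 0"
        using reflect_cases[of "circle_cover V V' V'' 0 \<or> circle_cover (\<lambda>x. - V x) (\<lambda>x. - V' x) (\<lambda>x. - V'' x) 0"] by auto
      then show False using circle_cover.deg_pos by blast
    qed
    then show ?thesis by simp
  qed
  have "(\<Sum>j\<in>B. cnj (y j) * y j) = integral {0..1} (\<lambda>t. u t * cnj (v (V t)))"
  proof -
    have "integral {0..1} (\<lambda>t. u t * cnj (v (V t)))
      = integral {0..1} (\<lambda>t. \<Sum>j\<in>B. \<Sum>k\<in>B. cnj (y j) * (x k * (fourier_e k t * cnj (fourier_e j (V t)))))"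
      by (intro integral_cong) (simp add: u_def v_def sum_product mult_ac, rule sum.swap)
    also have "\<dots> = (\<Sum>j\<in>B. integral {0..1} (\<lambda>t. \<Sum>k\<in>B. cnj (y j) * (x k * (fourier_e k t * cnj (fourier_e j (V t))))))"
      by (intro integral_sum B integrable_continuous_interval continuous_intros continuous_V)
    also have "\<dots> = (\<Sum>j\<in>B. \<Sum>k\<in>B. integral {0..1} (\<lambda>t. cnj (y j) * (x k * (fourier_e k t * cnj (fourier_e j (V t))))))"
      by (intro sum.cong refl integral_sum B integrable_continuous_interval continuous_intros continuous_V)
    also have "\<dots> = (\<Sum>j\<in>B. cnj (y j) * y j)"
    proof -
      have 1: "integral {0..1} (\<lambda>t. cnj (y j) * (x k * (fourier_e k t * cnj (fourier_e j (V t))))) = cnj (y j) * (mc V j k * x k)" for j k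
        unfolding mc_def by (simp add: mult.commute)
      show ?thesis unfolding 1 sum_distrib_left[symmetric] y_def[symmetric] ..
    qed
    finally show ?thesis by simp
  qed
  then have "complex_of_real ((nrm B y)\<^sup>2) = integral {0..1} (\<lambda>t. u t * cnj (v (V t)))"
    unfolding nrm_sq by (simp add: complex_norm_square mult.commute del: of_real_power)
  then have e1: "(nrm B y)\<^sup>2 = integral {0..1} (\<lambda>t. Re (u t * cnj (v (V t))))"
    by (subst integral_Re_01) (auto intro!: continuous_intros u vV simp: complex_eq_iff)
  \<comment> \<open>The inequality between the means, weighted by \<open>?D\<close> to compensate
    the factor \<open>?D\<close> that the composition with \<open>V\<close> costs: half of the left
    hand side then reappears on the right and is absorbed.\<close>
  also have "\<dots> \<le> integral {0..1} (\<lambda>t. (?D * (cmod (u t))\<^sup>2 + (cmod (v (V t)))\<^sup>2 / ?D) / 2)"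
  proof (rule integral_le)
    fix t
    have "0 \<le> (sqrt ?D * cmod (u t) - cmod (v (V t)) / sqrt ?D)\<^sup>2" by simp
    also have "\<dots> = ?D * (cmod (u t))\<^sup>2 + (cmod (v (V t)))\<^sup>2 / ?D - 2 * (cmod (u t) * cmod (v (V t)))"
      using D0 by (simp add: power2_diff power_mult_distrib power_divide)
    finally show "Re (u t * cnj (v (V t))) \<le> (?D * (cmod (u t))\<^sup>2 + (cmod (v (V t)))\<^sup>2 / ?D) / 2"
      using complex_Re_le_cmod[of "u t * cnj (v (V t))"] by (simp add: norm_mult)
  qed (use D0 in \<open>auto intro!: integrable_continuous_interval continuous_intros u vV\<close>)
  also have "\<dots> = (?D * integral {0..1} (\<lambda>t. (cmod (u t))\<^sup>2) + integral {0..1} (\<lambda>t. (cmod (v (V t)))\<^sup>2) / ?D) / 2"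
    using D0 by (subst integral_divide integral_add integral_mult_right;
        (intro integrable_continuous_interval continuous_intros u vV refl; simp)?)+
  also have "integral {0..1} (\<lambda>t. (cmod (v (V t)))\<^sup>2) \<le> ?D * integral {0..1} (\<lambda>t. (cmod (v t))\<^sup>2)"
  proof -
    let ?\<psi> = "\<lambda>t. complex_of_real ((cmod (v t))\<^sup>2)"
    have "complex_of_real (integral {0..1} (\<lambda>t. (cmod (v (V t)))\<^sup>2)) = integral {0..1} (\<lambda>t. 1 * ?\<psi> (V t))"
      by (subst integral_of_real_01[symmetric]) (auto intro!: continuous_intros vV)
    also have "\<dots> = integral {0..1} (\<lambda>t. transfer V (\<lambda>_. 1) t * ?\<psi> t)"
      by (rule transfer_dual[symmetric])
        (auto intro!: continuous_intros v simp: periodic1_def v_def fourier_e_periodic)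
    finally have "integral {0..1} (\<lambda>t. (cmod (v (V t)))\<^sup>2) = Re (integral {0..1} (\<lambda>t. transfer V (\<lambda>_. 1) t * ?\<psi> t))"
      by (metis Re_complex_of_real)
    also have "\<dots> = integral {0..1} (\<lambda>t. Re (transfer V (\<lambda>_. 1) t * ?\<psi> t))"
      by (subst integral_Re_01) (auto intro!: continuous_intros v transfer_continuous simp: periodic1_def)
    also have "\<dots> \<le> integral {0..1} (\<lambda>t. ?D * (cmod (v t))\<^sup>2)"
    proof (rule integral_le)
      fix t
      have "Re (transfer V (\<lambda>_. 1) t) \<le> ?D"
        using transfer_1_bound[of 1 t] c complex_Re_le_cmod[of "transfer V (\<lambda>_. 1) t"] by simp
      then show "Re (transfer V (\<lambda>_. 1) t * ?\<psi> t) \<le> ?D * (cmod (v t))\<^sup>2"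
        by (simp add: mult_right_mono del: of_real_power)
    qed (auto intro!: integrable_continuous_interval continuous_intros v transfer_continuous simp: periodic1_def)
    finally show ?thesis by simp
  qed
  finally have "(nrm B y)\<^sup>2 \<le> (?D * integral {0..1} (\<lambda>t. (cmod (u t))\<^sup>2) + integral {0..1} (\<lambda>t. (cmod (v t))\<^sup>2)) / 2"
    using D0 by (simp add: divide_right_mono pos_divide_le_eq mult.commute)
  then have "(nrm B y)\<^sup>2 \<le> (?D * (nrm B x)\<^sup>2 + (nrm B y)\<^sup>2) / 2"
    unfolding u_def v_def parseval_trig[OF B] nrm_sq .
  then have "(nrm B y)\<^sup>2 \<le> ?D * (nrm B x)\<^sup>2" by simp
  then have "nrm B y \<le> sqrt (?D * (nrm B x)\<^sup>2)" by (rule real_le_rsqrt)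
  then show ?thesis unfolding y_def[abs_def] by (simp add: real_sqrt_mult)
qed

end

section \<open>Expanding maps, their iterates and periodic points\<close>

locale expanding =
  fixes T T1 T2 :: "real \<Rightarrow> real" and D :: int and lam :: real
  assumes deg: "T (x + 1) = T x + of_int D"
    and T: "(T has_real_derivative T1 x) (at x)"
    and T1: "(T1 has_real_derivative T2 x) (at x)"
    and T2: "continuous_on UNIV T2"
    and lam: "lam > 1" "\<bar>T1 x\<bar> > lam"
begin

lemma iterates:
  "\<exists>V' V''. (\<forall>x. ((T ^^ n) has_real_derivative V' x) (at x)) \<and> (\<forall>x. (V' has_real_derivative V'' x) (at x))
    \<and> (\<forall>x. \<bar>V' x\<bar> \<ge> lam ^ n) \<and> (\<forall>x. (T ^^ n) (x + 1) = (T ^^ n) x + of_int (D ^ n))"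
proof (induction n)
  case 0
  have "((T ^^ 0) has_real_derivative 1) (at x)" for x by (auto simp: id_def)
  then show ?case by (intro exI[of _ "\<lambda>_. 1"] exI[of _ "\<lambda>_. 0"]) auto
next
  case (Suc n)
  then obtain V' V'' where V: "\<And>x. ((T ^^ n) has_real_derivative V' x) (at x)"
    "\<And>x. (V' has_real_derivative V'' x) (at x)" "\<And>x. \<bar>V' x\<bar> \<ge> lam ^ n"
    "\<And>x. (T ^^ n) (x + 1) = (T ^^ n) x + of_int (D ^ n)" by blast
  have Tint: "T (x + of_int k) = T x + of_int k * of_int D" for x k
    by (rule add_int_shift[of T, OF deg])
  let ?V' = "\<lambda>x. T1 ((T ^^ n) x) * V' x"
  let ?V'' = "\<lambda>x. T2 ((T ^^ n) x) * V' x * V' x + V'' x * T1 ((T ^^ n) x)"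
  have "((T ^^ Suc n) has_real_derivative ?V' x) (at x)" for x
    using DERIV_chain[OF T V(1)] by simp
  moreover have "(?V' has_real_derivative ?V'' x) (at x)" for x
    by (intro DERIV_mult DERIV_chain2[OF T1 V(1)] V(2))
  moreover have "\<bar>?V' x\<bar> \<ge> lam ^ Suc n" for x
    using lam(2)[of "(T ^^ n) x"] V(3)[of x] lam(1) by (auto simp: abs_mult intro!: mult_mono)
  moreover have "(T ^^ Suc n) (x + 1) = (T ^^ Suc n) x + of_int (D ^ Suc n)" for x
    using V(4)[of x] Tint[of "(T ^^ n) x" "D ^ n"] by (simp add: mult.commute)
  ultimately show ?case by (intro exI[of _ ?V'] exI[of _ ?V'']) blast
qed

sublocale T: circle_immersion T T1 T2 D
proof
  show "T1 x \<noteq> 0" for x using lam(1) lam(2)[of x] by auto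
qed (use deg T T1 in auto)

lemma continuous_iterate: "continuous_on A (T ^^ n)"
proof -
  obtain V' where V: "\<And>x. ((T ^^ n) has_real_derivative V' x) (at x)" using iterates[of n] by blast
  show ?thesis by (intro continuous_at_imp_continuous_on ballI DERIV_isCont[OF V])
qed

text \<open>The product of e_m(y) and the conjugate of e_m(T^n y) is the conjugate of e_m(T^n y -
  y). Hence the diagonal entries of the n-th power are the Fourier coefficients of the function
  obtained by applying the transfer operator of T^n - id to 1. Their sum is the value of that
  function at 0, a sum over the points fixed by T^n, which is the flat trace.\<close>

lemma fixed_points:
  assumes "n \<ge> 1"
  shows "(\<lambda>K. \<Sum>m\<in>{- int K..int K}. mc (T ^^ n) m m) \<longlonglongrightarrow> of_real (flat_trace T n)"
    and "flat_trace T n \<le> (of_int \<bar>D\<bar> ^ n + 1) / (lam - 1)" and "flat_trace T n \<ge> 0"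
proof -
  obtain V' V'' where V: "\<And>x. ((T ^^ n) has_real_derivative V' x) (at x)"
    "\<And>x. (V' has_real_derivative V'' x) (at x)" "\<And>x. \<bar>V' x\<bar> \<ge> lam ^ n"
    "\<And>x. (T ^^ n) (x + 1) = (T ^^ n) x + of_int (D ^ n)" using iterates[of n] by blast
  let ?W = "\<lambda>y. (T ^^ n) y - y"
  \<comment> \<open>For n >= 1 the derivative of the displacement stays at distance at least lam - 1
    from 0, so the displacement is an immersion and each weight in its transfer operator is at most
    1 / (lam - 1).\<close>
  have "lam ^ 1 \<le> lam ^ n" using assms lam(1) by (intro power_increasing) auto
  then have W1: "\<bar>V' x - 1\<bar> \<ge> lam - 1" for x using V(3)[of x] by simp
  interpret W: circle_immersion ?W "\<lambda>x. V' x - 1" V'' "D ^ n - 1"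
  proof
    show "V' x - 1 \<noteq> 0" for x using W1[of x] lam(1) by auto
  qed (auto simp: V(4) intro!: derivative_eq_intros V(1,2))
  have p1: "periodic1 (\<lambda>_. 1 :: complex)" by (simp add: periodic1_def)
  have mc: "mc (T ^^ n) m m = fc (transfer ?W (\<lambda>_. 1)) m" for m
  proof -
    have "fc (transfer ?W (\<lambda>_. 1)) m = integral {0..1} (\<lambda>y. 1 * cnj (fourier_e m (?W y)))"
      unfolding fc_def by (rule W.transfer_dual[OF p1 continuous_on_const fourier_e_periodic1(2) fourier_e_cont(2)])
    also have "\<dots> = mc (T ^^ n) m m"
    proof -
      have "1 * cnj (fourier_e m (?W y)) = fourier_e m y * cnj (fourier_e m ((T ^^ n) y))" for y
      proof -
        have "fourier_e m (?W y) = fourier_e m ((T ^^ n) y) * cnj (fourier_e m y)"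
          using fourier_e_add(2)[of m "(T ^^ n) y" "- y"] by (simp add: fourier_e_cnj(2))
        then show ?thesis by simp
      qed
      then show ?thesis unfolding mc_def by simp
    qed
    finally show ?thesis by simp
  qed
  have tr: "transfer ?W (\<lambda>_. 1) 0 = of_real (flat_trace T n)"
  proof -
    have d1: "deriv (T ^^ n) x = V' x" and d2: "deriv ?W x = V' x - 1" for x
      by (auto intro!: DERIV_imp_deriv derivative_eq_intros V(1))
    show ?thesis unfolding transfer_def flat_trace_def d1 d2
      by (simp add: abs_minus_commute)
  qed
  obtain d where d: "(transfer ?W (\<lambda>_. 1) has_vector_derivative d) (at 0)"
    using W.transfer_1_differentiable by blast
  from fourier_series_pointwise[OF W.transfer_continuous[OF p1 continuous_on_const] transfer_periodic d]
  show "(\<lambda>K. \<Sum>m\<in>{- int K..int K}. mc (T ^^ n) m m) \<longlonglongrightarrow> of_real (flat_trace T n)"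
    unfolding mc tr by simp
  show nn: "flat_trace T n \<ge> 0" unfolding flat_trace_def by (intro sum_nonneg) auto
  have "flat_trace T n = cmod (transfer ?W (\<lambda>_. 1) 0)" using nn unfolding tr by simp
  also have "\<dots> \<le> of_int \<bar>D ^ n - 1\<bar> / (lam - 1)"
    using W1 lam(1) by (intro W.transfer_1_bound) auto
  also have "\<dots> \<le> (of_int \<bar>D\<bar> ^ n + 1) / (lam - 1)"
    using lam(1) abs_triangle_ineq4[of "of_int D ^ n" "1::real"] by (intro divide_right_mono) (auto simp: power_abs)
  finally show "flat_trace T n \<le> (of_int \<bar>D\<bar> ^ n + 1) / (lam - 1)" .
qed

text \<open>Up to conjugation, row j of the matrix consists of the Fourier coefficients of this
  function. Its second derivative makes the rows absolutely summable and the Fourier series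
  uniformly convergent.\<close>

lemma koopman_C2:
  obtains f' f'' where "\<And>x. ((\<lambda>x. fourier_e j (T x)) has_vector_derivative f' x) (at x)"
    "\<And>x. (f' has_vector_derivative f'' x) (at x)" "continuous_on UNIV f''"
    "periodic1 (\<lambda>x. fourier_e j (T x))"
proof -
  let ?c = "2 * \<i> * pi * of_int j" and ?f = "\<lambda>x. fourier_e j (T x)"
  have T': "(T has_vector_derivative T1 x) (at x)" and T1': "(T1 has_vector_derivative T2 x) (at x)" for x
    using T T1 by (simp_all add: has_real_derivative_iff_has_vector_derivative)
  have f1: "(?f has_vector_derivative of_real (T1 x) * (?c * ?f x)) (at x)" for x
    using vector_diff_chain_at[OF T' fourier_e_deriv] by (simp add: comp_def scaleR_conv_of_real)
  have f2: "((\<lambda>x. of_real (T1 x) * (?c * ?f x)) has_vector_derivative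
     of_real (T1 x) * (?c * (of_real (T1 x) * (?c * ?f x))) + of_real (T2 x) * (?c * ?f x)) (at x)" for x
    by (intro has_vector_derivative_mult has_vector_derivative_mult_right f1
        bounded_linear.has_vector_derivative[OF bounded_linear_of_real] T1')
  have cT1: "continuous_on UNIV T1" using T1 DERIV_isCont continuous_at_imp_continuous_on by blast
  have "continuous_on UNIV (\<lambda>x. of_real (T1 x) * (?c * (of_real (T1 x) * (?c * ?f x))) + of_real (T2 x) * (?c * ?f x))"
    by (intro continuous_intros cT1 T2 T.continuous_V)
  moreover have "periodic1 ?f" by (simp add: periodic1_def deg fourier_e_add fourier_e_Ints)
  ultimately show ?thesis by (rule that[OF f1 f2])
qed

lemma mc_cnj: "fc (\<lambda>x. fourier_e j (T x)) m = cnj (mc T j m)"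
  unfolding fc_def mc_def
  by (subst integral_cnj_01[symmetric]) (auto intro!: continuous_intros T.continuous_V simp: mult.commute)

lemma mc_decay: obtains b where "b \<ge> 0" "\<And>m. cmod (mc T j m) \<le> b / (1 + (of_int m)\<^sup>2)"
proof -
  obtain f' f'' where f: "\<And>x. ((\<lambda>x. fourier_e j (T x)) has_vector_derivative f' x) (at x)"
    "\<And>x. (f' has_vector_derivative f'' x) (at x)" "continuous_on UNIV f''"
    "periodic1 (\<lambda>x. fourier_e j (T x))"
    using koopman_C2 by blast
  obtain b where "b \<ge> 0" "\<And>m. cmod (fc (\<lambda>x. fourier_e j (T x)) m) \<le> b / (1 + (of_int m)\<^sup>2)"
    using fc_decay[OF f] by blast
  then show ?thesis unfolding mc_cnj complex_mod_cnj by (rule that)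
qed

text \<open>Expand e_j composed with \<open>T\<close> into its uniformly convergent Fourier series,
  compose with the p-th iterate and integrate term by term: the matrix of the next power is a matrix
  product over all frequencies.\<close>

lemma mc_Suc:
  "(\<lambda>K. \<Sum>m\<in>{- int K..int K}. mc T j m * mc (T ^^ p) m k) \<longlonglongrightarrow> mc (T ^^ Suc p) j k"
proof -
  let ?f = "\<lambda>x. fourier_e j (T x)"
  obtain f' f'' where f: "\<And>x. (?f has_vector_derivative f' x) (at x)"
    "\<And>x. (f' has_vector_derivative f'' x) (at x)" "continuous_on UNIV f''" "periodic1 ?f"
    using koopman_C2 by blast
  let ?s = "\<lambda>K x. \<Sum>m\<in>{- int K..int K}. fc ?f m * fourier_e m x"
  have u: "uniform_limit UNIV ?s ?f sequentially"
    by (rule fourier_series_uniform[OF f])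
  have ul: "uniform_limit {0..1} (\<lambda>K x. fourier_e k x * cnj (?s K ((T ^^ p) x))) (\<lambda>x. fourier_e k x * cnj (?f ((T ^^ p) x))) sequentially"
  proof (rule uniform_limitI)
    fix e :: real assume "e > 0"
    from uniform_limitD[OF u this]
    show "\<forall>\<^sub>F K in sequentially. \<forall>x\<in>{0..1}. dist (fourier_e k x * cnj (?s K ((T ^^ p) x))) (fourier_e k x * cnj (?f ((T ^^ p) x))) < e"
    proof eventually_elim
      case (elim K)
      show ?case
      proof
        fix x
        have "dist (fourier_e k x * cnj (?s K ((T ^^ p) x))) (fourier_e k x * cnj (?f ((T ^^ p) x)))
          = dist (?s K ((T ^^ p) x)) (?f ((T ^^ p) x))"
          unfolding dist_norm right_diff_distrib[symmetric] norm_mult complex_cnj_diff[symmetric] complex_mod_cnj by simp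
        also have "\<dots> < e" using elim by blast
        finally show "dist (fourier_e k x * cnj (?s K ((T ^^ p) x))) (fourier_e k x * cnj (?f ((T ^^ p) x))) < e" .
      qed
    qed
  qed
  have "(\<lambda>K. integral {0..1} (\<lambda>x. fourier_e k x * cnj (?s K ((T ^^ p) x)))) \<longlonglongrightarrow> integral {0..1} (\<lambda>x. fourier_e k x * cnj (?f ((T ^^ p) x)))"
  proof -
    have c: "continuous_on {0..1} (\<lambda>x. fourier_e k x * cnj (?s K ((T ^^ p) x)))" for K
      by (intro continuous_intros continuous_iterate)
    obtain I J where IJ: "\<And>K. ((\<lambda>x. fourier_e k x * cnj (?s K ((T ^^ p) x))) has_integral I K) {0..1}"
      "((\<lambda>x. fourier_e k x * cnj (?f ((T ^^ p) x))) has_integral J) {0..1}" "I \<longlonglongrightarrow> J"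
      by (rule uniform_limit_integral[OF ul c]) auto
    then show ?thesis by (simp only: integral_unique[OF IJ(1)] integral_unique[OF IJ(2)])
  qed
  moreover have "integral {0..1} (\<lambda>x. fourier_e k x * cnj (?s K ((T ^^ p) x))) = (\<Sum>m\<in>{- int K..int K}. mc T j m * mc (T ^^ p) m k)" for K
  proof -
    have "integral {0..1} (\<lambda>x. fourier_e k x * cnj (?s K ((T ^^ p) x)))
      = integral {0..1} (\<lambda>x. \<Sum>m\<in>{- int K..int K}. mc T j m * (fourier_e k x * cnj (fourier_e m ((T ^^ p) x))))"
      unfolding mc_cnj by (intro integral_cong) (simp add: sum_distrib_left mult_ac)
    also have "\<dots> = (\<Sum>m\<in>{- int K..int K}. integral {0..1} (\<lambda>x. mc T j m * (fourier_e k x * cnj (fourier_e m ((T ^^ p) x)))))"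
      by (intro integral_sum integrable_continuous_interval continuous_intros continuous_iterate) auto
    finally show ?thesis by (simp add: mc_def)
  qed
  ultimately show ?thesis by (simp add: mc_def)
qed

end

subsection \<open>Convergence of the traces of the truncations\<close>

text \<open>The weights of successive steps cancel, so that diagonal entries of powers, hence
  traces, do not see the weights of the space.\<close>

lemma fpow_conj:
  assumes "\<And>j. h j \<noteq> 0"
  shows "fpow B (\<lambda>j k. h j * a j k * inverse (h k)) p j k = h j * fpow B a p j k * inverse (h k)"
proof (induction p arbitrary: j)
  case (Suc p)
  have "h j * a j m * inverse (h m) * (h m * fpow B a p m k * inverse (h k)) = h j * (a j m * fpow B a p m k) * inverse (h k)" for m
    using assms[of m] by simp
  then show ?case unfolding fpow.simps Suc sum_distrib_left sum_distrib_right by (intro sum.cong refl)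
qed (use assms in auto)

lemma fpow_le_operator_norm:
  assumes "finite B" "C \<ge> 0" and C: "\<And>x. nrm B (\<lambda>j. \<Sum>k\<in>B. a j k * x k) \<le> C * nrm B x"
    and "j \<in> B" "k \<in> B"
  shows "cmod (fpow B a p j k) \<le> C ^ p"
proof -
  have "nrm B (\<lambda>j. fpow B a p j k) \<le> C ^ p"
  proof (induction p)
    case 0
    have "(\<Sum>j\<in>B. (cmod (kron j k))\<^sup>2) = (\<Sum>j\<in>B. if j = k then 1 else 0)" by (intro sum.cong) auto
    then show ?case using assms by (simp add: L2_set_def)
  next
    case (Suc p)
    have "nrm B (\<lambda>j. fpow B a (Suc p) j k) \<le> C * nrm B (\<lambda>j. fpow B a p j k)" using C by simp
    also have "\<dots> \<le> C * C ^ p" using Suc assms(2) by (rule mult_left_mono)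
    finally show ?case by simp
  qed
  moreover have "cmod (fpow B a p j k) \<le> nrm B (\<lambda>j. fpow B a p j k)"
    using member_le_L2_set[OF assms(1,4), of "\<lambda>j. cmod (fpow B a p j k)"] by simp
  ultimately show ?thesis by simp
qed

text \<open>A closed path that is not contained in the smaller set has a step starting at one of the new
  points; such a step contributes a factor at most \<open>\<delta>\<close>.\<close>

lemma fpow_enlarge:
  assumes B: "finite B'" "B \<subseteq> B'" and K: "real (card B') \<le> K"
    and a: "\<And>j k. cmod (a j k) \<le> 1"
    and \<delta>: "\<And>j k. j \<in> B' - B \<Longrightarrow> k \<in> B' \<Longrightarrow> cmod (a j k) \<le> \<delta>" "\<delta> \<ge> 0"
    and "k \<in> B" "l \<in> B"
  shows "cmod (fpow B' a p k l - fpow B a p k l) \<le> real p * K ^ p * \<delta>"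
proof -
  have K0: "K \<ge> 0" using K by (meson of_nat_0_le_iff order_trans)
  have sum_le: "(\<Sum>m\<in>A. f m) \<le> K * b" if "A \<subseteq> B'" "b \<ge> 0" "\<And>m. m \<in> A \<Longrightarrow> f m \<le> b" for A and f :: "_ \<Rightarrow> real" and b
  proof -
    have "(\<Sum>m\<in>A. f m) \<le> real (card A) * b" using sum_bounded_above[of A f b] that by simp
    also have "\<dots> \<le> K * b"
      using K card_mono[OF B(1) that(1)] that(2) by (intro mult_right_mono) auto
    finally show ?thesis .
  qed
  have X: "cmod (fpow B' a p j l) \<le> K ^ p" for p j
  proof (induction p arbitrary: j)
    case (Suc p)
    have "cmod (fpow B' a (Suc p) j l) \<le> (\<Sum>m\<in>B'. cmod (a j m * fpow B' a p m l))"
      by (simp add: norm_sum)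
    also have "\<dots> \<le> K * K ^ p"
    proof (rule sum_le)
      fix m
      show "cmod (a j m * fpow B' a p m l) \<le> K ^ p"
        using mult_mono[OF a[of j m] Suc[of m]] by (simp add: norm_mult)
    qed (use K0 in auto)
    finally show ?case by simp
  qed auto
  \<comment> \<open>A path starting at a new point pays \<delta> in its first step. Without any step
    the entry is 0, because \<open>l\<close> belongs to \<open>B\<close> and \<open>j\<close> does
    not.\<close>
  have Y: "cmod (fpow B' a p j l) \<le> \<delta> * K ^ p" if j: "j \<in> B' - B" for p j
  proof (cases p)
    case 0
    then show ?thesis using j \<open>l \<in> B\<close> \<delta>(2) by auto
  next
    case (Suc q)
    have "cmod (fpow B' a (Suc q) j l) \<le> (\<Sum>m\<in>B'. cmod (a j m * fpow B' a q m l))"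
      by (simp add: norm_sum)
    also have "\<dots> \<le> K * (\<delta> * K ^ q)"
    proof (rule sum_le)
      fix m assume "m \<in> B'"
      then show "cmod (a j m * fpow B' a q m l) \<le> \<delta> * K ^ q"
        using mult_mono[OF \<delta>(1)[OF j] X[of q m]] \<delta>(2) by (simp add: norm_mult)
    qed (use K0 \<delta>(2) in auto)
    finally show ?thesis unfolding Suc by (simp add: mult_ac)
  qed
  show ?thesis using \<open>k \<in> B\<close>
  proof (induction p arbitrary: k)
    case (Suc p)
    have "(\<Sum>m\<in>B'. a k m * fpow B' a p m l) = (\<Sum>m\<in>B. a k m * fpow B' a p m l) + (\<Sum>m\<in>B'-B. a k m * fpow B' a p m l)"
      using sum.subset_diff[OF B(2,1)] by (simp add: add.commute)
    then have e: "fpow B' a (Suc p) k l - fpow B a (Suc p) k l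
      = (\<Sum>m\<in>B. a k m * (fpow B' a p m l - fpow B a p m l)) + (\<Sum>m\<in>B'-B. a k m * fpow B' a p m l)"
      by (simp add: right_diff_distrib sum_subtractf)
    have "cmod (fpow B' a (Suc p) k l - fpow B a (Suc p) k l) \<le> (\<Sum>m\<in>B. cmod (a k m * (fpow B' a p m l - fpow B a p m l))) + (\<Sum>m\<in>B'-B. cmod (a k m * fpow B' a p m l))"
      unfolding e by (intro order_trans[OF norm_triangle_ineq] add_mono norm_sum)
    also have "(\<Sum>m\<in>B. cmod (a k m * (fpow B' a p m l - fpow B a p m l))) \<le> K * (real p * K ^ p * \<delta>)"
    proof (rule sum_le)
      fix m assume "m \<in> B"
      from Suc.IH[OF this] have "cmod (a k m) * cmod (fpow B' a p m l - fpow B a p m l) \<le> 1 * (real p * K ^ p * \<delta>)"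
        by (intro mult_mono a) auto
      then show "cmod (a k m * (fpow B' a p m l - fpow B a p m l)) \<le> real p * K ^ p * \<delta>"
        by (simp only: norm_mult mult_1_left)
    next
      show "B \<subseteq> B'" by fact
      show "0 \<le> real p * K ^ p * \<delta>" using K0 \<delta>(2) by simp
    qed
    also have "(\<Sum>m\<in>B'-B. cmod (a k m * fpow B' a p m l)) \<le> K * (\<delta> * K ^ p)"
    proof (rule sum_le)
      fix m assume "m \<in> B' - B"
      from Y[OF this] have "cmod (a k m) * cmod (fpow B' a p m l) \<le> 1 * (\<delta> * K ^ p)"
        by (intro mult_mono a) auto
      then show "cmod (a k m * fpow B' a p m l) \<le> \<delta> * K ^ p"
        by (simp only: norm_mult mult_1_left)
    next
      show "B' - B \<subseteq> B'" by auto
      show "0 \<le> \<delta> * K ^ p" using K0 \<delta>(2) by simp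
    qed
    finally show ?case by (simp add: algebra_simps)
  qed simp
qed

text \<open>Two limits are combined. For fixed indices, the entries of powers of the sections
  converge to those of the full powers \<open>A\<close>. For the sum over the diagonal, adding the
  block of level n changes it by at most the summable \<epsilon> n, since the new entries decay
  faster than any power of the number of indices; so the section to \<open>B N\<close> may be
  compared with \<open>A\<close> on the same diagonal.\<close>

lemma trace_limit:
  fixes a :: "int \<Rightarrow> int \<Rightarrow> complex" and lev :: "int \<Rightarrow> nat"
  defines "B \<equiv> \<lambda>N. {k. lev k \<le> N}"
  assumes B: "\<And>N. B N = {- int (\<kappa> N)..int (\<kappa> N)}" and \<kappa>: "filterlim \<kappa> at_top sequentially"
    and K: "\<And>N. real (card (B N)) \<le> K N"
    and a: "\<And>j k. cmod (a j k) \<le> 1"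
    and \<delta>: "\<And>j k. lev k \<le> lev j \<Longrightarrow> cmod (a j k) \<le> \<delta> (lev j)" "\<And>N. \<delta> N \<ge> 0"
    and summ: "\<And>p. summable (\<lambda>N. K N ^ p * \<delta> N)"
    and C: "C \<ge> 0" "\<And>N x. nrm (B N) (\<lambda>j. \<Sum>k\<in>B N. a j k * x k) \<le> C * nrm (B N) x"
    and decay: "\<And>j. \<exists>b\<ge>0. \<forall>m. cmod (a j m) \<le> b / (1 + (of_int m)\<^sup>2)"
    and A0: "\<And>j k. A 0 j k = kron j k"
    and ASuc: "\<And>p j k. (\<lambda>K. \<Sum>m\<in>{- int K..int K}. a j m * A p m k) \<longlonglongrightarrow> A (Suc p) j k"
    and t: "(\<lambda>K. \<Sum>m\<in>{- int K..int K}. A p m m) \<longlonglongrightarrow> t"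
  shows "(\<lambda>N. \<Sum>j\<in>B N. fpow (B N) a p j j) \<longlonglongrightarrow> t"
proof -
  have fin: "finite (B N)" for N unfolding B by simp
  have ev: "eventually (\<lambda>N. k \<in> B N) sequentially" for k
    by (rule eventually_sequentiallyI[of "lev k"]) (simp add: B_def)
  have lim: "(\<lambda>N. fpow (B N) a p j k) \<longlonglongrightarrow> A p j k" for p j k
  proof (induction p arbitrary: j)
    case 0
    then show ?case by (simp add: A0)
  next
    case (Suc p)
    obtain b where b: "b \<ge> 0" "\<And>m. cmod (a j m) \<le> b / (1 + (of_int m)\<^sup>2)" using decay[of j] by blast
    \<comment> \<open>Extended by 0 outside the section, so that Tannery's theorem applies: the row
      \<open>j\<close> decays quadratically and the remaining factor is at most
      \<open>C ^ p\<close>, uniformly in \<open>N\<close>.\<close>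
    let ?s = "\<lambda>n N. if n \<le> \<kappa> N then sym_pair (\<lambda>m. a j m * fpow (B N) a p m k) n else 0"
    let ?l = "\<lambda>n. sym_pair (\<lambda>m. a j m * A p m k) n"
    have "eventually (\<lambda>N. summable (\<lambda>n. norm (?s n N))) sequentially \<and> summable (\<lambda>n. norm (?l n)) \<and>
      (\<lambda>N. suminf (\<lambda>n. ?s n N)) \<longlonglongrightarrow> suminf ?l"
    proof (rule tannerys_theorem[where M="\<lambda>n. 2 * (b * C ^ p / (1 + (of_int (int n))\<^sup>2))"])
      fix n
      have "(\<lambda>N. sym_pair (\<lambda>m. a j m * fpow (B N) a p m k) n) \<longlonglongrightarrow> ?l n"
        unfolding sym_pair_def by (auto intro!: tendsto_intros Suc.IH)
      moreover have "eventually (\<lambda>N. sym_pair (\<lambda>m. a j m * fpow (B N) a p m k) n = ?s n N) sequentially"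
        using eventually_compose_filterlim[OF eventually_ge_at_top[of n] \<kappa>] by eventually_elim simp
      ultimately show "(\<lambda>N. ?s n N) \<longlonglongrightarrow> ?l n" by (rule Lim_transform_eventually)
    next
      have "norm (?s n N) \<le> 2 * (b * C ^ p / (1 + (of_int (int n))\<^sup>2))" if N: "k \<in> B N" for n N
      proof (cases "n \<le> \<kappa> N")
        case True
        have "norm (sym_pair (\<lambda>m. a j m * fpow (B N) a p m k) n) \<le> 2 * (b * C ^ p / (1 + (of_int (int n))\<^sup>2))"
        proof (rule norm_sym_pair_le)
          fix m assume m: "m = int n \<or> m = - int n"
          then have "m \<in> B N" using True by (auto simp: B)
          from fpow_le_operator_norm[OF fin C this N]
          have "cmod (fpow (B N) a p m k) \<le> C ^ p" .
          then have "norm (a j m * fpow (B N) a p m k) \<le> b / (1 + (of_int m)\<^sup>2) * C ^ p"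
            unfolding norm_mult using b by (intro mult_mono) auto
          also have "(of_int m)\<^sup>2 = ((of_int (int n))\<^sup>2 :: real)" using m by auto
          finally show "norm (a j m * fpow (B N) a p m k) \<le> b * C ^ p / (1 + (of_int (int n))\<^sup>2)" by simp
        qed
        then show ?thesis using True by simp
      qed (use b C in auto)
      then have "eventually (\<lambda>N. \<forall>n. norm (?s n N) \<le> 2 * (b * C ^ p / (1 + (of_int (int n))\<^sup>2))) sequentially"
        using ev[of k] by (elim eventually_mono) blast
      from eventually_prodI[OF eventually_True[of sequentially] this]
      show "eventually (\<lambda>(n, N). norm (?s n N) \<le> 2 * (b * C ^ p / (1 + (of_int (int n))\<^sup>2))) (sequentially \<times>\<^sub>F sequentially)"
        by (rule eventually_mono) (simp add: case_prod_beta)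
      show "summable (\<lambda>n. 2 * (b * C ^ p / (1 + (of_int (int n))\<^sup>2)))"
        by (intro summable_mult summable_decay)
    qed simp
    then have s: "summable ?l" and c: "(\<lambda>N. suminf (\<lambda>n. ?s n N)) \<longlonglongrightarrow> suminf ?l"
      using summable_norm_cancel by blast+
    have "suminf (\<lambda>n. ?s n N) = fpow (B N) a (Suc p) j k" for N
    proof -
      have "suminf (\<lambda>n. ?s n N) = (\<Sum>n\<le>\<kappa> N. sym_pair (\<lambda>m. a j m * fpow (B N) a p m k) n)"
        by (subst suminf_finite[of "{..\<kappa> N}"]) auto
      then show ?thesis unfolding sum_sym_pair by (simp add: B)
    qed
    moreover have "suminf ?l = A (Suc p) j k"
    proof (rule LIMSEQ_unique)
      show "(\<lambda>K. \<Sum>m\<in>{- int K..int K}. a j m * A p m k) \<longlonglongrightarrow> suminf ?l"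
        using summable_LIMSEQ'[OF s] unfolding sum_sym_pair .
    qed (rule ASuc)
    ultimately show ?case using c by simp
  qed
  \<comment> \<open>The first factor counts diagonal entries, the second is the change of a single
    entry according to \<open>fpow_enlarge\<close>.\<close>
  define \<epsilon> where "\<epsilon> N = K N * (real p * K N ^ p * \<delta> N)" for N
  have K0: "K N \<ge> 0" for N using K by (meson of_nat_0_le_iff order_trans)
  have \<epsilon>0: "\<epsilon> N \<ge> 0" for N unfolding \<epsilon>_def using K0 \<delta>(2) by auto
  have \<epsilon>: "summable \<epsilon>"
    using summable_mult[OF summ[of "Suc p"], of "real p"] by (simp add: \<epsilon>_def[abs_def] mult_ac)
  \<comment> \<open>The diagonal stays restricted to \<open>B N\<close> while the section in which
    powers are formed grows; the sum telescopes over the levels added.\<close>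
  have step: "cmod (\<Sum>k\<in>B N. fpow (B (N + i)) a p k k - fpow (B N) a p k k) \<le> (\<Sum>n<i. \<epsilon> (Suc N + n))" for N i
  proof (induction i)
    case (Suc i)
    let ?M = "N + i"
    have "cmod (fpow (B (Suc ?M)) a p k k - fpow (B ?M) a p k k) \<le> real p * K (Suc ?M) ^ p * \<delta> (Suc ?M)" if "k \<in> B N" for k
    proof (rule fpow_enlarge[OF fin _ K a])
      show "B ?M \<subseteq> B (Suc ?M)" by (auto simp: B_def)
      show "k \<in> B ?M" "k \<in> B ?M" using that by (auto simp: B_def)
      fix j k assume "j \<in> B (Suc ?M) - B ?M" "k \<in> B (Suc ?M)"
      then have "lev j = Suc ?M" "lev k \<le> lev j" by (auto simp: B_def)
      then show "cmod (a j k) \<le> \<delta> (Suc ?M)" using \<delta>(1)[of k j] by simp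
    qed (rule \<delta>)
    then have "(\<Sum>k\<in>B N. cmod (fpow (B (Suc ?M)) a p k k - fpow (B ?M) a p k k)) \<le> real (card (B N)) * (real p * K (Suc ?M) ^ p * \<delta> (Suc ?M))"
      using sum_bounded_above[of "B N" "\<lambda>k. cmod (fpow (B (Suc ?M)) a p k k - fpow (B ?M) a p k k)"] by simp
    also have "\<dots> \<le> \<epsilon> (Suc ?M)"
    proof -
      have "card (B N) \<le> card (B (Suc ?M))" by (intro card_mono fin) (auto simp: B_def)
      then have "real (card (B N)) \<le> K (Suc ?M)" using K[of "Suc ?M"] by linarith
      then show ?thesis unfolding \<epsilon>_def using K0 \<delta>(2) by (intro mult_right_mono) auto
    qed
    finally have "cmod (\<Sum>k\<in>B N. fpow (B (Suc ?M)) a p k k - fpow (B ?M) a p k k) \<le> \<epsilon> (Suc ?M)"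
      by (rule order_trans[OF norm_sum])
    moreover have "(\<Sum>k\<in>B N. fpow (B (N + Suc i)) a p k k - fpow (B N) a p k k)
      = (\<Sum>k\<in>B N. fpow (B ?M) a p k k - fpow (B N) a p k k) + (\<Sum>k\<in>B N. fpow (B (Suc ?M)) a p k k - fpow (B ?M) a p k k)"
      by (simp add: sum_subtractf)
    ultimately show ?case using Suc norm_triangle_le by (simp add: add_mono norm_triangle_le)
  qed simp
  have close: "cmod ((\<Sum>k\<in>B N. A p k k) - (\<Sum>k\<in>B N. fpow (B N) a p k k)) \<le> (\<Sum>n. \<epsilon> (n + Suc N))" for N
  proof -
    have "(\<lambda>i. \<Sum>k\<in>B N. fpow (B (N + i)) a p k k - fpow (B N) a p k k) \<longlonglongrightarrow> (\<Sum>k\<in>B N. A p k k - fpow (B N) a p k k)"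
    proof (intro tendsto_intros)
      fix k
      show "(\<lambda>i. fpow (B (N + i)) a p k k) \<longlonglongrightarrow> A p k k"
        using LIMSEQ_ignore_initial_segment[OF lim[of p k k], of N] by (simp only: add.commute)
    qed
    from tendsto_norm[OF this]
    have "cmod (\<Sum>k\<in>B N. A p k k - fpow (B N) a p k k) \<le> (\<Sum>n. \<epsilon> (n + Suc N))"
    proof (rule LIMSEQ_le_const2, intro exI allI impI)
      fix i
      have "cmod (\<Sum>k\<in>B N. fpow (B (N + i)) a p k k - fpow (B N) a p k k) \<le> (\<Sum>n<i. \<epsilon> (n + Suc N))"
        using step[of N i] by (simp add: add.commute)
      also have "\<dots> \<le> (\<Sum>n. \<epsilon> (n + Suc N))"
        by (rule sum_le_suminf[OF summable_ignore_initial_segment[OF \<epsilon>]]) (use \<epsilon>0 in auto)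
      finally show "cmod (\<Sum>k\<in>B N. fpow (B (N + i)) a p k k - fpow (B N) a p k k) \<le> (\<Sum>n. \<epsilon> (n + Suc N))" .
    qed
    then show ?thesis by (simp add: sum_subtractf)
  qed
  have tail: "(\<lambda>N. \<Sum>n. \<epsilon> (n + Suc N)) \<longlonglongrightarrow> 0"
    using suminf_exist_split2[OF \<epsilon>] by (rule LIMSEQ_Suc)
  have "(\<lambda>N. (\<Sum>k\<in>B N. A p k k) - (\<Sum>k\<in>B N. fpow (B N) a p k k)) \<longlonglongrightarrow> 0"
    by (rule Lim_null_comparison[OF always_eventually tail]) (use close in blast)
  moreover have "(\<lambda>N. \<Sum>k\<in>B N. A p k k) \<longlonglongrightarrow> t"
    unfolding B using filterlim_compose[OF t \<kappa>] .
  ultimately have "(\<lambda>N. (\<Sum>k\<in>B N. A p k k) - ((\<Sum>k\<in>B N. A p k k) - (\<Sum>k\<in>B N. fpow (B N) a p k k))) \<longlonglongrightarrow> t - 0"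
    by (intro tendsto_diff)
  then show ?thesis by simp
qed

subsection \<open>Singular value expansion in coordinates\<close>

text \<open>Only finite sections of coordinate sequences are ever summed: \<open>B\<close> exhausts the index set
  and \<open>J u\<close> are the coordinates of \<open>u\<close>.\<close>

locale coordinate_space =
  fixes H :: "'f set" and J :: "'f \<Rightarrow> 'i \<Rightarrow> complex" and ip :: "'f \<Rightarrow> 'f \<Rightarrow> complex" and B :: "nat \<Rightarrow> 'i set"
  assumes fin: "finite (B N)" and mono: "incseq B" and exhaust: "i \<in> (\<Union>N. B N)"
    and ip: "u \<in> H \<Longrightarrow> v \<in> H \<Longrightarrow> (\<lambda>N. \<Sum>j\<in>B N. J u j * cnj (J v j)) \<longlonglongrightarrow> ip u v"
    and full: "(\<And>N. nrm (B N) x \<le> b) \<Longrightarrow> \<exists>u\<in>H. J u = x"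
begin

lemma ev_mem: "eventually (\<lambda>N. i \<in> B N) sequentially"
proof -
  obtain N where "i \<in> B N" using exhaust by blast
  then show ?thesis using mono by (auto simp: eventually_sequentially incseq_def)
qed

lemma finite_subset_B: "finite A \<Longrightarrow> eventually (\<lambda>N. A \<subseteq> B N) sequentially"
proof (induction A rule: finite_induct)
  case (insert i A)
  then show ?case using ev_mem[of i] by (auto elim: eventually_elim2)
qed simp

text \<open>The Gram matrix of \<open>Y\<close> is diagonal in the limit, so the squared norms of
  the combination over the sets \<open>B N\<close> tend to the right hand side and eventually
  dominate the one over \<open>A\<close>. Used for an orthonormal system and for its images under
  the operator.\<close>

lemma combination_le:
  fixes Y :: "nat \<Rightarrow> 'i \<Rightarrow> complex"
  assumes Y: "\<And>l m. l < q \<Longrightarrow> m < q \<Longrightarrow> (\<lambda>N. \<Sum>j\<in>B N. Y l j * cnj (Y m j)) \<longlonglongrightarrow> (if l = m then complex_of_real (\<sigma> l) else 0)"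
    and A: "finite A"
  shows "(nrm A (\<lambda>j. \<Sum>l<q. Y l j * x l))\<^sup>2 \<le> (\<Sum>l<q. \<sigma> l * (cmod (x l))\<^sup>2)"
proof -
  let ?y = "\<lambda>j. \<Sum>l<q. Y l j * x l"
  have sq: "complex_of_real (\<Sum>j\<in>B N. (cmod (?y j))\<^sup>2) = (\<Sum>l<q. \<Sum>m<q. x l * cnj (x m) * (\<Sum>j\<in>B N. Y l j * cnj (Y m j)))" for N
  proof -
    have "complex_of_real (\<Sum>j\<in>B N. (cmod (?y j))\<^sup>2) = (\<Sum>j\<in>B N. \<Sum>l<q. \<Sum>m<q. x l * cnj (x m) * (Y l j * cnj (Y m j)))"
      unfolding of_real_sum complex_norm_square by (simp add: sum_product mult_ac)
    also have "\<dots> = (\<Sum>l<q. \<Sum>m<q. \<Sum>j\<in>B N. x l * cnj (x m) * (Y l j * cnj (Y m j)))"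
      by (subst sum.swap, intro sum.cong refl, rule sum.swap)
    finally show ?thesis by (simp add: sum_distrib_left)
  qed
  have "(\<lambda>N. complex_of_real (\<Sum>j\<in>B N. (cmod (?y j))\<^sup>2)) \<longlonglongrightarrow> (\<Sum>l<q. \<Sum>m<q. x l * cnj (x m) * (if l = m then complex_of_real (\<sigma> l) else 0))"
    unfolding sq by (intro tendsto_intros Y) auto
  also have "(\<Sum>l<q. \<Sum>m<q. x l * cnj (x m) * (if l = m then complex_of_real (\<sigma> l) else 0)) = (\<Sum>l<q. x l * cnj (x l) * complex_of_real (\<sigma> l))"
  proof (intro sum.cong refl)
    fix l assume "l \<in> {..<q}"
    then show "(\<Sum>m<q. x l * cnj (x m) * (if l = m then complex_of_real (\<sigma> l) else 0)) = x l * cnj (x l) * complex_of_real (\<sigma> l)"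
      by (subst sum.mono_neutral_right[of _ "{l}"]) auto
  qed
  also have "\<dots> = complex_of_real (\<Sum>l<q. \<sigma> l * (cmod (x l))\<^sup>2)"
    by (simp add: complex_norm_square[symmetric] mult.commute del: of_real_power)
  finally have lim: "(\<lambda>N. \<Sum>j\<in>B N. (cmod (?y j))\<^sup>2) \<longlonglongrightarrow> (\<Sum>l<q. \<sigma> l * (cmod (x l))\<^sup>2)"
    unfolding tendsto_of_real_iff .
  have "(\<Sum>j\<in>A. (cmod (?y j))\<^sup>2) \<le> (\<Sum>l<q. \<sigma> l * (cmod (x l))\<^sup>2)"
  proof (rule tendsto_lowerbound[OF lim])
    show "eventually (\<lambda>N. (\<Sum>j\<in>A. (cmod (?y j))\<^sup>2) \<le> (\<Sum>j\<in>B N. (cmod (?y j))\<^sup>2)) sequentially"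
      using finite_subset_B[OF A] by eventually_elim (intro sum_mono2 fin; simp)
  qed simp
  then show ?thesis by (simp add: nrm_sq)
qed

lemma ip_kron_right:
  assumes "u \<in> H" "t \<in> H" "J t = (\<lambda>i. kron i j)"
  shows "ip u t = J u j"
proof (rule LIMSEQ_unique[OF ip[OF assms(1,2)]])
  have "eventually (\<lambda>N. (\<Sum>i\<in>B N. J u i * cnj (J t i)) = J u j) sequentially"
    using ev_mem[of j]
  proof eventually_elim
    case (elim N)
    have "(\<Sum>i\<in>B N. J u i * cnj (J t i)) = (\<Sum>i\<in>B N. J u i * kron i j)" unfolding assms(3) by (intro sum.cong) auto
    then show ?case using sum_kron_right[OF fin elim] by simp
  qed
  then show "(\<lambda>N. \<Sum>i\<in>B N. J u i * cnj (J t i)) \<longlonglongrightarrow> J u j" by (rule tendsto_eventually)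
qed

lemma ip_kron_left:
  assumes "u \<in> H" "t \<in> H" "J t = (\<lambda>i. kron i j)"
  shows "ip t u = cnj (J u j)"
proof (rule LIMSEQ_unique[OF ip[OF assms(2,1)]])
  have "eventually (\<lambda>N. (\<Sum>i\<in>B N. J t i * cnj (J u i)) = cnj (J u j)) sequentially"
    using ev_mem[of j]
  proof eventually_elim
    case (elim N)
    have "(\<Sum>i\<in>B N. J t i * cnj (J u i)) = (\<Sum>i\<in>B N. kron j i * cnj (J u i))" unfolding assms(3) by (intro sum.cong) auto
    then show ?case using sum_kron_left[OF fin elim] by simp
  qed
  then show "(\<lambda>N. \<Sum>i\<in>B N. J t i * cnj (J u i)) \<longlonglongrightarrow> cnj (J u j)" by (rule tendsto_eventually)
qed

lemma nrm_bounded: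
  assumes "u \<in> H" obtains b where "b \<ge> 0" "\<And>N. nrm (B N) (J u) \<le> b"
proof -
  have "convergent (\<lambda>N. \<Sum>j\<in>B N. J u j * cnj (J u j))" using ip[OF assms assms] by (auto simp: convergent_def)
  then obtain b where b: "\<And>N. cmod (\<Sum>j\<in>B N. J u j * cnj (J u j)) \<le> b"
    using BseqE[OF convergent_imp_Bseq] by blast
  have "(nrm (B N) (J u))\<^sup>2 \<le> b" for N
  proof -
    have "(\<Sum>j\<in>B N. J u j * cnj (J u j)) = complex_of_real ((nrm (B N) (J u))\<^sup>2)"
      unfolding nrm_sq of_real_sum complex_norm_square ..
    then show ?thesis using b[of N] by (simp add: norm_power)
  qed
  then have "nrm (B N) (J u) \<le> sqrt b" for N by (intro real_le_rsqrt)
  moreover have "0 \<le> b" using b[of 0] norm_ge_zero order_trans by blast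
  ultimately show ?thesis using that[of "sqrt b"] by simp
qed

text \<open>Identities between elements are stated for their coordinates, as members of
  \<open>H\<close> that agree almost everywhere may be different functions. The \<open>t i\<close>
  are the unit coordinate vectors.\<close>

context
  fixes A A' :: "'f \<Rightarrow> 'f" and e :: "nat \<Rightarrow> 'f" and s :: "nat \<Rightarrow> real" and t :: "'i \<Rightarrow> 'f"
  assumes A: "\<And>u. u \<in> H \<Longrightarrow> A u \<in> H" and A': "\<And>u. u \<in> H \<Longrightarrow> A' u \<in> H"
    and adj: "\<And>u v. u \<in> H \<Longrightarrow> v \<in> H \<Longrightarrow> ip (A u) v = ip u (A' v)"
    and e: "\<And>l. e l \<in> H" "\<And>k l. ip (e k) (e l) = (if k = l then 1 else 0)"
    and s: "\<And>l i. J (A' (A (e l))) i = of_real ((s l)\<^sup>2) * J (e l) i"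
    and ker: "\<And>u i. u \<in> H \<Longrightarrow> (\<And>l. ip u (e l) = 0) \<Longrightarrow> J (A' (A u)) i = 0"
    and t: "\<And>i. t i \<in> H" "\<And>i. J (t i) = (\<lambda>j. kron j i)"
begin

lemma orthonormal_combination: "finite X \<Longrightarrow> (nrm X (\<lambda>j. \<Sum>l<q. J (e l) j * x l))\<^sup>2 \<le> (\<Sum>l<q. (cmod (x l))\<^sup>2)"
proof -
  assume X: "finite X"
  have "(\<lambda>N. \<Sum>j\<in>B N. J (e l) j * cnj (J (e m) j)) \<longlonglongrightarrow> (if l = m then complex_of_real 1 else 0)" for l m
    using ip[OF e(1)[of l] e(1)[of m]] by (cases "l = m") (simp_all add: e(2))
  from combination_le[where Y="\<lambda>l. J (e l)" and \<sigma>="\<lambda>_. 1" and q=q and x=x, OF this X] show ?thesis by simp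
qed

lemma image_combination: "finite X \<Longrightarrow> (nrm X (\<lambda>j. \<Sum>l<q. J (A (e l)) j * x l))\<^sup>2 \<le> (\<Sum>l<q. (s l)\<^sup>2 * (cmod (x l))\<^sup>2)"
proof (rule combination_le)
  fix l m
  \<comment> \<open>The inner product is known as a limit of coordinate sums, and its homogeneity is
    read off from these; with the adjoint it follows that the images are orthogonal, with squared
    norms \<open>(s l)\<^sup>2\<close>.\<close>
  have "(\<lambda>N. of_real ((s m)\<^sup>2) * (\<Sum>j\<in>B N. J (e l) j * cnj (J (e m) j))) \<longlonglongrightarrow> of_real ((s m)\<^sup>2) * ip (e l) (e m)"
    by (intro tendsto_intros ip e)
  moreover have "(\<lambda>N. of_real ((s m)\<^sup>2) * (\<Sum>j\<in>B N. J (e l) j * cnj (J (e m) j))) = (\<lambda>N. \<Sum>j\<in>B N. J (e l) j * cnj (J (A' (A (e m))) j))"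
    by (simp add: s sum_distrib_left mult_ac)
  ultimately have "ip (e l) (A' (A (e m))) = of_real ((s m)\<^sup>2) * ip (e l) (e m)"
    using LIMSEQ_unique ip[OF e(1)[of l] A'[OF A[OF e(1)[of m]]]] by metis
  then have "ip (A (e l)) (A (e m)) = (if l = m then complex_of_real ((s l)\<^sup>2) else 0)"
    by (subst adj[OF e(1) A[OF e(1)]]) (simp add: e(2))
  then show "(\<lambda>N. \<Sum>j\<in>B N. J (A (e l)) j * cnj (J (A (e m)) j)) \<longlonglongrightarrow> (if l = m then complex_of_real ((s l)\<^sup>2) else 0)"
    using ip[OF A[OF e(1)] A[OF e(1)], of l m] by simp
qed

text \<open>Taking the conjugate coordinates themselves as coefficients in
  \<open>orthonormal_combination\<close>, observed at the single index \<open>i\<close>, gives S^2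
  <= S.\<close>

lemma bessel_pointwise: "(\<Sum>l<q. (cmod (J (e l) i))\<^sup>2) \<le> 1"
proof -
  let ?S = "\<Sum>l<q. (cmod (J (e l) i))\<^sup>2"
  have "(\<Sum>l<q. J (e l) i * cnj (J (e l) i)) = of_real ?S"
    unfolding of_real_sum complex_norm_square ..
  moreover have "(cmod (\<Sum>l<q. J (e l) i * cnj (J (e l) i)))\<^sup>2 \<le> ?S"
    using orthonormal_combination[of "{i}" "\<lambda>l. cnj (J (e l) i)" q] by (simp add: nrm_sq)
  ultimately have sq: "?S\<^sup>2 \<le> ?S" by (simp only: norm_of_real power2_abs)
  show ?thesis
  proof (rule ccontr)
    assume "\<not> ?S \<le> 1"
    then have "?S * 1 < ?S * ?S" by (intro mult_strict_left_mono) linarith+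
    then show False using sq by (simp only: power2_eq_square mult_1_right)
  qed
qed

lemma summable_coordinates: "summable (\<lambda>l. (cmod (J (e l) i))\<^sup>2)"
proof (rule bounded_imp_summable)
  show "(\<Sum>k\<le>n. (cmod (J (e k) i))\<^sup>2) \<le> 1" for n
    using bessel_pointwise[of i "Suc n"] by (simp add: lessThan_Suc_atMost)
qed simp

text \<open>The remainder \<open>\<rho>\<close> of the expansion of \<open>t k\<close> is orthogonal to all \<open>e l\<close>, so \<open>A\<close> annihilates it. The
  adjoint replaces the continuity of \<open>A\<close>, which is not assumed.\<close>

lemma expansion:
  "(\<lambda>q. \<Sum>l<q. J (A (e l)) j * cnj (J (e l) k)) \<longlonglongrightarrow> J (A (t k)) j"
proof -
  \<comment> \<open>The coefficients of \<open>t k\<close> with respect to the system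
    \<open>e\<close>, since pairing \<open>t k\<close> with \<open>e l\<close> gives the conjugate
    of the k-th coordinate of \<open>e l\<close>.\<close>
  define c where "c l = cnj (J (e l) k)" for l
  define S where "S i = (\<Sum>l. c l * J (e l) i)" for i
  define tail where "tail p = (\<Sum>l. (cmod (c (l + p)))\<^sup>2)" for p
  have c2: "summable (\<lambda>l. (cmod (c l))\<^sup>2)" using summable_coordinates[of k] by (simp add: c_def)
  have tail0: "tail \<longlonglongrightarrow> 0" unfolding tail_def by (rule suminf_exist_split2[OF c2])
  have S: "summable (\<lambda>l. c l * J (e l) i)" for i
  proof (rule summable_comparison_test'[where N=0])
    show "summable (\<lambda>l. ((cmod (c l))\<^sup>2 + (cmod (J (e l) i))\<^sup>2) / 2)"
      by (intro summable_divide summable_add c2 summable_coordinates)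
    show "norm (c l * J (e l) i) \<le> ((cmod (c l))\<^sup>2 + (cmod (J (e l) i))\<^sup>2) / 2" for l
      using sum_squares_bound[of "cmod (c l)" "cmod (J (e l) i)"] by (simp add: norm_mult)
  qed
  have close: "(nrm X (\<lambda>i. S i - (\<Sum>l<p. c l * J (e l) i)))\<^sup>2 \<le> tail p" if X: "finite X" for X p
  proof -
    have "(\<lambda>q. \<Sum>i\<in>X. (cmod ((\<Sum>l<q + p. c l * J (e l) i) - (\<Sum>l<p. c l * J (e l) i)))\<^sup>2)
      \<longlonglongrightarrow> (\<Sum>i\<in>X. (cmod (S i - (\<Sum>l<p. c l * J (e l) i)))\<^sup>2)"
      unfolding S_def by (intro tendsto_intros LIMSEQ_ignore_initial_segment summable_LIMSEQ S)
    then have "(\<Sum>i\<in>X. (cmod (S i - (\<Sum>l<p. c l * J (e l) i)))\<^sup>2) \<le> tail p"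
    proof (rule LIMSEQ_le_const2, intro exI allI impI)
      fix q
      have eq: "(\<Sum>l<q + p. c l * J (e l) i) - (\<Sum>l<p. c l * J (e l) i) = (\<Sum>l<q + p. J (e l) i * (if l < p then 0 else c l))" for i
      proof -
        have "(\<Sum>l<q + p. J (e l) i * (if l < p then 0 else c l)) = (\<Sum>l\<in>{p..<q+p}. c l * J (e l) i)"
          by (intro sum.mono_neutral_cong_right) auto
        moreover have "(\<Sum>l<q + p. c l * J (e l) i) = (\<Sum>l<p. c l * J (e l) i) + (\<Sum>l\<in>{p..<q+p}. c l * J (e l) i)"
          unfolding lessThan_atLeast0 by (rule sum.atLeastLessThan_concat[symmetric]) auto
        ultimately show ?thesis by simp
      qed
      have "(\<Sum>i\<in>X. (cmod ((\<Sum>l<q + p. c l * J (e l) i) - (\<Sum>l<p. c l * J (e l) i)))\<^sup>2)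
        \<le> (\<Sum>l<q + p. (cmod (if l < p then 0 else c l))\<^sup>2)"
        unfolding eq using orthonormal_combination[OF X, of "\<lambda>l. if l < p then 0 else c l" "q + p"] by (simp only: nrm_sq)
      also have "\<dots> = (\<Sum>l\<in>{p..<q+p}. (cmod (c l))\<^sup>2)"
        by (intro sum.mono_neutral_cong_right) auto
      also have "\<dots> = (\<Sum>l<q. (cmod (c (l + p)))\<^sup>2)"
        by (rule sum.reindex_bij_witness[of _ "\<lambda>l. l + p" "\<lambda>l. l - p"]) auto
      also have "\<dots> \<le> tail p"
        unfolding tail_def by (rule sum_le_suminf[OF summable_ignore_initial_segment[OF c2]]) auto
      finally show "(\<Sum>i\<in>X. (cmod ((\<Sum>l<q + p. c l * J (e l) i) - (\<Sum>l<p. c l * J (e l) i)))\<^sup>2) \<le> tail p" .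
    qed
    then show ?thesis by (simp add: nrm_sq)
  qed
  have close': "nrm X (\<lambda>i. S i - (\<Sum>l<p. c l * J (e l) i)) \<le> sqrt (tail p)" if "finite X" for X p
    by (rule real_le_rsqrt[OF close[OF that]])
  \<comment> \<open>The coordinatewise remainder has bounded norms on all \<open>B N\<close>, so
    that \<open>full\<close> realises it by an element of \<open>H\<close>.\<close>
  obtain \<rho> where \<rho>: "\<rho> \<in> H" "J \<rho> = (\<lambda>i. kron i k - S i)"
  proof -
    have "nrm (B N) (\<lambda>i. kron i k - S i) \<le> 1 + sqrt (tail 0)" for N
    proof -
      have "nrm (B N) (\<lambda>i. kron i k + (- 1) * S i) \<le> nrm (B N) (\<lambda>i. kron i k) + nrm (B N) (\<lambda>i. (- 1) * S i)"
        by (rule nrm_add)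
      also have "nrm (B N) (\<lambda>i. (- 1) * S i) \<le> sqrt (tail 0)"
        using close'[OF fin[of N], of 0] nrm_scale[of "- 1" S "B N"] by simp
      also have "nrm (B N) (\<lambda>i. kron i k) \<le> 1"
      proof -
        have "(\<Sum>i\<in>B N. (cmod (kron i k))\<^sup>2) = (\<Sum>i\<in>B N. if i = k then 1 else 0)" by (intro sum.cong) auto
        then show ?thesis using fin[of N] by (simp add: L2_set_def)
      qed
      finally show ?thesis by simp
    qed
    from full[OF this] show ?thesis using that by blast
  qed
  \<comment> \<open>The series may be paired with any \<open>v\<close> term by term: the error on
    each \<open>B N\<close> is at most the tail of the coefficients times the norm of
    \<open>v\<close>, a bound which does not involve \<open>N\<close>.\<close>
  have key: "(\<lambda>p. \<Sum>l<p. c l * ip (e l) v) \<longlonglongrightarrow> cnj (J v k) - ip \<rho> v" if v: "v \<in> H" for v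
  proof -
    obtain b where b: "b \<ge> 0" "\<And>N. nrm (B N) (J v) \<le> b" using nrm_bounded[OF v] by blast
    have b2: "cmod ((\<Sum>l<p. c l * ip (e l) v) - (cnj (J v k) - ip \<rho> v)) \<le> sqrt (tail p) * b" for p
    proof -
      have le: "cmod (\<Sum>i\<in>B N. (S i - (\<Sum>l<p. c l * J (e l) i)) * cnj (J v i)) \<le> sqrt (tail p) * b" for N
      proof -
        have "cmod (\<Sum>i\<in>B N. (S i - (\<Sum>l<p. c l * J (e l) i)) * cnj (J v i)) \<le> nrm (B N) (J v) * nrm (B N) (\<lambda>i. S i - (\<Sum>l<p. c l * J (e l) i))"
          using nrm_inner[of "J v" "\<lambda>i. S i - (\<Sum>l<p. c l * J (e l) i)" "B N"] by (simp only: mult.commute)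
        also have "\<dots> \<le> b * sqrt (tail p)"
          by (intro mult_mono b close' fin) auto
        finally show ?thesis by (simp only: mult.commute)
      qed
      have "(\<lambda>N. (\<Sum>i\<in>B N. J (t k) i * cnj (J v i)) - (\<Sum>i\<in>B N. J \<rho> i * cnj (J v i)) - (\<Sum>l<p. c l * (\<Sum>i\<in>B N. J (e l) i * cnj (J v i))))
        \<longlonglongrightarrow> ip (t k) v - ip \<rho> v - (\<Sum>l<p. c l * ip (e l) v)"
        by (intro tendsto_intros ip v t \<rho> e)
      moreover have "(\<Sum>i\<in>B N. J (t k) i * cnj (J v i)) - (\<Sum>i\<in>B N. J \<rho> i * cnj (J v i)) - (\<Sum>l<p. c l * (\<Sum>i\<in>B N. J (e l) i * cnj (J v i)))
        = (\<Sum>i\<in>B N. (S i - (\<Sum>l<p. c l * J (e l) i)) * cnj (J v i))" for N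
      proof -
        have "(\<Sum>l<p. c l * (\<Sum>i\<in>B N. J (e l) i * cnj (J v i))) = (\<Sum>i\<in>B N. (\<Sum>l<p. c l * J (e l) i) * cnj (J v i))"
          unfolding sum_distrib_left sum_distrib_right mult.assoc by (rule sum.swap)
        then show ?thesis unfolding t(2) \<rho>(2) by (simp only: left_diff_distrib sum_subtractf)  simp
      qed
      ultimately have "(\<lambda>N. \<Sum>i\<in>B N. (S i - (\<Sum>l<p. c l * J (e l) i)) * cnj (J v i)) \<longlonglongrightarrow> ip (t k) v - ip \<rho> v - (\<Sum>l<p. c l * ip (e l) v)"
        by (simp only:)
      from tendsto_norm[OF this] have "cmod (ip (t k) v - ip \<rho> v - (\<Sum>l<p. c l * ip (e l) v)) \<le> sqrt (tail p) * b"
        by (rule LIMSEQ_le_const2) (use le in blast)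
      then show ?thesis unfolding ip_kron_left[OF v t] by (simp only: norm_minus_commute)
    qed
    have b3: "(\<lambda>p. sqrt (tail p) * b) \<longlonglongrightarrow> 0"
    proof -
      have "(\<lambda>p. sqrt (tail p) * b) \<longlonglongrightarrow> sqrt 0 * b" by (intro tendsto_intros tail0)
      then show ?thesis by simp
    qed
    have "(\<lambda>p. (\<Sum>l<p. c l * ip (e l) v) - (cnj (J v k) - ip \<rho> v)) \<longlonglongrightarrow> 0"
      by (rule Lim_null_comparison[OF always_eventually[OF allI[OF b2]] b3])
    then show ?thesis by (rule LIM_zero_cancel)
  qed
  have orth: "ip \<rho> (e m) = 0" for m
  proof -
    have "eventually (\<lambda>p. (\<Sum>l<p. c l * ip (e l) (e m)) = c m) sequentially"
      using eventually_gt_at_top[of m]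
    proof eventually_elim
      case (elim p)
      have "(\<Sum>l<p. c l * ip (e l) (e m)) = (\<Sum>l<p. c l * kron l m)" by (simp only: e(2))
      then show ?case using sum_kron_right[of "{..<p}" m c] elim by simp
    qed
    then have "(\<lambda>p. \<Sum>l<p. c l * ip (e l) (e m)) \<longlonglongrightarrow> c m" by (rule tendsto_eventually)
    from LIMSEQ_unique[OF this key[OF e(1)]] show ?thesis by (simp add: c_def)
  qed
  have A\<rho>: "J (A \<rho>) i = 0" for i
  proof -
    have "(\<lambda>N. \<Sum>i\<in>B N. J \<rho> i * cnj (J (A' (A \<rho>)) i)) \<longlonglongrightarrow> ip \<rho> (A' (A \<rho>))"
      by (intro ip \<rho> A' A)
    then have "ip \<rho> (A' (A \<rho>)) = 0" using ker[OF \<rho>(1) orth] by (simp add: LIMSEQ_const_iff)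
    then have "ip (A \<rho>) (A \<rho>) = 0" using adj[OF \<rho>(1) A[OF \<rho>(1)]] by simp
    then have "(\<lambda>N. \<Sum>i\<in>B N. J (A \<rho>) i * cnj (J (A \<rho>) i)) \<longlonglongrightarrow> complex_of_real 0"
      using ip[OF A[OF \<rho>(1)] A[OF \<rho>(1)]] by simp
    moreover have "(\<lambda>N. \<Sum>i\<in>B N. J (A \<rho>) i * cnj (J (A \<rho>) i)) = (\<lambda>N. complex_of_real (\<Sum>i\<in>B N. (cmod (J (A \<rho>) i))\<^sup>2))"
      unfolding of_real_sum complex_norm_square ..
    ultimately have lim: "(\<lambda>N. \<Sum>i\<in>B N. (cmod (J (A \<rho>) i))\<^sup>2) \<longlonglongrightarrow> 0"
      by (simp only: tendsto_of_real_iff)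
    have "(cmod (J (A \<rho>) i))\<^sup>2 \<le> 0"
    proof (rule tendsto_lowerbound[OF lim])
      show "eventually (\<lambda>N. (cmod (J (A \<rho>) i))\<^sup>2 \<le> (\<Sum>i\<in>B N. (cmod (J (A \<rho>) i))\<^sup>2)) sequentially"
        using ev_mem[of i] by eventually_elim (rule member_le_sum, auto simp: fin)
    qed simp
    then show ?thesis by simp
  qed
  \<comment> \<open>For this choice of v, the adjoint turns the pairing with \<open>e l\<close> into
    the j-th coordinate of \<open>A (e l)\<close>, and the remainder contributes the j-th coordinate
    of \<open>A \<rho>\<close>, which is 0.\<close>
  have "(\<lambda>p. \<Sum>l<p. c l * ip (e l) (A' (t j))) \<longlonglongrightarrow> cnj (J (A' (t j)) k) - ip \<rho> (A' (t j))"
    by (rule key[OF A'[OF t(1)]])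
  moreover have "ip \<rho> (A' (t j)) = 0"
    using adj[OF \<rho>(1) t(1)[of j]] ip_kron_right[OF A[OF \<rho>(1)] t] A\<rho> by simp
  moreover have "cnj (J (A' (t j)) k) = J (A (t k)) j"
    using ip_kron_left[OF A'[OF t(1)[of j]] t, of k] adj[OF t(1) t(1), of k j] ip_kron_right[OF A[OF t(1)[of k]] t] by simp
  moreover have "ip (e l) (A' (t j)) = J (A (e l)) j" for l
    using adj[OF e(1) t(1), of l j] ip_kron_right[OF A[OF e(1)[of l]] t] by simp
  ultimately show ?thesis by (simp add: c_def mult.commute)
qed

end

end

subsection \<open>Square-integrable functions on the circle\<close>

text \<open>The bridge between the Lebesgue integrals over the half-open circle in the definitions
  and the gauge integrals used for Fourier series.\<close>

lemma set_integrable_01: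
  fixes f :: "real \<Rightarrow> 'a::euclidean_space"
  assumes "continuous_on {0..1} f"
  shows "set_integrable lborel {0..<1} f" "(LINT x:{0..<1}|lborel. f x) = integral {0..1} f"
proof -
  have "set_integrable lborel {0..1} f" by (rule borel_integrable_atLeastAtMost'[OF assms])
  then show 1: "set_integrable lborel {0..<1} f" by (rule set_integrable_subset) auto
  have "(LINT x:{0..<1}|lborel. f x) = integral {0..<1} f"
    by (rule set_borel_integral_eq_integral(2)[OF 1])
  also have "\<dots> = integral {0..1} f"
  proof (rule integral_spike_set)
    have "{x \<in> {0..1} - {0..<1}. f x \<noteq> 0} \<subseteq> {1}" by auto
    then show "negligible {x \<in> {0..1} - {0..<1}. f x \<noteq> 0}" by (rule negligible_subset[rotated]) simp
    have e: "{x \<in> {0..<1} - {0..1}. f x \<noteq> 0} = {}" by auto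
    show "negligible {x \<in> {0..<1} - {0..1}. f x \<noteq> 0}" unfolding e by (rule negligible_empty)
  qed
  finally show "(LINT x:{0..<1}|lborel. f x) = integral {0..1} f" .
qed

lemma L2_I:
  assumes "continuous_on UNIV f" "periodic1 f"
  shows "f \<in> L2"
proof -
  have "continuous_on {0..1} (\<lambda>x. (cmod (f x))\<^sup>2)"
    by (intro continuous_intros continuous_on_subset[OF assms(1)]) auto
  then show ?thesis
    using assms set_integrable_01(1) by (auto simp: L2_def borel_measurable_continuous_onI)
qed

abbreviation hat :: "(real \<Rightarrow> complex) \<Rightarrow> int \<Rightarrow> complex" where
  "hat u j \<equiv> L2_inner u (fourier_e j)"

lemma hat_continuous:
  assumes "continuous_on UNIV f" shows "hat f j = fc f j"
  unfolding L2_inner_def fc_def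
  by (rule set_integrable_01(2)) (intro continuous_intros continuous_on_subset[OF assms], auto)

lemma L2_integrable:
  assumes "u \<in> L2"
  shows "set_integrable lborel {0..<1} (\<lambda>x. u x * cnj (fourier_e j x))"
proof -
  have [measurable]: "u \<in> borel_measurable borel" using assms by (simp add: L2_def)
  have [measurable]: "(\<lambda>x. cnj (fourier_e j x)) \<in> borel_measurable borel"
    by (intro borel_measurable_continuous_onI fourier_e_cont)
  have "set_integrable lborel {0..<1} (\<lambda>x. 1 + (cmod (u x))\<^sup>2)"
    using assms set_integrable_01(1)[of "\<lambda>_. 1::real"] by (intro set_integral_add) (auto simp: L2_def)
  then show ?thesis
    unfolding set_integrable_def
  proof (rule Bochner_Integration.integrable_bound)
    show "(\<lambda>x. indicator {0..<1} x *\<^sub>R (u x * cnj (fourier_e j x))) \<in> borel_measurable lborel"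
      by measurable
    have "cmod (u x) \<le> 1 + (cmod (u x))\<^sup>2" for x
    proof -
      have "0 \<le> (cmod (u x) - 1)\<^sup>2" by simp
      then have "2 * cmod (u x) \<le> 1 + (cmod (u x))\<^sup>2" by (simp add: power2_diff)
      then show ?thesis using norm_ge_zero[of "u x"] by linarith
    qed
    then show "AE x in lborel. norm (indicator {0..<1} x *\<^sub>R (u x * cnj (fourier_e j x)))
      \<le> norm (indicator {0..<1} x *\<^sub>R (1 + (cmod (u x))\<^sup>2))"
      by (intro always_eventually) (auto simp: norm_mult indicator_def abs_of_nonneg)
  qed
qed

lemma hat_diff: "u \<in> L2 \<Longrightarrow> v \<in> L2 \<Longrightarrow> hat (\<lambda>x. u x - v x) j = hat u j - hat v j"
  unfolding L2_inner_def left_diff_distrib by (intro set_integral_diff L2_integrable)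

text \<open>Converts equations almost everywhere into exact ones for coordinates. The scalar allows
  for eigenvector equations and, when it is 0, for functions that vanish almost everywhere.\<close>

lemma hat_AE:
  assumes "u \<in> L2" "v \<in> L2" "AE x in lborel. u x = c * v x"
  shows "hat u j = c * hat v j"
proof -
  have [measurable]: "u \<in> borel_measurable borel" "v \<in> borel_measurable borel" using assms by (simp_all add: L2_def)
  have [measurable]: "(\<lambda>x. cnj (fourier_e j x)) \<in> borel_measurable borel"
    by (intro borel_measurable_continuous_onI fourier_e_cont)
  have "hat u j = (LINT x:{0..<1}|lborel. c * (v x * cnj (fourier_e j x)))"
    unfolding L2_inner_def set_lebesgue_integral_def
  proof (rule integral_cong_AE)
    show "AE x in lborel. indicator {0..<1} x *\<^sub>R (u x * cnj (fourier_e j x)) = indicator {0..<1} x *\<^sub>R (c * (v x * cnj (fourier_e j x)))"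
      using assms(3) by eventually_elim simp
  qed measurable
  then show ?thesis by (simp add: L2_inner_def)
qed

lemma proj_trig:
  shows "continuous_on A (proj \<theta> m u)" "periodic1 (proj \<theta> m u)"
  unfolding proj_def[abs_def] by (auto intro!: continuous_intros simp: periodic1_def fourier_e_periodic)

lemma L2_norm_proj:
  assumes "finite (freq_block \<theta> m)"
  shows "(L2_norm (proj \<theta> m u))\<^sup>2 = (\<Sum>k\<in>freq_block \<theta> m. (cmod (hat u k))\<^sup>2)"
proof -
  have "(LINT x:{0..<1}|lborel. (cmod (proj \<theta> m u x))\<^sup>2) = integral {0..1} (\<lambda>x. (cmod (proj \<theta> m u x))\<^sup>2)"
    by (intro set_integrable_01(2) continuous_intros proj_trig)
  also have "\<dots> = (\<Sum>k\<in>freq_block \<theta> m. (cmod (hat u k))\<^sup>2)"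
    unfolding proj_def by (rule parseval_trig[OF assms])
  finally show ?thesis by (simp add: L2_norm_def sum_nonneg)
qed

lemma fc_trig:
  assumes "finite B"
  shows "fc (\<lambda>x. \<Sum>k\<in>B. c k * fourier_e k x) j = (if j \<in> B then c j else 0)"
proof -
  have "fc (\<lambda>x. \<Sum>k\<in>B. c k * fourier_e k x) j = integral {0..1} (\<lambda>x. \<Sum>k\<in>B. c k * (fourier_e k x * cnj (fourier_e j x)))"
    unfolding fc_def by (intro integral_cong) (simp add: sum_distrib_right mult.assoc)
  also have "\<dots> = (\<Sum>k\<in>B. c k * fc (fourier_e k) j)"
    unfolding fc_def by (subst integral_sum) (auto simp: assms intro!: integrable_continuous_interval continuous_intros)
  also have "\<dots> = (\<Sum>k\<in>B. c k * kron k j)" by (simp only: fc_fourier_e)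
  also have "\<dots> = (if j \<in> B then c j else 0)"
  proof (cases "j \<in> B")
    case True
    then show ?thesis using sum_kron_right[OF assms True, of c] by simp
  next
    case False
    then have "(\<Sum>k\<in>B. c k * kron k j) = 0" by (intro sum.neutral) auto
    then show ?thesis using False by simp
  qed
  finally show ?thesis .
qed

lemma L2_inner_proj:
  assumes "finite (freq_block \<theta> m)"
  shows "L2_inner (proj \<theta> m u) (proj \<theta> m v) = (\<Sum>k\<in>freq_block \<theta> m. hat u k * cnj (hat v k))"
proof -
  let ?B = "freq_block \<theta> m"
  have "L2_inner (proj \<theta> m u) (proj \<theta> m v) = integral {0..1} (\<lambda>x. proj \<theta> m u x * cnj (proj \<theta> m v x))"
    unfolding L2_inner_def by (intro set_integrable_01(2) continuous_intros proj_trig)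
  also have "\<dots> = integral {0..1} (\<lambda>x. \<Sum>k\<in>?B. cnj (hat v k) * (proj \<theta> m u x * cnj (fourier_e k x)))"
    unfolding proj_def[of \<theta> m v] by (intro integral_cong) (simp add: sum_distrib_left mult_ac)
  also have "\<dots> = (\<Sum>k\<in>?B. cnj (hat v k) * fc (proj \<theta> m u) k)"
    unfolding fc_def by (subst integral_sum) (auto simp: assms intro!: integrable_continuous_interval continuous_intros proj_trig)
  also have "\<dots> = (\<Sum>k\<in>?B. hat u k * cnj (hat v k))"
    unfolding proj_def[abs_def] fc_trig[OF assms] by (intro sum.cong refl) (simp add: mult.commute)
  finally show ?thesis .
qed

subsection \<open>The weighted space\<close>

locale weighted_space =
  fixes M :: "nat \<Rightarrow> real" and lam \<theta> R :: real
  assumes W: "weight_sequence M" and lam: "lam > 1" and \<theta>: "\<theta> > 1" and R: "R > 0"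
begin

definition lev :: "int \<Rightarrow> nat" where "lev k = (LEAST n. \<bar>real_of_int k\<bar> < \<theta> ^ n)"

definition Bs :: "nat \<Rightarrow> int set" where "Bs N = {k. lev k \<le> N}"

definition wv :: "nat \<Rightarrow> real" where "wv m = wfun M (R / \<theta> powi (int m - 1))"

text \<open>The square root of the weight of the block of \<open>j\<close> (see
  \<open>H_weight_eq\<close>). Multiplying Fourier coefficients by it turns \<open>H_inner\<close>
  into the plain inner product of the coordinates \<open>J\<close>.\<close>

definition hw :: "int \<Rightarrow> real" where "hw j = inverse (lam ^ lev j * wv (lev j))"

definition J :: "(real \<Rightarrow> complex) \<Rightarrow> int \<Rightarrow> complex" where "J u j = of_real (hw j) * hat u j"

lemma lev_le: "lev k \<le> N \<longleftrightarrow> \<bar>real_of_int k\<bar> < \<theta> ^ N"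
proof
  obtain n where n: "\<bar>real_of_int k\<bar> < \<theta> ^ n" using real_arch_pow[OF \<theta>] by blast
  then have l: "\<bar>real_of_int k\<bar> < \<theta> ^ lev k" unfolding lev_def by (rule LeastI)
  assume "lev k \<le> N"
  then have "\<theta> ^ lev k \<le> \<theta> ^ N" using \<theta> by (intro power_increasing) auto
  then show "\<bar>real_of_int k\<bar> < \<theta> ^ N" using l by linarith
next
  assume "\<bar>real_of_int k\<bar> < \<theta> ^ N"
  then show "lev k \<le> N" unfolding lev_def by (rule Least_le)
qed

lemma freq_block_eq: "freq_block \<theta> n = {k. lev k = n}"
proof (cases n)
  case 0
  have "lev k = 0 \<longleftrightarrow> k = 0" for k using lev_le[of k 0] by auto
  then show ?thesis using 0 by (auto simp: freq_block_def)
next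
  case (Suc m)
  have e: "lev k = Suc m \<longleftrightarrow> \<not> lev k \<le> m \<and> lev k \<le> Suc m" for k by auto
  have "freq_block \<theta> (Suc m) = {k. \<theta> ^ m \<le> \<bar>real_of_int k\<bar> \<and> \<bar>real_of_int k\<bar> < \<theta> ^ Suc m}"
    unfolding freq_block_def by (simp del: power_Suc)
  then show ?thesis unfolding Suc e lev_le not_less .
qed

text \<open>The largest integer strictly below \<theta>^N. The strict inequality in the definition
  of the blocks is the reason for a ceiling minus 1 in place of a floor.\<close>

definition \<kappa> :: "nat \<Rightarrow> nat" where "\<kappa> N = nat (\<lceil>\<theta> ^ N\<rceil> - 1)"

lemma \<kappa>: "int (\<kappa> N) = \<lceil>\<theta> ^ N\<rceil> - 1"
proof -
  have "1 \<le> \<theta> ^ N" using \<theta> by simp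
  then have "\<lceil>\<theta> ^ N\<rceil> \<ge> 1" by linarith
  then show ?thesis by (simp add: \<kappa>_def)
qed

lemma Bs_eq: "Bs N = {- int (\<kappa> N)..int (\<kappa> N)}"
proof -
  have "\<bar>real_of_int k\<bar> < \<theta> ^ N \<longleftrightarrow> \<bar>k\<bar> \<le> \<lceil>\<theta> ^ N\<rceil> - 1" for k
    unfolding of_int_abs[symmetric] less_ceiling_iff[symmetric] by (rule zle_diff1_eq[symmetric])
  then have "Bs N = {k. \<bar>k\<bar> \<le> \<lceil>\<theta> ^ N\<rceil> - 1}" unfolding Bs_def lev_le by (simp only:)
  moreover have "{k. \<bar>k\<bar> \<le> c} = {- c..c}" for c :: int by auto
  ultimately show ?thesis unfolding \<kappa> by (simp only:)
qed

lemma finite_Bs: "finite (Bs N)" by (simp add: Bs_eq)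

lemma finite_block: "finite {k. lev k = n}"
  by (rule finite_subset[OF _ finite_Bs[of n]]) (auto simp: Bs_def)

lemma card_Bs: "real (card (Bs N)) \<le> 3 * \<theta> ^ N"
proof -
  have "real (card (Bs N)) = 2 * of_int (int (\<kappa> N)) + 1" by (simp add: Bs_eq)
  also have "\<dots> \<le> 2 * \<theta> ^ N + 1" unfolding \<kappa> using ceiling_correct[of "\<theta> ^ N"] by simp
  also have "\<dots> \<le> 3 * \<theta> ^ N" using \<theta> by simp
  finally show ?thesis .
qed

lemma filterlim_\<kappa>: "filterlim \<kappa> at_top sequentially"
proof -
  have "eventually (\<lambda>N. n \<le> \<kappa> N) sequentially" for n
  proof (rule eventually_sequentiallyI)
    fix N assume "lev (int n) \<le> N"
    then have "int n \<in> Bs N" by (simp add: Bs_def)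
    then show "n \<le> \<kappa> N" by (simp add: Bs_eq)
  qed
  then show ?thesis by (simp add: filterlim_at_top)
qed

lemma incseq_Bs: "incseq Bs" by (auto simp: incseq_def Bs_def)

lemma mem_Bs: "i \<in> Bs (lev i)" by (simp add: Bs_def)

lemma wv_pos: "wv m > 0" unfolding wv_def using wfun_pos[OF W] R \<theta> by simp

lemma hw_pos: "hw j > 0" unfolding hw_def using lam wv_pos by simp

lemma H_weight_eq: "H_weight M lam \<theta> R (lev j) = (hw j)\<^sup>2"
  unfolding H_weight_def hw_def wv_def using lam
  by (simp add: power_int_minus power_int_mult power_mult power_mult_distrib power_inverse flip: power_mult)

text \<open>A telescoping product: \<open>g_fun\<close> at each level bounds the quotient of two
  consecutive weights.\<close>

lemma wv_ratio: "m \<le> n \<Longrightarrow> wv n / wv m \<le> (\<Prod>i\<in>{m..<n}. g_fun M \<theta> R i)"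
proof (induction n rule: dec_induct)
  case base
  then show ?case using wv_pos[of m] by simp
next
  case (step n)
  have "wv (Suc n) / wv n \<le> g_fun M \<theta> R n"
    using wfun_ratio_le_g[OF W \<theta> R, of n] by (simp add: wv_def)
  then have "(wv n / wv m) * (wv (Suc n) / wv n) \<le> (\<Prod>i\<in>{m..<n}. g_fun M \<theta> R i) * g_fun M \<theta> R n"
    using step.IH wv_pos[of n] wv_pos[of m] wv_pos[of "Suc n"] less_imp_le[OF g_fun_pos[OF W \<theta> R]]
    by (intro mult_mono) (auto intro!: prod_nonneg)
  then show ?case using step wv_pos[of n] by (simp add: prod.atLeastLessThan_Suc)
qed

lemma hw_ratio:
  assumes "lev j < lev k"
  shows "hw j / hw k \<le> lam ^ (lev k - lev j) * (\<Prod>i\<in>{lev j..<lev k}. g_fun M \<theta> R i)"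
proof -
  have "hw j / hw k = (lam ^ lev k / lam ^ lev j) * (wv (lev k) / wv (lev j))"
    unfolding hw_def by (simp add: field_simps)
  also have "lam ^ lev k / lam ^ lev j = lam ^ (lev k - lev j)"
    using lam assms by (simp add: power_diff)
  also have "lam ^ (lev k - lev j) * (wv (lev k) / wv (lev j)) \<le> lam ^ (lev k - lev j) * (\<Prod>i\<in>{lev j..<lev k}. g_fun M \<theta> R i)"
    using wv_ratio[of "lev j" "lev k"] assms lam by (intro mult_left_mono) auto
  finally show ?thesis .
qed

text \<open>Fix the index q in the infimum so large that \<theta>^q exceeds 2 r; the q-th term then
  decays like \<theta> to the power -q m.\<close>

lemma wfun_superpolynomial:
  assumes "c > 0" "r > 0"
  shows "\<exists>b\<ge>0. \<forall>m. r ^ m * wfun M (c / \<theta> ^ m) \<le> b * (1/2) ^ m"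
proof -
  obtain q where q: "2 * r < \<theta> ^ q" using real_arch_pow[OF \<theta>] by blast
  let ?b = "c ^ q * fact q * M q"
  have b: "?b \<ge> 0" using assms weight_sequence_ge_1[OF W, of q] by simp
  have "r ^ m * wfun M (c / \<theta> ^ m) \<le> ?b * (1/2) ^ m" for m
  proof -
    have "r ^ m * wfun M (c / \<theta> ^ m) \<le> r ^ m * ((c / \<theta> ^ m) ^ q * fact q * M q)"
      using assms \<theta> by (intro mult_left_mono wfun_le[OF W]) auto
    also have "\<dots> = ?b * (r / \<theta> ^ q) ^ m"
      using \<theta> by (simp add: power_divide field_simps flip: power_mult)
    also have "\<dots> \<le> ?b * (1/2) ^ m"
      using q assms \<theta> by (intro mult_left_mono power_mono b) (auto simp: field_simps)
    finally show ?thesis .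
  qed
  then show ?thesis using b by blast
qed

lemma sum_Bs_blocks: "(\<Sum>j\<in>Bs N. f j) = (\<Sum>m\<le>N. \<Sum>j\<in>{k. lev k = m}. f j)"
proof -
  have "(\<Sum>j\<in>Bs N. f j) = (\<Sum>m\<le>N. \<Sum>j\<in>{j\<in>Bs N. lev j = m}. f j)"
    by (rule sum_levels) (auto simp: finite_Bs, simp add: Bs_def)
  also have "\<dots> = (\<Sum>m\<le>N. \<Sum>j\<in>{k. lev k = m}. f j)"
    by (intro sum.cong refl) (auto simp: Bs_def)
  finally show ?thesis .
qed

lemma H_partial:
  "(\<Sum>m\<le>N. H_weight M lam \<theta> R m * (L2_norm (proj \<theta> m u))\<^sup>2) = (nrm (Bs N) (J u))\<^sup>2"
  "(\<Sum>m\<le>N. of_real (H_weight M lam \<theta> R m) * L2_inner (proj \<theta> m u) (proj \<theta> m v)) = (\<Sum>j\<in>Bs N. J u j * cnj (J v j))"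
proof -
  have b: "freq_block \<theta> m = {k. lev k = m}" "finite (freq_block \<theta> m)" for m
    using freq_block_eq finite_block by auto
  show "(\<Sum>m\<le>N. H_weight M lam \<theta> R m * (L2_norm (proj \<theta> m u))\<^sup>2) = (nrm (Bs N) (J u))\<^sup>2"
    unfolding nrm_sq sum_Bs_blocks L2_norm_proj[OF b(2)] sum_distrib_left
    by (intro sum.cong refl) (auto simp: b J_def norm_mult power_mult_distrib H_weight_eq)
  show "(\<Sum>m\<le>N. of_real (H_weight M lam \<theta> R m) * L2_inner (proj \<theta> m u) (proj \<theta> m v)) = (\<Sum>j\<in>Bs N. J u j * cnj (J v j))"
    unfolding sum_Bs_blocks L2_inner_proj[OF b(2)] sum_distrib_left
    by (intro sum.cong refl) (auto simp: b J_def H_weight_eq power2_eq_square)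
qed

lemma H_weight_nonneg: "H_weight M lam \<theta> R m \<ge> 0"
  unfolding H_weight_def using lam wfun_pos[OF W] R \<theta> by (intro mult_nonneg_nonneg zero_le_power_int) (auto simp: less_imp_le)

lemma H_space_iff:
  "u \<in> H_space M lam \<theta> R \<longleftrightarrow> u \<in> L2 \<and> (\<exists>b. \<forall>N. nrm (Bs N) (J u) \<le> b)"
proof -
  let ?t = "\<lambda>m. H_weight M lam \<theta> R m * (L2_norm (proj \<theta> m u))\<^sup>2"
  have "summable ?t \<longleftrightarrow> (\<exists>b. \<forall>N. nrm (Bs N) (J u) \<le> b)"
  proof
    assume s: "summable ?t"
    have "nrm (Bs N) (J u) \<le> sqrt (suminf ?t)" for N
    proof (rule real_le_rsqrt)
      show "(nrm (Bs N) (J u))\<^sup>2 \<le> suminf ?t"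
        unfolding H_partial[symmetric] using H_weight_nonneg by (intro sum_le_suminf s) auto
    qed
    then show "\<exists>b. \<forall>N. nrm (Bs N) (J u) \<le> b" by blast
  next
    assume "\<exists>b. \<forall>N. nrm (Bs N) (J u) \<le> b"
    then obtain b where b: "\<And>N. nrm (Bs N) (J u) \<le> b" by blast
    show "summable ?t"
    proof (rule bounded_imp_summable)
      show "0 \<le> ?t m" for m using H_weight_nonneg by simp
      show "(\<Sum>m\<le>N. ?t m) \<le> b\<^sup>2" for N
        unfolding H_partial by (rule power_mono[OF b]) simp
    qed
  qed
  then show ?thesis by (simp add: H_space_def)
qed

lemma H_inner_tendsto:
  assumes "u \<in> H_space M lam \<theta> R" "v \<in> H_space M lam \<theta> R"
  shows "(\<lambda>N. \<Sum>j\<in>Bs N. J u j * cnj (J v j)) \<longlonglongrightarrow> H_inner M lam \<theta> R u v"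
proof -
  let ?t = "\<lambda>u m. H_weight M lam \<theta> R m * (L2_norm (proj \<theta> m u))\<^sup>2"
  have fin: "finite (freq_block \<theta> m)" for m using freq_block_eq finite_block by auto
  have "summable (\<lambda>m. complex_of_real (H_weight M lam \<theta> R m) * L2_inner (proj \<theta> m u) (proj \<theta> m v))"
  proof (rule summable_comparison_test'[where N=0])
    show "summable (\<lambda>m. (?t u m + ?t v m) / 2)"
      using assms by (intro summable_divide summable_add) (auto simp: H_space_def)
    fix m
    have "cmod (L2_inner (proj \<theta> m u) (proj \<theta> m v)) \<le> (\<Sum>k\<in>freq_block \<theta> m. ((cmod (hat u k))\<^sup>2 + (cmod (hat v k))\<^sup>2) / 2)"
      unfolding L2_inner_proj[OF fin]
    proof (rule order_trans[OF norm_sum sum_mono])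
      fix k
      show "cmod (hat u k * cnj (hat v k)) \<le> ((cmod (hat u k))\<^sup>2 + (cmod (hat v k))\<^sup>2) / 2"
        using sum_squares_bound[of "cmod (hat u k)" "cmod (hat v k)"] by (simp add: norm_mult)
    qed
    also have "\<dots> = ((L2_norm (proj \<theta> m u))\<^sup>2 + (L2_norm (proj \<theta> m v))\<^sup>2) / 2"
      unfolding L2_norm_proj[OF fin] by (simp add: sum.distrib sum_divide_distrib[symmetric])
    finally have "H_weight M lam \<theta> R m * cmod (L2_inner (proj \<theta> m u) (proj \<theta> m v))
      \<le> H_weight M lam \<theta> R m * (((L2_norm (proj \<theta> m u))\<^sup>2 + (L2_norm (proj \<theta> m v))\<^sup>2) / 2)"
      by (rule mult_left_mono[OF _ H_weight_nonneg])
    then show "norm (complex_of_real (H_weight M lam \<theta> R m) * L2_inner (proj \<theta> m u) (proj \<theta> m v)) \<le> (?t u m + ?t v m) / 2"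
      using H_weight_nonneg[of m] by (simp add: norm_mult distrib_left)
  qed
  from summable_LIMSEQ'[OF this] show ?thesis unfolding H_partial H_inner_def .
qed

text \<open>Block m has at most 3 \<theta>^m frequencies, each contributing the square of
  \<open>lam ^ m * wv m\<close>. One factor \<open>wv m\<close> beats the whole exponential growth,
  the other is at most \<open>wv 0\<close>.\<close>

lemma inverse_weights_bounded: "\<exists>b. \<forall>N. (\<Sum>j\<in>Bs N. (inverse (hw j))\<^sup>2) \<le> b"
proof -
  have "lam\<^sup>2 * \<theta> > 0" using lam \<theta> by simp
  then obtain b where b: "b \<ge> 0" "\<And>m. (lam\<^sup>2 * \<theta>) ^ m * wfun M (R * \<theta> / \<theta> ^ m) \<le> b * (1/2) ^ m"
    using wfun_superpolynomial[of "R * \<theta>" "lam\<^sup>2 * \<theta>"] R \<theta> by auto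
  have wv: "wv m = wfun M (R * \<theta> / \<theta> ^ m)" for m
    using \<theta> by (simp add: wv_def power_int_diff)
  have wv0: "wv m \<le> wv 0" for m unfolding wv
    using R \<theta> by (intro wfun_mono[OF W]) (auto simp: divide_le_eq)
  have blk: "(\<Sum>j\<in>{k. lev k = m}. (inverse (hw j))\<^sup>2) \<le> 3 * b * wv 0 * (1/2) ^ m" for m
  proof -
    have "(\<Sum>j\<in>{k. lev k = m}. (inverse (hw j))\<^sup>2) = real (card {k. lev k = m}) * (lam ^ m * wv m)\<^sup>2"
      by (simp add: hw_def)
    also have "\<dots> \<le> (3 * \<theta> ^ m) * (lam ^ m * wv m)\<^sup>2"
    proof (rule mult_right_mono)
      have "card {k. lev k = m} \<le> card (Bs m)" by (intro card_mono finite_Bs) (auto simp: Bs_def)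
      then show "real (card {k. lev k = m}) \<le> 3 * \<theta> ^ m" using card_Bs[of m] by linarith
    qed simp
    also have "\<dots> = 3 * (((lam\<^sup>2 * \<theta>) ^ m * wv m) * wv m)"
      by (simp add: power_mult_distrib power2_eq_square mult_ac)
    also have "\<dots> \<le> 3 * ((b * (1/2) ^ m) * wv 0)"
    proof (rule mult_left_mono)
      show "((lam\<^sup>2 * \<theta>) ^ m * wv m) * wv m \<le> (b * (1/2) ^ m) * wv 0"
        using b(2)[of m] b(1) less_imp_le[OF wv_pos[of m]] wv0[of m]
        by - (rule mult_mono; simp add: wv)
    qed simp
    finally show ?thesis by (simp add: mult_ac)
  qed
  have "(\<Sum>j\<in>Bs N. (inverse (hw j))\<^sup>2) \<le> 3 * b * wv 0 * 2" for N
  proof -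
    have "(\<Sum>j\<in>Bs N. (inverse (hw j))\<^sup>2) \<le> (\<Sum>m\<le>N. 3 * b * wv 0 * (1/2) ^ m)"
      unfolding sum_Bs_blocks by (intro sum_mono blk)
    also have "\<dots> = 3 * b * wv 0 * (\<Sum>m\<le>N. (1/2) ^ m)" by (simp add: sum_distrib_left)
    also have "\<dots> \<le> 3 * b * wv 0 * 2"
    proof (rule mult_left_mono)
      have "(\<Sum>m\<le>N. (1/2::real) ^ m) \<le> (\<Sum>m. (1/2) ^ m)" by (rule sum_le_suminf) auto
      then show "(\<Sum>m\<le>N. (1/2::real) ^ m) \<le> 2" by (simp add: suminf_geometric)
    qed (use b wv_pos[of 0] in simp)
    finally show ?thesis .
  qed
  then show ?thesis by blast
qed

text \<open>The weights grow so fast that the Fourier series of an element converges absolutely, so no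
  completeness of \<open>L\<^sup>2\<close> is needed.\<close>

lemma realize_coordinates:
  assumes x: "\<And>N. nrm (Bs N) x \<le> b"
  shows "\<exists>u\<in>H_space M lam \<theta> R. J u = x"
proof -
  define c where "c j = x j * of_real (inverse (hw j))" for j
  obtain b' where b': "\<And>N. (\<Sum>j\<in>Bs N. (inverse (hw j))\<^sup>2) \<le> b'" using inverse_weights_bounded by blast
  have "(\<Sum>j\<in>Bs N. cmod (c j)) \<le> (b\<^sup>2 + b') / 2" for N
  proof -
    have "(\<Sum>j\<in>Bs N. cmod (c j)) \<le> (\<Sum>j\<in>Bs N. ((cmod (x j))\<^sup>2 + (inverse (hw j))\<^sup>2) / 2)"
    proof (rule sum_mono)
      fix j
      show "cmod (c j) \<le> ((cmod (x j))\<^sup>2 + (inverse (hw j))\<^sup>2) / 2"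
        using sum_squares_bound[of "cmod (x j)" "inverse (hw j)"] hw_pos[of j] by (simp add: c_def norm_mult norm_inverse)
    qed
    also have "\<dots> = ((nrm (Bs N) x)\<^sup>2 + (\<Sum>j\<in>Bs N. (inverse (hw j))\<^sup>2)) / 2"
      unfolding nrm_sq by (simp add: sum.distrib sum_divide_distrib[symmetric])
    also have "\<dots> \<le> (b\<^sup>2 + b') / 2"
      using power_mono[OF x[of N], of 2] b'[of N] by simp
    finally show ?thesis .
  qed
  then have cb: "(\<Sum>n\<le>K. sym_pair (\<lambda>j. cmod (c j)) n) \<le> (b\<^sup>2 + b') / 2" for K
  proof -
    obtain N where N: "K \<le> \<kappa> N" using filterlim_\<kappa> by (auto simp: filterlim_at_top eventually_at_top_linorder)
    have "(\<Sum>n\<le>K. sym_pair (\<lambda>j. cmod (c j)) n) \<le> (\<Sum>j\<in>Bs N. cmod (c j))"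
      unfolding sum_sym_pair Bs_eq using N by (intro sum_mono2) auto
    also have "\<dots> \<le> (b\<^sup>2 + b') / 2" by fact
    finally show ?thesis .
  qed
  have sc: "summable (sym_pair (\<lambda>j. cmod (c j)))"
    by (rule bounded_imp_summable[OF _ cb]) (simp add: sym_pair_def)
  define f where "f y = (\<Sum>n. sym_pair (\<lambda>j. c j * fourier_e j y) n)" for y
  have nsym: "norm (sym_pair (\<lambda>j. c j * fourier_e j y) n) \<le> sym_pair (\<lambda>j. cmod (c j)) n" for y n
    unfolding sym_pair_def using norm_triangle_ineq[of "c (int n) * fourier_e (int n) y" "c (- int n) * fourier_e (- int n) y"]
    by (simp add: norm_mult)
  have "uniform_limit UNIV (\<lambda>K y. \<Sum>n<K. sym_pair (\<lambda>j. c j * fourier_e j y) n) f sequentially"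
    unfolding f_def by (rule Weierstrass_m_test[OF nsym sc])
  then have ul: "uniform_limit UNIV (\<lambda>K y. \<Sum>j\<in>{- int K..int K}. c j * fourier_e j y) f sequentially"
    unfolding sum_sym_pair[symmetric] lessThan_Suc_atMost[symmetric] by (rule filterlim_compose[OF _ filterlim_Suc])
  have pc: "continuous_on A (\<lambda>y. \<Sum>j\<in>{- int K..int K}. c j * fourier_e j y)" for K A
    by (intro continuous_intros)
  have f: "continuous_on UNIV f"
    by (rule uniform_limit_theorem[OF always_eventually[OF allI[OF pc]] ul]) simp
  have fp: "periodic1 f" unfolding periodic1_def f_def by (simp add: fourier_e_periodic)
  have hat: "hat f j = c j" for j
  proof -
    let ?p = "\<lambda>K y. (\<Sum>j\<in>{- int K..int K}. c j * fourier_e j y) * cnj (fourier_e j y)"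
    have "uniform_limit {0..1} ?p (\<lambda>y. f y * cnj (fourier_e j y)) sequentially"
    proof (rule uniform_limitI)
      fix e :: real assume "e > 0"
      from uniform_limitD[OF ul this]
      show "\<forall>\<^sub>F K in sequentially. \<forall>y\<in>{0..1}. dist (?p K y) (f y * cnj (fourier_e j y)) < e"
        by eventually_elim (simp add: dist_norm norm_mult flip: left_diff_distrib)
    qed
    then obtain I L where IL: "\<And>K. (?p K has_integral I K) {0..1}"
      "((\<lambda>y. f y * cnj (fourier_e j y)) has_integral L) {0..1}" "I \<longlonglongrightarrow> L"
      by (rule uniform_limit_integral) (auto intro!: continuous_intros)
    have "I K = fc (\<lambda>y. \<Sum>j\<in>{- int K..int K}. c j * fourier_e j y) j" for K
      using integral_unique[OF IL(1)] by (simp add: fc_def)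
    then have I: "I K = (if j \<in> {- int K..int K} then c j else 0)" for K by (simp only: fc_trig[OF finite_atLeastAtMost_int])
    have "eventually (\<lambda>K. I K = c j) sequentially"
      by (rule eventually_sequentiallyI[of "nat \<bar>j\<bar>"]) (auto simp: I)
    then have "I \<longlonglongrightarrow> c j" by (rule tendsto_eventually)
    then have "L = c j" using IL(3) LIMSEQ_unique by blast
    then show ?thesis using hat_continuous[OF f, of j] integral_unique[OF IL(2)] by (simp add: fc_def)
  qed
  have "J f = x"
    using hw_pos less_imp_neq[OF hw_pos] by (auto simp: J_def hat c_def fun_eq_iff)
  moreover have "f \<in> H_space M lam \<theta> R"
    unfolding H_space_iff \<open>J f = x\<close> using L2_I[OF f fp] x by blast
  ultimately show ?thesis by blast
qed

sublocale coordinate_space "H_space M lam \<theta> R" J "H_inner M lam \<theta> R" Bs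
  by unfold_locales (auto intro: finite_Bs incseq_Bs mem_Bs H_inner_tendsto realize_coordinates)

end

subsection \<open>The operators in Fourier coordinates\<close>

text \<open>The derivative is periodic, so T (x + 1) - T x is constant, and being an integer it is
  the degree \<open>D\<close>. \<open>class_CM\<close> concerns complex-valued functions, hence the
  second derivative is obtained as a real part; it is continuous because it is differentiable in
  turn.\<close>

lemma circle_map_expanding:
  assumes lift: "circle_lift T" and diff: "\<And>x. T differentiable (at x)"
    and lam: "lam > 1" "\<And>x. \<bar>deriv T x\<bar> > lam"
    and C: "(\<lambda>x. complex_of_real (deriv T x)) \<in> class_CM M"
  obtains T2 D where "expanding T (deriv T) T2 D lam"
proof -
  let ?h = "\<lambda>x. complex_of_real (deriv T x)"
  define h1 where "h1 x = vector_derivative ?h (at x)" for x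
  have per: "periodic1 ?h" and d: "\<And>k x. nth_deriv k ?h differentiable (at x)" using C by (auto simp: class_CM_def)
  have h: "(?h has_vector_derivative h1 x) (at x)" for x
    using d[of 0 x] unfolding h1_def nth_deriv_def by (simp add: vector_derivative_works)
  have "nth_deriv 1 ?h = h1" by (simp add: nth_deriv_def h1_def fun_eq_iff)
  then have h1: "h1 differentiable (at x)" for x using d[of 1 x] by simp
  have T: "(T has_real_derivative deriv T x) (at x)" for x
    using diff[of x] by (metis DERIV_deriv_iff_real_differentiable)
  have T1: "(deriv T has_real_derivative Re (h1 x)) (at x)" for x
    using bounded_linear.has_vector_derivative[OF bounded_linear_Re h, of x]
    by (simp add: has_real_derivative_iff_has_vector_derivative)
  have T2: "continuous_on UNIV (\<lambda>x. Re (h1 x))"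
    using h1 by (intro continuous_intros continuous_at_imp_continuous_on ballI differentiable_imp_continuous_within)
  have "((\<lambda>x. T (x + 1) - T x) has_real_derivative 0) (at x)" for x
  proof -
    have "deriv T (x + 1) = deriv T x" using per by (simp add: periodic1_def)
    moreover have "((\<lambda>x. T (x + 1)) has_real_derivative deriv T (x + 1)) (at x)"
      using DERIV_shift[of T "deriv T (x + 1)" x 1] T by (simp add: add.commute)
    ultimately show ?thesis using DERIV_diff[OF _ T[of x]] by fastforce
  qed
  then have c: "T (x + 1) - T x = T (0 + 1) - T 0" for x
    using DERIV_isconst_all[of "\<lambda>x. T (x + 1) - T x"] by blast
  obtain D where "T (0 + 1) - T 0 = of_int D" using lift unfolding circle_lift_def by (metis Ints_cases)
  then have "T (x + 1) = T x + of_int D" for x using c[of x] by simp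
  then have "expanding T (deriv T) (\<lambda>x. Re (h1 x)) D lam"
    using T T1 T2 lam by unfold_locales auto
  then show ?thesis by (rule that)
qed

lemma hat_fourier: "hat (\<lambda>x. c * fourier_e k x) j = c * kron k j"
proof -
  have "hat (\<lambda>x. c * fourier_e k x) j = fc (\<lambda>x. c * fourier_e k x) j"
    by (intro hat_continuous continuous_intros fourier_e_cont)
  also have "\<dots> = c * fc (fourier_e k) j" unfolding fc_def by (simp add: mult.assoc)
  finally show ?thesis by (simp only: fc_fourier_e)
qed

lemma fourier_L2: "(\<lambda>x. c * fourier_e k x) \<in> L2"
  by (intro L2_I continuous_intros fourier_e_cont) (simp add: periodic1_def fourier_e_periodic)

locale circle_transfer = weighted_space + expanding T T1 T2 D lam
  for T T1 T2 :: "real \<Rightarrow> real" and D :: int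
begin

lemma proj_fourier:
  "proj \<theta> n (\<lambda>x. c * fourier_e k x) = (if n = lev k then (\<lambda>x. c * fourier_e k x) else (\<lambda>x. 0))"
proof -
  have fin: "finite (freq_block \<theta> n)" unfolding freq_block_eq by (rule finite_block)
  have "proj \<theta> n (\<lambda>x. c * fourier_e k x) x = (\<Sum>i\<in>freq_block \<theta> n. kron k i * (c * fourier_e i x))" for x
    unfolding proj_def hat_fourier by (intro sum.cong) auto
  moreover have "(\<Sum>i\<in>freq_block \<theta> n. kron k i * (c * fourier_e i x)) = (if n = lev k then c * fourier_e k x else 0)" for x
  proof (cases "n = lev k")
    case True
    then have "k \<in> freq_block \<theta> n" by (simp add: freq_block_eq)
    from sum_kron_left[OF fin this, of "\<lambda>i. c * fourier_e i x"] True show ?thesis by simp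
  next
    case False
    then have "(\<Sum>i\<in>freq_block \<theta> n. kron k i * (c * fourier_e i x)) = 0"
      by (intro sum.neutral) (auto simp: freq_block_eq)
    then show ?thesis using False by simp
  qed
  ultimately show ?thesis by auto
qed

lemma hat_transfer: "hat (transfer T (\<lambda>x. c * fourier_e k x)) j = c * mc T j k"
proof -
  have "transfer T (\<lambda>x. c * fourier_e k x) = (\<lambda>x. c * transfer T (fourier_e k) x)"
    by (simp add: transfer_def fun_eq_iff sum_distrib_left mult_ac)
  moreover have "continuous_on UNIV (transfer T (fourier_e k))"
    by (rule T.transfer_continuous[OF fourier_e_periodic1(1) fourier_e_cont(1)])
  ultimately have "hat (transfer T (\<lambda>x. c * fourier_e k x)) j = fc (\<lambda>x. c * transfer T (fourier_e k) x) j"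
    by (simp only:) (intro hat_continuous continuous_intros)
  also have "\<dots> = c * fc (transfer T (fourier_e k)) j" unfolding fc_def by (simp add: mult.assoc)
  finally show ?thesis by (simp only: T.fc_transfer)
qed

lemma L2_norm_fourier: "L2_norm (fourier_e k) = 1"
proof -
  have "(LINT x:{0..<1}|lborel. (cmod (fourier_e k x))\<^sup>2) = integral {0..1::real} (\<lambda>x. 1)"
    by (subst set_integrable_01(2)) (auto intro!: continuous_intros)
  then show ?thesis by (simp add: L2_norm_def)
qed

text \<open>The block estimate is tested on one exponential. Its exponent (m + n) / 2 is at most m,
  as n does not exceed m.\<close>

lemma entry_bound:
  assumes C0: "C0 > 0" and *: "\<And>m n u. u \<in> L2 \<Longrightarrow> n \<le> m \<Longrightarrow>
           L2_norm (proj \<theta> m (transfer T (proj \<theta> n u)))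
             \<le> C0 * wfun M (R / \<theta> ^ m) * \<theta> powr (real (m + n) / 2) * L2_norm (proj \<theta> n u)"
    and l: "lev k \<le> lev j"
  shows "cmod (mc T j k) \<le> C0 * wfun M (R / \<theta> ^ lev j) * \<theta> ^ lev j"
proof -
  have p: "proj \<theta> (lev k) (fourier_e k) = fourier_e k" using proj_fourier[of "lev k" 1 k] by simp
  have L: "fourier_e k \<in> L2" using fourier_L2[of 1 k] by simp
  let ?f = "transfer T (fourier_e k)"
  have fin: "finite (freq_block \<theta> (lev j))" unfolding freq_block_eq by (rule finite_block)
  have "(cmod (hat ?f j))\<^sup>2 \<le> (L2_norm (proj \<theta> (lev j) ?f))\<^sup>2"
    unfolding L2_norm_proj[OF fin]
    by (rule member_le_sum[of j _ "\<lambda>k. (cmod (hat ?f k))\<^sup>2"]) (auto simp: fin, simp add: freq_block_eq)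
  moreover have "L2_norm (proj \<theta> (lev j) ?f) \<ge> 0" unfolding L2_norm_def
    by (intro real_sqrt_ge_zero) (simp add: set_lebesgue_integral_def)
  ultimately have "cmod (hat ?f j) \<le> L2_norm (proj \<theta> (lev j) ?f)" by (rule power2_le_imp_le)
  also have "\<dots> \<le> C0 * wfun M (R / \<theta> ^ lev j) * \<theta> powr (real (lev j + lev k) / 2)"
    using *[OF L l] unfolding p L2_norm_fourier by simp
  also have "\<dots> \<le> C0 * wfun M (R / \<theta> ^ lev j) * \<theta> powr (real (lev j))"
    using C0 wfun_pos[OF W, of "R / \<theta> ^ lev j"] R \<theta> l by (intro mult_left_mono powr_mono) auto
  also have "\<theta> powr (real (lev j)) = \<theta> ^ lev j" using \<theta> by (simp add: powr_realpow)
  finally show ?thesis using hat_transfer[of 1 k j] by simp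
qed

lemma A_trunc_fourier:
  "A_trunc T \<theta> N (\<lambda>x. c * fourier_e k x) x = (\<Sum>i\<in>Bs N. (if lev k \<le> lev i then c * mc T i k else 0) * fourier_e i x)"
proof -
  let ?u = "\<lambda>x. c * fourier_e k x"
  have t0: "transfer T (\<lambda>x. 0) = (\<lambda>x. 0)" by (simp add: transfer_def fun_eq_iff)
  have p0: "proj \<theta> m (\<lambda>x. 0) = (\<lambda>x. 0)" for m by (simp add: proj_def L2_inner_def fun_eq_iff)
  have "(\<Sum>n\<le>m. proj \<theta> m (transfer T (proj \<theta> n ?u)) x) = (if lev k \<le> m then proj \<theta> m (transfer T ?u) x else 0)" for m
  proof -
    have "(\<Sum>n\<le>m. proj \<theta> m (transfer T (proj \<theta> n ?u)) x) = (\<Sum>n\<le>m. if n = lev k then proj \<theta> m (transfer T ?u) x else 0)"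
      by (intro sum.cong refl) (simp add: proj_fourier t0 p0)
    then show ?thesis by simp
  qed
  then have "A_trunc T \<theta> N ?u x = (\<Sum>m\<le>N. if lev k \<le> m then proj \<theta> m (transfer T ?u) x else 0)"
    by (simp add: A_trunc_def)
  also have "\<dots> = (\<Sum>m\<le>N. \<Sum>i\<in>{i. lev i = m}. (if lev k \<le> lev i then c * mc T i k else 0) * fourier_e i x)"
    unfolding proj_def freq_block_eq hat_transfer by (intro sum.cong refl) auto
  also have "\<dots> = (\<Sum>i\<in>Bs N. (if lev k \<le> lev i then c * mc T i k else 0) * fourier_e i x)"
    by (rule sum_Bs_blocks[symmetric])
  finally show ?thesis .
qed

lemma J_le_H_norm:
  assumes "u \<in> H_space M lam \<theta> R"
  shows "cmod (J u j) \<le> H_norm M lam \<theta> R u"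
proof -
  have "(cmod (J u j))\<^sup>2 \<le> (nrm (Bs (lev j)) (J u))\<^sup>2"
    unfolding nrm_sq by (rule member_le_sum[of j _ "\<lambda>j. (cmod (J u j))\<^sup>2"]) (auto simp: finite_Bs mem_Bs)
  also have "\<dots> \<le> (\<Sum>m. H_weight M lam \<theta> R m * (L2_norm (proj \<theta> m u))\<^sup>2)"
    unfolding H_partial[symmetric] using assms H_weight_nonneg
    by (intro sum_le_suminf) (auto simp: H_space_def)
  finally have "cmod (J u j) \<le> sqrt (\<Sum>m. H_weight M lam \<theta> R m * (L2_norm (proj \<theta> m u))\<^sup>2)"
    by (rule real_le_rsqrt)
  then show ?thesis by (simp add: H_norm_def)
qed

text \<open>Convergence in the norm of \<open>H_space\<close> controls each coordinate, and the
  coordinate \<open>j\<close> of the truncated operators no longer changes once N has reached the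
  level of \<open>j\<close>.\<close>

lemma Lc_entry:
  assumes A: "is_Lc M lam T \<theta> R A"
  shows "hat (A (\<lambda>x. c * fourier_e k x)) j = (if lev k \<le> lev j then c * mc T j k else 0)"
proof -
  let ?u = "\<lambda>x. c * fourier_e k x" and ?a = "\<lambda>j. if lev k \<le> lev j then c * mc T j k else 0"
  have Au: "A ?u \<in> L2" using A fourier_L2[of c k] by (auto simp: is_Lc_def H_space_def)
  have AN: "A_trunc T \<theta> N ?u = (\<lambda>x. \<Sum>i\<in>Bs N. ?a i * fourier_e i x)" for N using A_trunc_fourier by auto
  have ANL: "A_trunc T \<theta> N ?u \<in> L2" for N unfolding AN
    by (intro L2_I continuous_intros fourier_e_cont) (simp add: periodic1_def fourier_e_periodic)
  have hatAN: "hat (A_trunc T \<theta> N ?u) j = ?a j" if "lev j \<le> N" for N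
  proof -
    have "hat (A_trunc T \<theta> N ?u) j = fc (\<lambda>x. \<Sum>i\<in>Bs N. ?a i * fourier_e i x) j"
      unfolding AN by (intro hat_continuous continuous_intros fourier_e_cont)
    also have "\<dots> = ?a j" unfolding fc_trig[OF finite_Bs] using that by (simp add: Bs_def)
    finally show ?thesis .
  qed
  have "cmod (hat (A ?u) j - ?a j) \<le> \<epsilon>" if \<epsilon>: "\<epsilon> > 0" for \<epsilon>
  proof -
    \<comment> \<open>Chosen so that \<eta> times the norm of \<open>?u\<close> is at most
      \<open>\<epsilon> * hw j\<close>; the summand 1 keeps the denominator positive.\<close>
    define \<eta> where "\<eta> = \<epsilon> * hw j / (L2_norm ?u + 1)"
    have L0: "L2_norm ?u \<ge> 0" unfolding L2_norm_def by (intro real_sqrt_ge_zero) (simp add: set_lebesgue_integral_def)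
    have \<eta>: "\<eta> > 0" unfolding \<eta>_def using \<epsilon> hw_pos[of j] L0 by simp
    have "\<forall>\<^sub>F N in sequentially. (\<forall>u\<in>L2. (\<lambda>x. A u x - A_trunc T \<theta> N u x) \<in> H_space M lam \<theta> R \<and>
        H_norm M lam \<theta> R (\<lambda>x. A u x - A_trunc T \<theta> N u x) \<le> \<eta> * L2_norm u) \<and> lev j \<le> N"
      using A \<eta> by (intro eventually_conj eventually_ge_at_top) (auto simp: is_Lc_def)
    then obtain N where N: "\<And>u. u \<in> L2 \<Longrightarrow> (\<lambda>x. A u x - A_trunc T \<theta> N u x) \<in> H_space M lam \<theta> R \<and>
        H_norm M lam \<theta> R (\<lambda>x. A u x - A_trunc T \<theta> N u x) \<le> \<eta> * L2_norm u" "lev j \<le> N"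
      by (auto simp: eventually_at_top_linorder)
    let ?d = "\<lambda>x. A ?u x - A_trunc T \<theta> N ?u x"
    have "hat ?d j = hat (A ?u) j - ?a j"
      unfolding hat_diff[OF Au ANL] hatAN[OF N(2)] ..
    then have "hw j * cmod (hat (A ?u) j - ?a j) = cmod (J ?d j)"
      using hw_pos[of j] by (simp only: J_def norm_mult norm_of_real abs_of_pos)
    also have "\<dots> \<le> \<eta> * L2_norm ?u"
      using J_le_H_norm[of ?d j] N(1)[OF fourier_L2[of c k]] by linarith
    also have "\<dots> \<le> \<epsilon> * hw j"
      unfolding \<eta>_def using \<epsilon> hw_pos[of j] L0 by (simp add: divide_le_eq mult_left_mono)
    finally show ?thesis using hw_pos[of j] by (simp add: mult.commute)
  qed
  then have "cmod (hat (A ?u) j - ?a j) \<le> 0" by (rule field_le_epsilon[of _ 0, simplified])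
  then show ?thesis by simp
qed

section \<open>The weighted matrix and its triangular splitting\<close>

definition wm :: "int \<Rightarrow> int \<Rightarrow> complex" where
  "wm j k = of_real (hw j) * mc T j k * inverse (of_real (hw k))"

text \<open>Upper triangular for the levels: the column \<open>k\<close> goes to strictly lower
  frequencies. Passing to lower levels is bounded in the unweighted norm, and the quotient hw j / hw
  k of weights makes it small.\<close>

definition up :: "int \<Rightarrow> int \<Rightarrow> complex" where
  "up j k = (if lev j < lev k then wm j k else 0)"

definition low :: "int \<Rightarrow> int \<Rightarrow> complex" where
  "low j k = (if lev k \<le> lev j then wm j k else 0)"

lemma wm_split: "wm j k = up j k + low j k" by (simp add: up_def low_def)

text \<open>The orthonormal basis of \<open>H_inner\<close> in which the operator has the matrix
  \<open>wm\<close>, so that norms of sections are euclidean.\<close>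

definition basis_fn :: "int \<Rightarrow> real \<Rightarrow> complex" where
  "basis_fn k = (\<lambda>x. of_real (inverse (hw k)) * fourier_e k x)"

lemma J_basis_fn: "J (basis_fn k) = (\<lambda>j. kron j k)"
  unfolding J_def basis_fn_def hat_fourier using hw_pos[of k] by (auto simp: fun_eq_iff)

lemma basis_fn_H: "basis_fn k \<in> H_space M lam \<theta> R"
  unfolding H_space_iff J_basis_fn
proof
  show "basis_fn k \<in> L2" unfolding basis_fn_def by (rule fourier_L2)
  have "nrm (Bs N) (\<lambda>j. kron j k) \<le> 1" for N
  proof -
    have "(\<Sum>i\<in>Bs N. (cmod (kron i k))\<^sup>2) = (\<Sum>i\<in>Bs N. if i = k then 1 else 0)" by (intro sum.cong) auto
    then show ?thesis using finite_Bs[of N] by (simp add: L2_set_def)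
  qed
  then show "\<exists>b. \<forall>N. nrm (Bs N) (\<lambda>j. kron j k) \<le> b" by blast
qed

lemma J_Lc:
  assumes "is_Lc M lam T \<theta> R A"
  shows "J (A (basis_fn k)) j = low j k"
  unfolding J_def basis_fn_def Lc_entry[OF assms] low_def wm_def by simp

lemma up_tri: "\<not> lev j < lev k \<Longrightarrow> up j k = 0" by (simp add: up_def)

lemma T1_ge_1: "\<bar>T1 x\<bar> \<ge> 1" using lam(1) lam(2)[of x] by linarith

text \<open>Weights are constant on blocks, hence a block of \<open>up\<close> is a scalar times a
  block of the unweighted matrix. The latter is a submatrix of a section of norm at most the square
  root of |D|, and \<open>hw_ratio\<close> bounds the scalar.\<close>

lemma up_block:
  assumes "m < n"
  shows "nrm {j\<in>Bs N. lev j = m} (\<lambda>j. \<Sum>k\<in>{k\<in>Bs N. lev k = n}. up j k * x k)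
    \<le> sqrt (of_int \<bar>D\<bar>) * lam ^ (n - m) * (\<Prod>i\<in>{m..<n}. g_fun M \<theta> R i) * nrm {k\<in>Bs N. lev k = n} x"
\<comment> \<open>For \<theta> close to 1 some blocks are empty, and then there is no frequency at
  which to read off the weight of the block.\<close>
proof (cases "{j\<in>Bs N. lev j = m} = {} \<or> {k\<in>Bs N. lev k = n} = {}")
  case True
  have "nrm {j\<in>Bs N. lev j = m} (\<lambda>j. \<Sum>k\<in>{k\<in>Bs N. lev k = n}. up j k * x k) = 0"
    using True
  proof
    assume e: "{j\<in>Bs N. lev j = m} = {}"
    show ?thesis unfolding e by (simp add: L2_set_def)
  next
    assume e: "{k\<in>Bs N. lev k = n} = {}"
    show ?thesis unfolding e by (simp add: L2_set_def)
  qed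
  moreover have "0 \<le> sqrt (of_int \<bar>D\<bar>) * lam ^ (n - m) * (\<Prod>i\<in>{m..<n}. g_fun M \<theta> R i) * nrm {k\<in>Bs N. lev k = n} x"
    using lam(1) less_imp_le[OF g_fun_pos[OF W \<theta> R]]
    by (intro mult_nonneg_nonneg L2_set_nonneg prod_nonneg) auto
  ultimately show ?thesis by (simp only:)
next
  case False
  then obtain j0 k0 where jk: "lev j0 = m" "lev k0 = n" by auto
  let ?r = "hw j0 / hw k0"
  have hw: "hw j = hw j0" if "lev j = m" for j using that jk by (simp add: hw_def)
  have hw': "hw k = hw k0" if "lev k = n" for k using that jk by (simp add: hw_def)
  let ?x = "\<lambda>k. if lev k = n then x k else 0"
  have "nrm {j\<in>Bs N. lev j = m} (\<lambda>j. \<Sum>k\<in>{k\<in>Bs N. lev k = n}. up j k * x k)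
    = nrm {j\<in>Bs N. lev j = m} (\<lambda>j. of_real ?r * (\<Sum>k\<in>Bs N. mc T j k * ?x k))"
  proof (intro L2_set_cong refl arg_cong[where f=cmod])
    fix j assume j: "j \<in> {j\<in>Bs N. lev j = m}"
    have "(\<Sum>k\<in>Bs N. mc T j k * ?x k) = (\<Sum>k\<in>{k\<in>Bs N. lev k = n}. mc T j k * x k)"
      by (intro sum.mono_neutral_cong_right finite_Bs) auto
    moreover have "up j k * x k = of_real ?r * (mc T j k * x k)" if "k \<in> {k\<in>Bs N. lev k = n}" for k
      using j that assms hw[of j] hw'[of k] by (simp add: up_def wm_def divide_inverse)
    ultimately show "(\<Sum>k\<in>{k\<in>Bs N. lev k = n}. up j k * x k) = of_real ?r * (\<Sum>k\<in>Bs N. mc T j k * ?x k)"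
      by (simp only: sum_distrib_left cong: sum.cong)
  qed
  also have "\<dots> = ?r * nrm {j\<in>Bs N. lev j = m} (\<lambda>j. \<Sum>k\<in>Bs N. mc T j k * ?x k)"
    unfolding nrm_scale norm_of_real using hw_pos[of j0] hw_pos[of k0] by simp
  also have "\<dots> \<le> ?r * nrm (Bs N) (\<lambda>j. \<Sum>k\<in>Bs N. mc T j k * ?x k)"
    unfolding L2_set_def using hw_pos[of j0] hw_pos[of k0]
    by (intro mult_left_mono real_sqrt_le_mono sum_mono2 finite_Bs) auto
  also have "\<dots> \<le> ?r * (sqrt (of_int \<bar>D\<bar>) * nrm (Bs N) ?x)"
    using hw_pos[of j0] hw_pos[of k0] T1_ge_1
    by (intro mult_left_mono T.mc_operator_bound finite_Bs) auto
  also have "nrm (Bs N) ?x = nrm {k\<in>Bs N. lev k = n} x"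
    unfolding L2_set_def by (intro arg_cong[where f=sqrt] sum.mono_neutral_cong_right finite_Bs) auto
  also have "?r * (sqrt (of_int \<bar>D\<bar>) * nrm {k\<in>Bs N. lev k = n} x)
    \<le> (lam ^ (n - m) * (\<Prod>i\<in>{m..<n}. g_fun M \<theta> R i)) * (sqrt (of_int \<bar>D\<bar>) * nrm {k\<in>Bs N. lev k = n} x)"
    using hw_ratio[of j0 k0] jk assms by (intro mult_right_mono) auto
  finally show ?thesis by (simp only: mult_ac)
qed

text \<open>The factor at the fixed argument \<open>2 * lam\<close> sums, inside one power, over the
  excess of the change of level beyond \<open>p\<close>; the factor depending on \<open>z\<close>
  sums over the exponents \<open>p\<close> of the Neumann series.\<close>

lemma resolvent_bound:
  "nrm (Bs N) (\<lambda>j. \<Sum>k\<in>Bs N. (\<Sum>p\<le>N. z ^ p * fpow (Bs N) up p j k) * x k)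
    \<le> G_fun M \<theta> R (2 * lam) * G_fun M \<theta> R (2 * lam * sqrt (of_int \<bar>D\<bar>) * cmod z) * nrm (Bs N) x"
proof -
  let ?C = "sqrt (of_int \<bar>D\<bar>)" and ?\<gamma> = "\<lambda>p. \<Prod>k<p. g_fun M \<theta> R k" and ?G = "G_fun M \<theta> R (2 * lam)"
  have lam0: "lam > 0" using lam(1) by simp
  have \<gamma>: "?\<gamma> p > 0" for p using g_fun_pos[OF W \<theta> R] by (intro prod_pos) auto
  have G: "(\<Sum>i<n. (2 * lam) ^ i * ?\<gamma> i) \<le> ?G" for n
  proof -
    have "(\<Sum>i<n. of_real (?\<gamma> i) * (2 * lam) ^ i) \<le> ?G"
      unfolding G_fun_def using \<gamma> lam0 by (intro sum_le_suminf G_summable[OF W \<theta> R]) (auto intro!: mult_nonneg_nonneg less_imp_le)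
    then show ?thesis by (simp add: mult.commute)
  qed
  have b: "nrm (Bs N) (\<lambda>j. \<Sum>k\<in>Bs N. fpow (Bs N) up p j k * x k) \<le> ?G * (2 * lam * ?C) ^ p * ?\<gamma> p * nrm (Bs N) x" for p
    by (rule fpow_triangular_bound[OF finite_Bs _ g_fun_antimono[OF W \<theta> R] g_fun_pos[OF W \<theta> R] _ lam0 up_tri up_block G])
      (auto simp: Bs_def)
  have "(\<Sum>k\<in>Bs N. (\<Sum>p\<le>N. z ^ p * fpow (Bs N) up p j k) * x k) = (\<Sum>p\<le>N. z ^ p * (\<Sum>k\<in>Bs N. fpow (Bs N) up p j k * x k))" for j
    unfolding sum_distrib_right sum_distrib_left mult.assoc by (rule sum.swap)
  then have "nrm (Bs N) (\<lambda>j. \<Sum>k\<in>Bs N. (\<Sum>p\<le>N. z ^ p * fpow (Bs N) up p j k) * x k)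
    \<le> (\<Sum>p\<le>N. nrm (Bs N) (\<lambda>j. z ^ p * (\<Sum>k\<in>Bs N. fpow (Bs N) up p j k * x k)))"
    by (simp only:) (rule nrm_sum, simp)
  also have "\<dots> \<le> (\<Sum>p\<le>N. cmod z ^ p * (?G * (2 * lam * ?C) ^ p * ?\<gamma> p * nrm (Bs N) x))"
    unfolding nrm_scale norm_power by (intro sum_mono mult_left_mono b) auto
  also have "\<dots> = ?G * nrm (Bs N) x * (\<Sum>p\<le>N. of_real (?\<gamma> p) * (2 * lam * ?C * cmod z) ^ p)"
    by (simp add: sum_distrib_left power_mult_distrib mult_ac)
  also have "\<dots> \<le> ?G * nrm (Bs N) x * G_fun M \<theta> R (2 * lam * ?C * cmod z)"
  proof (rule mult_left_mono)
    show "(\<Sum>p\<le>N. of_real (?\<gamma> p) * (2 * lam * ?C * cmod z) ^ p) \<le> G_fun M \<theta> R (2 * lam * ?C * cmod z)"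
      unfolding G_fun_def using less_imp_le[OF \<gamma>] lam0
      by (intro sum_le_suminf G_summable[OF W \<theta> R]) (auto intro!: mult_nonneg_nonneg)
    show "0 \<le> ?G * nrm (Bs N) x" using G_ge_1[OF W \<theta> R, of "2 * lam"] lam0 by simp
  qed
  finally show ?thesis by (simp only: mult_ac)
qed

lemma traces_converge:
  assumes C0: "C0 > 0" and *: "\<And>m n u. u \<in> L2 \<Longrightarrow> n \<le> m \<Longrightarrow>
           L2_norm (proj \<theta> m (transfer T (proj \<theta> n u)))
             \<le> C0 * wfun M (R / \<theta> ^ m) * \<theta> powr (real (m + n) / 2) * L2_norm (proj \<theta> n u)"
    and p: "p \<ge> 1"
  shows "(\<lambda>N. \<Sum>j\<in>Bs N. fpow (Bs N) wm p j j) \<longlonglongrightarrow> of_real (flat_trace T p)"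
proof -
  have hw: "complex_of_real (hw j) \<noteq> 0" for j using hw_pos[of j] by simp
  have "wm = (\<lambda>j k. of_real (hw j) * mc T j k * inverse (of_real (hw k)))" by (simp add: wm_def fun_eq_iff)
  then have "fpow B wm p j j = fpow B (mc T) p j j" for B j
    using fpow_conj[where h="\<lambda>j. complex_of_real (hw j)", OF hw, of B "mc T" p j j] hw[of j] by simp
  moreover have "(\<lambda>N. \<Sum>j\<in>Bs N. fpow (Bs N) (mc T) p j j) \<longlonglongrightarrow> of_real (flat_trace T p)"
    unfolding Bs_def
  proof (rule trace_limit[where \<kappa>=\<kappa> and K="\<lambda>N. 3 * \<theta> ^ N" and \<delta>="\<lambda>m. C0 * wfun M (R / \<theta> ^ m) * \<theta> ^ m"
        and C="sqrt (of_int \<bar>D\<bar>)" and A="\<lambda>p. mc (T ^^ p)"])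
    show "{k. lev k \<le> N} = {- int (\<kappa> N)..int (\<kappa> N)}" for N using Bs_eq[of N] by (simp add: Bs_def)
    show "filterlim \<kappa> at_top sequentially" by (rule filterlim_\<kappa>)
    show "real (card {k. lev k \<le> N}) \<le> 3 * \<theta> ^ N" for N using card_Bs[of N] by (simp add: Bs_def)
    show "cmod (mc T j k) \<le> 1" for j k by (rule mc_le_1[OF T.continuous_V])
    show "cmod (mc T j k) \<le> C0 * wfun M (R / \<theta> ^ lev j) * \<theta> ^ lev j" if "lev k \<le> lev j" for j k
      by (rule entry_bound[OF C0 * that])
    show "0 \<le> C0 * wfun M (R / \<theta> ^ N) * \<theta> ^ N" for N
      using C0 wfun_pos[OF W, of "R / \<theta> ^ N"] R \<theta> by (intro mult_nonneg_nonneg) auto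
    show "summable (\<lambda>N. (3 * \<theta> ^ N) ^ p * (C0 * wfun M (R / \<theta> ^ N) * \<theta> ^ N))" for p
    proof -
      \<comment> \<open>The base \<theta>^(p+1) absorbs \<open>p\<close> powers of the number of
        frequencies and the factor \<theta>^N of the bound on the entries.\<close>
      obtain b where b: "\<And>m. (\<theta> ^ Suc p) ^ m * wfun M (R / \<theta> ^ m) \<le> b * (1/2) ^ m"
        using wfun_superpolynomial[of R "\<theta> ^ Suc p"] R \<theta> by auto
      have "summable (\<lambda>N. 3 ^ p * C0 * (b * (1/2) ^ N) :: real)" by (intro summable_mult summable_geometric) simp
      then show ?thesis
      proof (rule summable_comparison_test'[where N=0])
        fix N
        have e: "(\<theta> ^ N) ^ p * \<theta> ^ N = (\<theta> ^ Suc p) ^ N"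
          by (simp add: power_mult_distrib mult.commute flip: power_mult)
        have "(3 * \<theta> ^ N) ^ p * (C0 * wfun M (R / \<theta> ^ N) * \<theta> ^ N) = 3 ^ p * C0 * (((\<theta> ^ N) ^ p * \<theta> ^ N) * wfun M (R / \<theta> ^ N))"
          by (simp only: power_mult_distrib mult_ac)
        then have "(3 * \<theta> ^ N) ^ p * (C0 * wfun M (R / \<theta> ^ N) * \<theta> ^ N) = 3 ^ p * C0 * ((\<theta> ^ Suc p) ^ N * wfun M (R / \<theta> ^ N))"
          unfolding e .
        moreover have "0 \<le> 3 ^ p * C0 * ((\<theta> ^ Suc p) ^ N * wfun M (R / \<theta> ^ N))"
          using C0 \<theta> R wfun_pos[OF W, of "R / \<theta> ^ N"] by simp
        moreover have "3 ^ p * C0 * ((\<theta> ^ Suc p) ^ N * wfun M (R / \<theta> ^ N)) \<le> 3 ^ p * C0 * (b * (1/2) ^ N)"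
          using C0 by (intro mult_left_mono b) auto
        ultimately show "norm ((3 * \<theta> ^ N) ^ p * (C0 * wfun M (R / \<theta> ^ N) * \<theta> ^ N)) \<le> 3 ^ p * C0 * (b * (1/2) ^ N)"
          by (simp only: real_norm_def abs_of_nonneg)
      qed
    qed
    show "0 \<le> sqrt (of_int \<bar>D\<bar>)" by simp
    show "nrm {k. lev k \<le> N} (\<lambda>j. \<Sum>k\<in>{k. lev k \<le> N}. mc T j k * x k) \<le> sqrt (of_int \<bar>D\<bar>) * nrm {k. lev k \<le> N} x" for N x
      using T.mc_operator_bound[OF finite_Bs T1_ge_1] by (simp only: Bs_def)
    show "\<exists>b\<ge>0. \<forall>m. cmod (mc T j m) \<le> b / (1 + (of_int m)\<^sup>2)" for j
      using mc_decay[of j] by blast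
    show "mc (T ^^ 0) j k = kron j k" for j k
    proof -
      have "mc (T ^^ 0) j k = fc (fourier_e k) j" by (simp add: mc_def fc_def)
      then show ?thesis by (simp add: fc_fourier_e)
    qed
    show "(\<lambda>K. \<Sum>m\<in>{- int K..int K}. mc T j m * mc (T ^^ p) m k) \<longlonglongrightarrow> mc (T ^^ Suc p) j k" for p j k
      by (rule mc_Suc)
    show "(\<lambda>K. \<Sum>m\<in>{- int K..int K}. mc (T ^^ p) m m) \<longlonglongrightarrow> of_real (flat_trace T p)"
      by (rule fixed_points(1)[OF p])
  qed
  ultimately show ?thesis by simp
qed

text \<open>For fixed \<open>N\<close>, the lower part is replaced by the first \<open>q\<close>
  terms of its singular value expansion. This makes it a product through \<open>q\<close>
  dimensions, to which \<open>cmod_fdet_le\<close> applies; the bound survives q -> infinity because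
  the determinant is continuous in finitely many entries.\<close>

lemma determinant_bound:
  assumes A: "is_Lc M lam T \<theta> R A"
    and sv: "singular_values_on (H_space M lam \<theta> R) (H_inner M lam \<theta> R) A s"
    and b: "\<And>q. (\<Prod>l<q. 1 + cmod z * (G_fun M \<theta> R (2 * lam) * G_fun M \<theta> R (2 * lam * sqrt (of_int \<bar>D\<bar>) * cmod z)) * s l) \<le> b"
  shows "cmod (fdet (Bs N) (\<lambda>j k. kron j k - z * wm j k)) \<le> b"
proof -
  let ?H = "H_space M lam \<theta> R" and ?ip = "H_inner M lam \<theta> R" and ?B = "Bs N"
  let ?c = "G_fun M \<theta> R (2 * lam) * G_fun M \<theta> R (2 * lam * sqrt (of_int \<bar>D\<bar>) * cmod z)"
  let ?V = "\<lambda>j k. \<Sum>p\<le>N. z ^ p * fpow ?B up p j k"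
  obtain A' e where adj: "adjoint_on ?H ?ip A A'" and e: "\<And>l. e l \<in> ?H"
      "\<And>k l. ?ip (e k) (e l) = (if k = l then 1 else 0)"
    and ae: "\<And>l. AE x in lborel. A' (A (e l)) x = of_real ((s l)\<^sup>2) * e l x"
    and ker: "\<And>u. u \<in> ?H \<Longrightarrow> (\<And>l. ?ip u (e l) = 0) \<Longrightarrow> AE x in lborel. A' (A u) x = 0"
    and s0: "\<And>l. 0 \<le> s l"
    using sv unfolding singular_values_on_def by blast
  have HL2: "u \<in> ?H \<Longrightarrow> u \<in> L2" for u by (simp add: H_space_def)
  have AH: "A u \<in> ?H" if "u \<in> ?H" for u using A HL2[OF that] by (simp add: is_Lc_def)
  have A'H: "A' u \<in> ?H" if "u \<in> ?H" for u using adj that by (simp add: adjoint_on_def)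
  have adj': "?ip (A u) v = ?ip u (A' v)" if "u \<in> ?H" "v \<in> ?H" for u v using adj that by (simp add: adjoint_on_def)
  have seq: "J (A' (A (e l))) i = of_real ((s l)\<^sup>2) * J (e l) i" for l i
    unfolding J_def hat_AE[OF HL2[OF A'H[OF AH[OF e(1)]]] HL2[OF e(1)] ae[of l]] by simp
  have ker': "J (A' (A u)) i = 0" if "u \<in> ?H" "\<And>l. ?ip u (e l) = 0" for u i
  proof -
    have "AE x in lborel. A' (A u) x = 0 * e 0 x" using ker[OF that] by simp
    from hat_AE[OF HL2[OF A'H[OF AH[OF that(1)]]] HL2[OF e(1)] this] show ?thesis by (simp add: J_def)
  qed
  note ctx = AH A'H adj' e seq ker' basis_fn_H J_basis_fn
  \<comment> \<open>The left singular vectors. The default 0 at a vanishing singular value is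
    harmless: there the coordinates of \<open>A (e l)\<close> vanish as well, by
    \<open>image_combination\<close>.\<close>
  define P where "P j l = (if s l = 0 then 0 else J (A (e l)) j / of_real (s l))" for j l
  define Q where "Q j l = J (e l) j" for j l
  have Q: "nrm ?B (\<lambda>j. \<Sum>l<q. Q j l * x l) \<le> nrm {..<q} x" for q x
  proof (rule power2_le_imp_le)
    show "(nrm ?B (\<lambda>j. \<Sum>l<q. Q j l * x l))\<^sup>2 \<le> (nrm {..<q} x)\<^sup>2"
      unfolding Q_def using orthonormal_combination[where A=A and A'=A' and e=e and s=s and t=basis_fn and q=q and x=x, OF ctx finite_Bs[of N]] by (simp only: nrm_sq)
  qed simp
  have P: "nrm ?B (\<lambda>j. \<Sum>l<q. P j l * x l) \<le> nrm {..<q} x" for q x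
  proof (rule power2_le_imp_le)
    let ?x = "\<lambda>l. if s l = 0 then 0 else x l / of_real (s l)"
    have "(\<Sum>l<q. P j l * x l) = (\<Sum>l<q. J (A (e l)) j * ?x l)" for j
      by (intro sum.cong) (auto simp: P_def)
    then have "(nrm ?B (\<lambda>j. \<Sum>l<q. P j l * x l))\<^sup>2 \<le> (\<Sum>l<q. (s l)\<^sup>2 * (cmod (?x l))\<^sup>2)"
      using image_combination[where A=A and A'=A' and e=e and s=s and t=basis_fn and q=q and x="?x", OF ctx finite_Bs[of N]] by (simp only:)
    also have "\<dots> \<le> (\<Sum>l<q. (cmod (x l))\<^sup>2)"
      by (intro sum_mono) (auto simp: norm_divide power_divide)
    finally show "(nrm ?B (\<lambda>j. \<Sum>l<q. P j l * x l))\<^sup>2 \<le> (nrm {..<q} x)\<^sup>2" by (simp only: nrm_sq)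
  qed simp
  have PQ: "(\<Sum>l<q. P m l * of_real (s l) * cnj (Q k l)) = (\<Sum>l<q. J (A (e l)) m * cnj (J (e l) k))" for q m k
  proof (intro sum.cong refl)
    fix l
    have "J (A (e l)) m = 0" if "s l = 0"
    proof -
      have k1: "(\<Sum>i<Suc l. J (A (e i)) j * kron i l) = J (A (e l)) j" for j
        by (rule sum_kron_right) auto
      have k2: "(\<Sum>i<Suc l. (s i)\<^sup>2 * (cmod (kron i l))\<^sup>2) = 0"
        by (rule sum.neutral) (use that in auto)
      have "(nrm {m} (\<lambda>j. \<Sum>i<Suc l. J (A (e i)) j * kron i l))\<^sup>2 \<le> (\<Sum>i<Suc l. (s i)\<^sup>2 * (cmod (kron i l))\<^sup>2)"
        by (rule image_combination[where A=A and A'=A' and e=e and s=s and t=basis_fn, OF ctx]) simp_all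
      then have "(cmod (J (A (e l)) m))\<^sup>2 \<le> 0" unfolding k1 k2 nrm_sq by simp
      then show ?thesis by simp
    qed
    then show "P m l * of_real (s l) * cnj (Q k l) = J (A (e l)) m * cnj (J (e l) k)"
      by (auto simp: P_def Q_def)
  qed
  have low: "(\<lambda>q. \<Sum>l<q. P m l * of_real (s l) * cnj (Q k l)) \<longlonglongrightarrow> low m k" for m k
    unfolding PQ J_Lc[OF A, symmetric]
    by (rule expansion[where A=A and A'=A' and e=e and s=s and t=basis_fn, OF ctx])
  have eq: "fdet ?B (\<lambda>j k. kron j k - z * wm j k) = fdet ?B (\<lambda>j k. kron j k - z * (\<Sum>m\<in>?B. ?V j m * low m k))"
    unfolding wm_split
  proof (rule fdet_split_triangular[where lev=lev])
    show "finite ?B" by (rule finite_Bs)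
    show "lev j \<le> N" if "j \<in> ?B" for j using that by (simp add: Bs_def)
    show "up j k = 0" if "\<not> lev j < lev k" for j k using that by (rule up_tri)
  qed
  have lim: "(\<lambda>q. fdet ?B (\<lambda>j k. kron j k - z * (\<Sum>m\<in>?B. ?V j m * (\<Sum>l<q. P m l * of_real (s l) * cnj (Q k l)))))
    \<longlonglongrightarrow> fdet ?B (\<lambda>j k. kron j k - z * wm j k)"
    unfolding eq by (rule fdet_tendsto[OF finite_Bs]) (intro tendsto_diff tendsto_mult tendsto_sum tendsto_const low)
  have c0: "?c \<ge> 0"
  proof -
    have "G_fun M \<theta> R (2 * lam) \<ge> 1" "G_fun M \<theta> R (2 * lam * sqrt (of_int \<bar>D\<bar>) * cmod z) \<ge> 1"
      using lam(1) by (intro G_ge_1[OF W \<theta> R]; simp)+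
    then show ?thesis by simp
  qed
  have "cmod (fdet ?B (\<lambda>j k. kron j k - z * (\<Sum>m\<in>?B. ?V j m * (\<Sum>l<q. P m l * of_real (s l) * cnj (Q k l))))) \<le> b" for q
    by (rule order_trans[OF cmod_fdet_le[OF finite_Bs c0 s0 resolvent_bound P Q] b])
  then show ?thesis by (intro LIMSEQ_le_const2[OF tendsto_norm[OF lim]]) auto
qed

end

text \<open>Infinite products and sums are total operators, so the first four conjuncts certify that
  \<open>F_fun\<close> and \<open>G_fun\<close> denote the intended entire functions. The last one
  evaluates them on the real line.\<close>

theorem proposition16:
  fixes M :: "nat \<Rightarrow> real" and lam \<theta> R R' :: real and T :: "real \<Rightarrow> real"
    and Lc :: "(real \<Rightarrow> complex) \<Rightarrow> real \<Rightarrow> complex" and s :: "nat \<Rightarrow> real"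
    and d :: "complex \<Rightarrow> complex"
  assumes "weight_sequence M"
    and "lam > 1"
    and "circle_lift T" and "\<And>x. T differentiable (at x)"
    and "\<And>x. \<bar>deriv T x\<bar> > lam"
    and "(\<lambda>x. complex_of_real (deriv T x)) \<in> class_CM M"
    and "is_dynamical_determinant T d"
    and "1 < \<theta>" and "\<theta> < lam"
    and "R > 0"
    and "\<exists>C0>0. \<forall>m n. \<forall>u\<in>L2. n \<le> m \<longrightarrow>
           L2_norm (proj \<theta> m (transfer T (proj \<theta> n u)))
             \<le> C0 * wfun M (R / \<theta> ^ m) * \<theta> powr (real (m + n) / 2) * L2_norm (proj \<theta> n u)"
    and "is_Lc M lam T \<theta> R Lc"
    and "singular_values_on (H_space M lam \<theta> R) (H_inner M lam \<theta> R) Lc s"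
    and "R' > 0"
    and "\<exists>C1>0. \<forall>l\<ge>1. s l \<le> C1 * real l powr alpha lam \<theta> * wfun M (R' / real l)"
  shows "(\<forall>z::complex. convergent_prod (\<lambda>m. 1 + of_real (f_fun M lam \<theta> R' (real (Suc m))) * z)) \<and>
         (F_fun M lam \<theta> R' :: complex \<Rightarrow> complex) holomorphic_on UNIV \<and>
         (\<forall>z::complex. summable (\<lambda>n. of_real (\<Prod>k<n. g_fun M \<theta> R k) * z ^ n)) \<and>
         (G_fun M \<theta> R :: complex \<Rightarrow> complex) holomorphic_on UNIV \<and>
         (\<exists>C>0. \<forall>z. cmod (d z) \<le> F_fun M lam \<theta> R' (C * cmod z * G_fun M \<theta> R (C * cmod z)))"
proof (intro conjI allI)
  note W = assms(1) and \<theta> = assms(8) and R = assms(10) and R' = assms(14)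
  show "convergent_prod (\<lambda>m. 1 + of_real (f_fun M lam \<theta> R' (real (Suc m))) * z)" for z :: complex
    by (rule F_convergent[OF W R'])
  show "(F_fun M lam \<theta> R' :: complex \<Rightarrow> complex) holomorphic_on UNIV"
    by (rule F_holomorphic[OF W R'])
  show "summable (\<lambda>n. of_real (\<Prod>k<n. g_fun M \<theta> R k) * z ^ n)" for z :: complex
    by (rule G_summable[OF W \<theta> R])
  show "(G_fun M \<theta> R :: complex \<Rightarrow> complex) holomorphic_on UNIV"
    by (rule G_holomorphic[OF W \<theta> R])
  obtain T2 D where ex: "expanding T (deriv T) T2 D lam"
    using circle_map_expanding[OF assms(3,4,2,5,6)] by blast
  interpret circle_transfer M lam \<theta> R T "deriv T" T2 D
    using ex W assms(2) \<theta> R by (intro circle_transfer.intro weighted_space.intro)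
  obtain C0 where C0: "C0 > 0" "\<And>m n u. u \<in> L2 \<Longrightarrow> n \<le> m \<Longrightarrow>
           L2_norm (proj \<theta> m (transfer T (proj \<theta> n u)))
             \<le> C0 * wfun M (R / \<theta> ^ m) * \<theta> powr (real (m + n) / 2) * L2_norm (proj \<theta> n u)"
    using assms(11) by blast
  obtain C1 where C1: "C1 > 0" "\<And>l. l \<ge> 1 \<Longrightarrow> s l \<le> C1 * real l powr alpha lam \<theta> * wfun M (R' / real l)"
    using assms(15) by blast
  have s0: "s l \<ge> 0" for l using assms(13) by (simp add: singular_values_on_def)
  \<comment> \<open>The part of the resolvent bound which does not depend on z.\<close>
  define Gs where "Gs = G_fun M \<theta> R (2 * lam)"
  have Gs: "Gs \<ge> 1" unfolding Gs_def using assms(2) by (intro G_ge_1[OF W \<theta> R]) simp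
  define b where "b = 2 * lam * sqrt (of_int \<bar>D\<bar>)"
  have b0: "b \<ge> 0" unfolding b_def using assms(2) by simp
  \<comment> \<open>Each summand serves one purpose: \<open>b\<close> enlarges the argument of
    \<open>G_fun\<close>, \<open>Gs * s 0\<close> handles the first singular value,
    \<open>Gs * C1\<close> all others, and 1 makes \<open>C\<close> positive.\<close>
  define C where "C = b + Gs * (s 0 + C1) + 1"
  have GsC: "0 \<le> Gs * s 0" "0 \<le> Gs * C1" using Gs s0[of 0] C1(1) by (auto intro!: mult_nonneg_nonneg)
  then have C: "C > 0" "b \<le> C" "Gs * s 0 \<le> C" "Gs * C1 \<le> C"
    using b0 by (auto simp: C_def distrib_left)
  let ?y = "\<lambda>r. C * r * G_fun M \<theta> R (C * r)"
  have prod_bound: "(\<Prod>l<q. 1 + cmod z * (Gs * G_fun M \<theta> R (b * cmod z)) * s l) \<le> F_fun M lam \<theta> R' (?y (cmod z))" for q z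
  proof -
    let ?r = "cmod z" let ?c = "Gs * G_fun M \<theta> R (b * ?r)"
    have G: "1 \<le> G_fun M \<theta> R (b * ?r)" "G_fun M \<theta> R (b * ?r) \<le> G_fun M \<theta> R (C * ?r)"
      using b0 C by (auto intro!: G_ge_1[OF W \<theta> R] G_mono[OF W \<theta> R] mult_right_mono)
    have y0: "?y ?r \<ge> 0" using C G by (intro mult_nonneg_nonneg) auto
    have le: "?r * ?c * s l \<le> t * ?y ?r" if "Gs * s l \<le> C * t" for l t
    proof -
      have "?r * ?c * s l = (Gs * s l) * (?r * G_fun M \<theta> R (b * ?r))" by simp
      also have "\<dots> \<le> (C * t) * (?r * G_fun M \<theta> R (C * ?r))"
      proof (rule mult_mono[OF that])
        show "?r * G_fun M \<theta> R (b * ?r) \<le> ?r * G_fun M \<theta> R (C * ?r)" by (rule mult_left_mono[OF G(2)]) simp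
        have "0 \<le> Gs * s l" using Gs s0[of l] by simp
        then show "0 \<le> C * t" using that by linarith
        show "0 \<le> ?r * G_fun M \<theta> R (b * ?r)" using G by simp
      qed
      finally show ?thesis by (simp add: mult_ac)
    qed
    have nn: "0 \<le> ?r * ?c * s l" for l using Gs G s0[of l] by (intro mult_nonneg_nonneg) auto
    \<comment> \<open>A further factor, at least 1, is appended so that exactly \<open>q\<close>
      factors remain once index 0 is split off; that one is matched with the factor 1 + z of
      \<open>F_fun\<close>.\<close>
    have "(\<Prod>l<q. 1 + ?r * ?c * s l) \<le> (\<Prod>l<Suc q. 1 + ?r * ?c * s l)"
      using nn[of q] mult_left_mono[of 1 "1 + ?r * ?c * s q" "\<Prod>l<q. 1 + ?r * ?c * s l"] prod_nonneg[of "{..<q}" "\<lambda>l. 1 + ?r * ?c * s l"] nn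
      by (simp add: add_nonneg_nonneg)
    also have "\<dots> = (1 + ?r * ?c * s 0) * (\<Prod>l<q. 1 + ?r * ?c * s (Suc l))"
      by (rule prod.lessThan_Suc_shift)
    also have "\<dots> \<le> (1 + ?y ?r) * (\<Prod>m<q. 1 + f_fun M lam \<theta> R' (real (Suc m)) * ?y ?r)"
    proof (rule mult_mono)
      show "1 + ?r * ?c * s 0 \<le> 1 + ?y ?r" using le[of 0 1] C(3) by simp
      show "(\<Prod>l<q. 1 + ?r * ?c * s (Suc l)) \<le> (\<Prod>m<q. 1 + f_fun M lam \<theta> R' (real (Suc m)) * ?y ?r)"
      proof (rule prod_mono, intro conjI)
        fix m
        show "0 \<le> 1 + ?r * ?c * s (Suc m)" using nn[of "Suc m"] by linarith
        have f0: "f_fun M lam \<theta> R' (real (Suc m)) \<ge> 0" by (rule f_fun_nonneg[OF W R']) simp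
        have "s (Suc m) \<le> C1 * f_fun M lam \<theta> R' (real (Suc m))"
          using C1(2)[of "Suc m"] by (simp add: f_fun_def mult.assoc)
        then have "Gs * s (Suc m) \<le> Gs * (C1 * f_fun M lam \<theta> R' (real (Suc m)))"
          using Gs by (intro mult_left_mono) auto
        also have "\<dots> \<le> C * f_fun M lam \<theta> R' (real (Suc m))"
          unfolding mult.assoc[symmetric] by (rule mult_right_mono[OF C(4) f0])
        finally show "1 + ?r * ?c * s (Suc m) \<le> 1 + f_fun M lam \<theta> R' (real (Suc m)) * ?y ?r"
          using le by simp
      qed
      show "0 \<le> 1 + ?y ?r" using y0 by linarith
      show "0 \<le> (\<Prod>l<q. 1 + ?r * ?c * s (Suc l))"
        by (intro prod_nonneg ballI add_nonneg_nonneg nn) simp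
    qed
    also have "\<dots> \<le> F_fun M lam \<theta> R' (?y ?r)" by (rule prod_le_F[OF W R' y0])
    finally show ?thesis .
  qed
  have "cmod (d z) \<le> F_fun M lam \<theta> R' (?y (cmod z))" for z
  proof (rule determinant_limit_bound[where t="\<lambda>n. of_real (flat_trace T n)" and B=Bs and a=wm
        and K="2 / (lam - 1)" and D="of_int \<bar>D\<bar> + 1" and \<Phi>="\<lambda>r. F_fun M lam \<theta> R' (?y r)"])
    show "d holomorphic_on UNIV"
      "\<forall>\<^sub>F z in nhds 0. d z = exp (- (\<Sum>n. 1 / of_nat (Suc n) * of_real (flat_trace T (Suc n)) * z ^ Suc n))"
      using assms(7) by (simp_all only: is_dynamical_determinant_def)
    show "cmod (of_real (flat_trace T (Suc n))) \<le> 2 / (lam - 1) * (of_int \<bar>D\<bar> + 1) ^ Suc n" for n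
    proof -
      let ?D = "of_int \<bar>D\<bar> :: real"
      have "cmod (of_real (flat_trace T (Suc n))) = flat_trace T (Suc n)"
        using fixed_points(3)[of "Suc n"] by simp
      also have "\<dots> \<le> (?D ^ Suc n + 1) / (lam - 1)" by (rule fixed_points(2)) simp
      \<comment> \<open>The base is raised by 1 to bring the sum of a power and 1 into the purely
        geometric form that \<open>exp_trace_newton\<close> expects.\<close>
      also have "\<dots> \<le> (2 * (?D + 1) ^ Suc n) / (lam - 1)"
      proof (rule divide_right_mono)
        have "?D ^ Suc n \<le> (?D + 1) ^ Suc n" by (rule power_mono) auto
        moreover have "1 \<le> (?D + 1) ^ Suc n" by (rule one_le_power) simp
        ultimately show "?D ^ Suc n + 1 \<le> 2 * (?D + 1) ^ Suc n" by linarith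
      qed (use assms(2) in simp)
      finally show ?thesis by simp
    qed
    show "(0::real) < of_int \<bar>D\<bar> + 1" by simp
    show "finite (Bs N)" for N by (rule finite_Bs)
    show "(\<lambda>N. \<Sum>j\<in>Bs N. fpow (Bs N) wm p j j) \<longlonglongrightarrow> of_real (flat_trace T p)" if "p \<ge> 1" for p
      by (rule traces_converge[OF C0 that])
    show "cmod (fdet (Bs N) (\<lambda>j k. kron j k - z * wm j k)) \<le> F_fun M lam \<theta> R' (?y (cmod z))" for N z
      by (rule determinant_bound[OF assms(12,13)]) (rule prod_bound[unfolded Gs_def b_def])
  qed
  then show "\<exists>C>0. \<forall>z. cmod (d z) \<le> F_fun M lam \<theta> R' (C * cmod z * G_fun M \<theta> R (C * cmod z))"
    using C(1) by blast
qed

end
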